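(* Let $\mathbb{K}$ be a field and let $G$ be a finite group acting on a space $X$ whose cohomology with coefficients in $\mathbb{K}$ is locally finite. Suppose that the characteristic of $\mathbb{K}$ is coprime with $|G|$. Then, as an algebra, $$H^*(EG\times_GX;\mathbb{K})\cong\mathbb{K}\,\Box_{\mathbb{K}[G]^\vee}H^*(X;\mathbb{K}),$$ where the right-hand side is the cotensor product of the trivial right $\mathbb{K}[G]^\vee$-comodule $\mathbb{K}$ and the left $\mathbb{K}[G]^\vee$-comodule $H^*(X;\mathbb{K})$.
   Context: $EG\times_GX$ is the Borel construction. Locally finite means finite dimensional in each degree. "Characteristic coprime with $|G|$" means $|G|$ is invertible in $\mathbb{K}$ (characteristic $0$ allowed). $\mathbb{K}[G]^\vee=H^*(G;\mathbb{K})$ is the dual Hopf algebra of the group ring. $H^*(X;\mathbb{K})$ is a left $\mathbb{K}[G]^\vee$-comodule via $\nabla:H^*(X)\to H^*(G\times X)\cong\mathbb{K}[G]^\vee\otimes H^*(X)$ induced by the action; since $\nabla$ is a morphism of algebras, the cotensor product $\{x\in H^*(X;\mathbb{K})\mid\nabla(x)=1\otimes x\}$ is a subalgebra of $H^*(X;\mathbb{K})$. *)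

theory Defs
  imports "HOL-Homology.Homology" "HOL-Algebra.Group_Action" "HOL-Algebra.QuotRing"
    "HOL-Algebra.Module"
begin

section \<open>The singular cohomology algebra\<close>

type_synonym 'a simplex = "(nat \<Rightarrow> real) \<Rightarrow> 'a"

text \<open>An element of the direct sum of all singular cochain groups \<open>C\<^sup>n(X; K)\<close>, as a function of the
  degree \<open>n\<close>. A cochain is normalised to vanish on functions that are not singular simplices.\<close>

type_synonym ('a, 'k) cochain = "nat \<Rightarrow> 'a simplex \<Rightarrow> 'k"

type_synonym ('a, 'k) cohomology = "('k, ('a, 'k) cochain set) module"

definition cochains :: "'a topology \<Rightarrow> ('a, 'k::field) cochain set" where
  "cochains X = {c. (\<forall>n s. \<not> singular_simplex n X s \<longrightarrow> c n s = 0) \<and> finite {n. c n \<noteq> (\<lambda>s. 0)}}"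

definition coboundary :: "'a topology \<Rightarrow> ('a, 'k::field) cochain \<Rightarrow> ('a, 'k) cochain" where
  "coboundary X c = (\<lambda>n s. if 0 < n \<and> singular_simplex n X s
     then \<Sum>i\<le>n. (-1) ^ i * c (n - 1) (singular_face n i s) else 0)"

definition cocycles :: "'a topology \<Rightarrow> ('a, 'k::field) cochain set" where
  "cocycles X = {c \<in> cochains X. coboundary X c = (\<lambda>n s. 0)}"

definition coboundaries :: "'a topology \<Rightarrow> ('a, 'k::field) cochain set" where
  "coboundaries X = coboundary X ` cochains X"

text \<open>For an \<open>n\<close>-simplex with vertices \<open>v\<^sub>0, \<dots>, v\<^sub>n\<close>, the faces spanned by \<open>v\<^sub>0, \<dots>, v\<^sub>p\<close> and
  by \<open>v\<^sub>p, \<dots>, v\<^sub>n\<close>, where \<open>q = n - p\<close>.\<close>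

definition front_face :: "nat \<Rightarrow> 'a simplex \<Rightarrow> 'a simplex" where
  "front_face p s = restrict s (standard_simplex p)"

definition back_face :: "nat \<Rightarrow> nat \<Rightarrow> 'a simplex \<Rightarrow> 'a simplex" where
  "back_face p q s = restrict (\<lambda>x. s (\<lambda>i. if i < p then 0 else x (i - p))) (standard_simplex q)"

definition cup :: "'a topology \<Rightarrow> ('a, 'k::field) cochain \<Rightarrow> ('a, 'k) cochain \<Rightarrow> ('a, 'k) cochain" where
  "cup X c d = (\<lambda>n s. if singular_simplex n X s
     then \<Sum>p\<le>n. c p (front_face p s) * d (n - p) (back_face p (n - p) s) else 0)"

definition cocycle_ring :: "'a topology \<Rightarrow> ('a, 'k::field) cochain ring" where
  "cocycle_ring X =
    \<lparr>carrier = cocycles X,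
     mult = cup X,
     one = (\<lambda>n s. if n = 0 \<and> singular_simplex n X s then 1 else 0),
     zero = (\<lambda>n s. 0),
     add = (\<lambda>c d n s. c n s + d n s)\<rparr>"

definition cohomology_class ::
    "'a topology \<Rightarrow> ('a, 'k::field) cochain \<Rightarrow> ('a, 'k) cochain set" where
  "cohomology_class X c = coboundaries X +>\<^bsub>cocycle_ring X\<^esub> c"

definition cohomology_algebra :: "'a topology \<Rightarrow> ('a, 'k::field) cohomology" where
  "cohomology_algebra X = ring.extend (cocycle_ring X Quot coboundaries X)
     (module.fields (\<lambda>a A. \<Union>c\<in>A. cohomology_class X (\<lambda>n s. a * c n s)))"

definition cohomology_group :: "nat \<Rightarrow> 'a topology \<Rightarrow> ('a, 'k::field) cochain set set" where
  "cohomology_group n X =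
    {cohomology_class X c | c. c \<in> cocycles X \<and> (\<forall>m. m \<noteq> n \<longrightarrow> c m = (\<lambda>s. 0))}"

definition pullback_cochain ::
    "'a topology \<Rightarrow> ('a \<Rightarrow> 'b) \<Rightarrow> ('b, 'k::field) cochain \<Rightarrow> ('a, 'k) cochain" where
  "pullback_cochain X f c = (\<lambda>n s. if singular_simplex n X s then c n (simplex_map n f s) else 0)"

definition induced_map ::
    "'a topology \<Rightarrow> ('a \<Rightarrow> 'b) \<Rightarrow> ('b, 'k::field) cochain set \<Rightarrow> ('a, 'k) cochain set" where
  "induced_map X f A = (\<Union>c\<in>A. cohomology_class X (pullback_cochain X f c))"

definition finite_dimensional :: "('k::field, 'v) module \<Rightarrow> 'v set \<Rightarrow> bool" where
  "finite_dimensional M V \<longleftrightarrow>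
    (\<exists>S. finite S \<and> S \<subseteq> V \<and> (\<forall>x\<in>V. \<exists>a. x = (\<Oplus>\<^bsub>M\<^esub>v\<in>S. a v \<odot>\<^bsub>M\<^esub> v)))"

definition locally_finite_cohomology :: "'k::field itself \<Rightarrow> 'a topology \<Rightarrow> bool" where
  "locally_finite_cohomology _ X \<longleftrightarrow>
    (\<forall>n. finite_dimensional (cohomology_algebra X :: ('a, 'k) cohomology) (cohomology_group n X))"

definition graded_algebra_iso ::
    "('k::field, 'v) module \<Rightarrow> (nat \<Rightarrow> 'v set) \<Rightarrow> ('k, 'w) module \<Rightarrow> (nat \<Rightarrow> 'w set) \<Rightarrow> ('v \<Rightarrow> 'w) set"
  where
  "graded_algebra_iso A A_deg B B_deg =
    {h \<in> ring_iso A B. (\<forall>a. \<forall>x\<in>carrier A. h (a \<odot>\<^bsub>A\<^esub> x) = a \<odot>\<^bsub>B\<^esub> h x) \<and>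
      (\<forall>n. h ` A_deg n = B_deg n)}"


section \<open>Tensor products over \<open>K\<close> and the cohomology cross product\<close>

text \<open>\<open>M \<otimes> N\<close> is the vector space of formal \<open>K\<close>-linear combinations of pairs (finitely supported
  functions) modulo the bilinearity relations. Since every relation below carries an arbitrary
  coefficient \<open>a\<close>, closure under addition already yields a linear subspace.\<close>

definition tensor_free :: "('k::field, 'v) module \<Rightarrow> ('k, 'w) module \<Rightarrow> ('v \<times> 'w \<Rightarrow>\<^sub>0 'k) set" where
  "tensor_free M N = {u. Poly_Mapping.keys u \<subseteq> carrier M \<times> carrier N}"

inductive_set tensor_relations ::
    "('k::field, 'v) module \<Rightarrow> ('k, 'w) module \<Rightarrow> ('v \<times> 'w \<Rightarrow>\<^sub>0 'k) set"
  for M :: "('k::field, 'v) module" and N :: "('k, 'w) module" where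
  zero: "0 \<in> tensor_relations M N"
| add: "u \<in> tensor_relations M N \<Longrightarrow> v \<in> tensor_relations M N \<Longrightarrow> u + v \<in> tensor_relations M N"
| add_left: "x \<in> carrier M \<Longrightarrow> x' \<in> carrier M \<Longrightarrow> y \<in> carrier N \<Longrightarrow>
    Poly_Mapping.single (x \<oplus>\<^bsub>M\<^esub> x', y) a - Poly_Mapping.single (x, y) a
      - Poly_Mapping.single (x', y) a \<in> tensor_relations M N"
| add_right: "x \<in> carrier M \<Longrightarrow> y \<in> carrier N \<Longrightarrow> y' \<in> carrier N \<Longrightarrow>
    Poly_Mapping.single (x, y \<oplus>\<^bsub>N\<^esub> y') a - Poly_Mapping.single (x, y) a
      - Poly_Mapping.single (x, y') a \<in> tensor_relations M N"
| smult_left: "x \<in> carrier M \<Longrightarrow> y \<in> carrier N \<Longrightarrow>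
    Poly_Mapping.single (b \<odot>\<^bsub>M\<^esub> x, y) a - Poly_Mapping.single (x, y) (a * b) \<in> tensor_relations M N"
| smult_right: "x \<in> carrier M \<Longrightarrow> y \<in> carrier N \<Longrightarrow>
    Poly_Mapping.single (x, b \<odot>\<^bsub>N\<^esub> y) a - Poly_Mapping.single (x, y) (a * b) \<in> tensor_relations M N"

definition tensor_class ::
    "('k::field, 'v) module \<Rightarrow> ('k, 'w) module \<Rightarrow> ('v \<times> 'w \<Rightarrow>\<^sub>0 'k) \<Rightarrow> ('v \<times> 'w \<Rightarrow>\<^sub>0 'k) set" where
  "tensor_class M N u = {v \<in> tensor_free M N. v - u \<in> tensor_relations M N}"

definition tensor_space ::
    "('k::field, 'v) module \<Rightarrow> ('k, 'w) module \<Rightarrow> ('v \<times> 'w \<Rightarrow>\<^sub>0 'k) set set" where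
  "tensor_space M N = tensor_class M N ` tensor_free M N"

definition pure_tensor ::
    "('k::field, 'v) module \<Rightarrow> ('k, 'w) module \<Rightarrow> 'v \<Rightarrow> 'w \<Rightarrow> ('v \<times> 'w \<Rightarrow>\<^sub>0 'k) set" where
  "pure_tensor M N x y = tensor_class M N (Poly_Mapping.single (x, y) 1)"

text \<open>The linear map into \<open>P\<close> induced by a bilinear map \<open>f\<close>.\<close>

definition tensor_lift ::
    "('k::field, 'p) module \<Rightarrow> ('v \<Rightarrow> 'w \<Rightarrow> 'p) \<Rightarrow> ('v \<times> 'w \<Rightarrow>\<^sub>0 'k) set \<Rightarrow> 'p" where
  "tensor_lift P f T = the_elem ((\<lambda>u. \<Oplus>\<^bsub>P\<^esub>z\<in>Poly_Mapping.keys u.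
     Poly_Mapping.lookup u z \<odot>\<^bsub>P\<^esub> f (fst z) (snd z)) ` T)"

definition cross_product :: "'a topology \<Rightarrow> 'b topology \<Rightarrow>
    ('a, 'k::field) cochain set \<Rightarrow> ('b, 'k) cochain set \<Rightarrow> ('a \<times> 'b, 'k) cochain set" where
  "cross_product X Y A B = induced_map (prod_topology X Y) fst A
     \<otimes>\<^bsub>cohomology_algebra (prod_topology X Y)\<^esub> induced_map (prod_topology X Y) snd B"

definition kunneth_map :: "'a topology \<Rightarrow> 'b topology \<Rightarrow>
    (('a, 'k::field) cochain set \<times> ('b, 'k) cochain set \<Rightarrow>\<^sub>0 'k) set \<Rightarrow> ('a \<times> 'b, 'k) cochain set" where
  "kunneth_map X Y = tensor_lift (cohomology_algebra (prod_topology X Y)) (cross_product X Y)"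


section \<open>The coaction of the dual group algebra and the cotensor product\<close>

definition continuous_action ::
    "('g, 'm) monoid_scheme \<Rightarrow> 'a topology \<Rightarrow> ('g \<Rightarrow> 'a \<Rightarrow> 'a) \<Rightarrow> bool" where
  "continuous_action G X \<phi> \<longleftrightarrow>
    group_action G (topspace X) \<phi> \<and> (\<forall>g\<in>carrier G. continuous_map X X (\<phi> g))"

abbreviation discrete_group :: "('g, 'm) monoid_scheme \<Rightarrow> 'g topology" where
  "discrete_group G \<equiv> discrete_topology (carrier G)"

text \<open>The dual \<open>K[G]\<^sup>\<or>\<close> of the group algebra of a finite group \<open>G\<close>, realised as the cohomology of the
  discrete space \<open>G\<close>, that is, as the algebra of functions \<open>G \<rightarrow> K\<close>, in degree \<open>0\<close>.\<close>

abbreviation dual_group_algebra :: "('g, 'm) monoid_scheme \<Rightarrow> ('g, 'k::field) cohomology" where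
  "dual_group_algebra G \<equiv> cohomology_algebra (discrete_group G)"

text \<open>The composite \<open>H\<^sup>*(X) \<rightarrow> H\<^sup>*(G \<times> X) \<cong> K[G]\<^sup>\<or> \<otimes> H\<^sup>*(X)\<close> of the map induced by the action and the
  inverse of the Kunneth isomorphism (the latter is bijective because \<open>G\<close> is finite and discrete).\<close>

definition coaction :: "('g, 'm) monoid_scheme \<Rightarrow> 'a topology \<Rightarrow> ('g \<Rightarrow> 'a \<Rightarrow> 'a) \<Rightarrow>
    ('a, 'k::field) cochain set \<Rightarrow> (('g, 'k) cochain set \<times> ('a, 'k) cochain set \<Rightarrow>\<^sub>0 'k) set" where
  "coaction G X \<phi> x =
    inv_into (tensor_space (dual_group_algebra G) (cohomology_algebra X))
      (kunneth_map (discrete_group G) X)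
      (induced_map (prod_topology (discrete_group G) X) (\<lambda>(g, y). \<phi> g y) x)"

text \<open>The cotensor product \<open>K \<box>\<^sub>C N\<close> of the trivial right comodule \<open>K\<close> with a left comodule algebra
  \<open>(N, \<nabla>)\<close>: after the identification \<open>K \<otimes> N \<cong> N\<close>, the equaliser of \<open>\<nabla>\<close> and \<open>x \<mapsto> 1 \<otimes> x\<close>.\<close>

definition trivial_cotensor :: "('k::field, 'c) module \<Rightarrow> ('k, 'v) module \<Rightarrow>
    ('v \<Rightarrow> ('c \<times> 'v \<Rightarrow>\<^sub>0 'k) set) \<Rightarrow> ('k, 'v) module" where
  "trivial_cotensor C N coact =
    N\<lparr>carrier := {x \<in> carrier N. coact x = pure_tensor C N \<one>\<^bsub>C\<^esub> x}\<rparr>"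

abbreviation cotensor_cohomology ::
    "('g, 'm) monoid_scheme \<Rightarrow> 'a topology \<Rightarrow> ('g \<Rightarrow> 'a \<Rightarrow> 'a) \<Rightarrow> ('a, 'k::field) cohomology" where
  "cotensor_cohomology G X \<phi> \<equiv>
    trivial_cotensor (dual_group_algebra G) (cohomology_algebra X) (coaction G X \<phi>)"


section \<open>The Borel construction\<close>

text \<open>A model of \<open>EG\<close> for a discrete group \<open>G\<close>: a contractible total space of a principal \<open>G\<close>-bundle.
  Local triviality of \<open>E \<rightarrow> E/G\<close> says that every point has a neighbourhood whose translates are
  disjoint. The usual right action on \<open>E\<close> is turned into a left one via \<open>g \<cdot> e = e \<cdot> g\<^sup>-\<^sup>1\<close>.
  Nonemptiness is explicit because \<^const>\<open>contractible_space\<close> holds for the empty space.\<close>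

definition universal_G_space ::
    "('g, 'm) monoid_scheme \<Rightarrow> 'e topology \<Rightarrow> ('g \<Rightarrow> 'e \<Rightarrow> 'e) \<Rightarrow> bool" where
  "universal_G_space G E \<psi> \<longleftrightarrow>
    continuous_action G E \<psi> \<and> topspace E \<noteq> {} \<and> contractible_space E \<and>
    (\<forall>e\<in>topspace E. \<exists>U. openin E U \<and> e \<in> U \<and>
      (\<forall>g\<in>carrier G. g \<noteq> \<one>\<^bsub>G\<^esub> \<longrightarrow> \<psi> g ` U \<inter> U = {}))"

definition quotient_topology :: "'a topology \<Rightarrow> ('a \<Rightarrow> 'b) \<Rightarrow> 'b topology" where
  "quotient_topology X f =
    topology (\<lambda>U. U \<subseteq> f ` topspace X \<and> openin X {x \<in> topspace X. f x \<in> U})"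

lemma openin_quotient_topology:
  "openin (quotient_topology X f) U \<longleftrightarrow>
    U \<subseteq> f ` topspace X \<and> openin X {x \<in> topspace X. f x \<in> U}"
proof -
  have "istopology (\<lambda>U. U \<subseteq> f ` topspace X \<and> openin X {x \<in> topspace X. f x \<in> U})"
  proof (unfold istopology_def, intro conjI allI impI; (elim conjE)?)
    fix S T
    assume "openin X {x \<in> topspace X. f x \<in> S}" "openin X {x \<in> topspace X. f x \<in> T}"
    then have "openin X ({x \<in> topspace X. f x \<in> S} \<inter> {x \<in> topspace X. f x \<in> T})"
      by blast
    then show "openin X {x \<in> topspace X. f x \<in> S \<inter> T}"
      by (rule back_subst) auto
  next
    fix \<K>
    assume "\<forall>K\<in>\<K>. K \<subseteq> f ` topspace X \<and> openin X {x \<in> topspace X. f x \<in> K}"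
    then have "openin X (\<Union>K\<in>\<K>. {x \<in> topspace X. f x \<in> K})"
      by blast
    then show "openin X {x \<in> topspace X. f x \<in> \<Union> \<K>}"
      by (rule back_subst) auto
  qed blast+
  then show ?thesis
    by (simp add: quotient_topology_def topology_inverse')
qed

lemma topspace_quotient_topology: "topspace (quotient_topology X f) = f ` topspace X"
proof
  have "openin X {x \<in> topspace X. f x \<in> f ` topspace X}"
    using openin_topspace[of X] by (rule back_subst) auto
  then show "f ` topspace X \<subseteq> topspace (quotient_topology X f)"
    by (intro openin_subset) (simp add: openin_quotient_topology)
qed (use openin_quotient_topology[of X f] openin_topspace in blast)

lemma quotient_map_quotient_topology: "quotient_map X (quotient_topology X f) f"
  by (auto simp: quotient_map_def topspace_quotient_topology openin_quotient_topology)

definition diagonal_action :: "('g \<Rightarrow> 'e \<Rightarrow> 'e) \<Rightarrow> ('g \<Rightarrow> 'a \<Rightarrow> 'a) \<Rightarrow> 'g \<Rightarrow> 'e \<times> 'a \<Rightarrow> 'e \<times> 'a" where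
  "diagonal_action \<psi> \<phi> g = (\<lambda>(e, x). (\<psi> g e, \<phi> g x))"

text \<open>\<open>E \<times>\<^sub>G X\<close>, the space of orbits of the diagonal action. In terms of the right action on \<open>E\<close> this
  is the quotient by \<open>(e \<cdot> g, x) \<sim> (e, g \<cdot> x)\<close>.\<close>

definition borel_construction :: "('g, 'm) monoid_scheme \<Rightarrow> 'e topology \<Rightarrow> ('g \<Rightarrow> 'e \<Rightarrow> 'e) \<Rightarrow>
    'a topology \<Rightarrow> ('g \<Rightarrow> 'a \<Rightarrow> 'a) \<Rightarrow> ('e \<times> 'a) set topology" where
  "borel_construction G E \<psi> X \<phi> =
    quotient_topology (prod_topology E X) (orbit G (diagonal_action \<psi> \<phi>))"

end

theory Submission
  imports Defs "HOL-Library.Function_Algebras"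
begin

text \<open>
  The isomorphism is induced by the fibre inclusion \<open>q: X \<rightarrow> E \<times>\<^sub>G X\<close>, \<open>x \<mapsto> [e, x]\<close>, for any point \<open>e\<close> of \<open>E\<close>, so
  that it is multiplicative, linear and graded on the level of cochains. What has to be shown is that \<open>q\<^sup>*\<close> is
  injective on cohomology with the cotensor product as its image. There are three ingredients.

  The diagonal action on \<open>Y = E \<times> X\<close> is a covering space action with orbit map \<open>p: Y \<rightarrow> E \<times>\<^sub>G X\<close>. Every singular
  simplex of the orbit space lifts to \<open>Y\<close>, and two lifts differ by an element of \<open>G\<close>
  (\<open>singular_simplex_lift\<close>, \<open>singular_simplex_lifts_translate\<close>). Hence \<open>p\<^sup>*\<close> identifies the cochains of the orbit
  space with the \<open>G\<close>-invariant cochains of \<open>Y\<close>. As \<open>|G|\<close> is invertible, primitives and cocycles with invariant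
  class can be averaged, and so \<open>p\<^sup>*\<close> is injective on cohomology and its image consists of the invariant classes
  (\<open>orbit_pullback_coboundary_imp\<close>, \<open>invariant_class_descends\<close>).

  As \<open>E\<close> is contractible, the projection \<open>Y \<rightarrow> X\<close> and the inclusion \<open>x \<mapsto> (e, x)\<close> induce mutually inverse
  maps in cohomology (\<open>contractible_factor_pullback\<close>). The projection is equivariant, so the invariant classes of
  \<open>Y\<close> correspond to those of \<open>X\<close>, and \<open>p\<^sup>*\<close> corresponds to \<open>q\<^sup>*\<close>.

  Finally, the cotensor product consists of the invariant classes (\<open>coaction_eq_iff_invariant\<close>). The coaction is
  defined through the inverse of the Kunneth map for \<open>G \<times> X\<close>, which is bijective because \<open>G \<times> X\<close> is a finite
  disjoint union of copies of \<open>X\<close> (\<open>bij_betw_kunneth_map\<close>).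
\<close>

section \<open>Linear operations on cochains\<close>

definition scale :: "'k \<Rightarrow> ('a, 'k::field) cochain \<Rightarrow> ('a, 'k) cochain" where
  "scale a c = (\<lambda>n s. a * c n s)"

definition unit_cochain :: "'a topology \<Rightarrow> ('a, 'k::field) cochain" where
  "unit_cochain X = (\<lambda>n s. if n = 0 \<and> singular_simplex n X s then 1 else 0)"

lemma scale_apply [simp]: "scale a c n s = a * c n s"
  by (simp add: scale_def)

lemma sum_cochain_apply: "(\<Sum>i\<in>I. f i) n s = (\<Sum>i\<in>I. f i n s)"
  for f :: "'i \<Rightarrow> ('a, 'k::field) cochain"
  by (induction I rule: infinite_finite_induct) auto

lemma scale_simps [simp]:
  "scale a (c + d) = scale a c + scale a d"
  "scale a (c - d) = scale a c - scale a d"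
  "scale (a + b) c = scale a c + scale b c"
  "scale a (scale b c) = scale (a * b) c"
  "scale 1 c = c" "scale 0 c = 0" "scale a 0 = 0"
  by (simp_all add: fun_eq_iff algebra_simps)

section \<open>Cochains\<close>

lemma cochains_iff:
  "c \<in> cochains X \<longleftrightarrow>
    (\<forall>n s. \<not> singular_simplex n X s \<longrightarrow> c n s = 0) \<and> finite {n. c n \<noteq> 0}"
  by (simp add: cochains_def zero_fun_def)

lemma cochains_eqI:
  assumes "c \<in> cochains X" "d \<in> cochains X"
    and "\<And>n s. singular_simplex n X s \<Longrightarrow> c n s = d n s"
  shows "c = d"
proof (intro ext)
  fix n s show "c n s = d n s"
    using assms by (cases "singular_simplex n X s") (auto simp: cochains_iff)
qed

lemma cochains_supportI:
  assumes "\<And>n s. \<not> singular_simplex n X s \<Longrightarrow> c n s = 0"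
    and "finite N" and "\<And>n. n \<notin> N \<Longrightarrow> c n = 0"
  shows "c \<in> cochains X"
  using assms by (auto simp: cochains_iff intro: finite_subset[of _ N])

lemma cochains_zero [simp]: "0 \<in> cochains X"
  by (simp add: cochains_iff)

lemma cochains_add [simp]:
  assumes "c \<in> cochains X" "d \<in> cochains X" shows "c + d \<in> cochains X"
  using assms
  by (intro cochains_supportI[where N = "{n. c n \<noteq> 0} \<union> {n. d n \<noteq> 0}"]) (auto simp: cochains_iff)

lemma cochains_scale [simp]:
  assumes "c \<in> cochains X" shows "scale a c \<in> cochains X"
  using assms
  by (intro cochains_supportI[where N = "{n. c n \<noteq> 0}"]) (auto simp: cochains_iff fun_eq_iff)

lemma diff_eq_scale: "c - d = c + scale (- 1) d"
  for c d :: "('a, 'k::field) cochain"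
  by (simp add: fun_eq_iff)

lemma cochains_diff [simp]:
  assumes "c \<in> cochains X" "d \<in> cochains X" shows "c - d \<in> cochains X"
  using assms by (simp add: diff_eq_scale)

lemma cochains_sum: "(\<And>i. i \<in> I \<Longrightarrow> f i \<in> cochains X) \<Longrightarrow> (\<Sum>i\<in>I. f i) \<in> cochains X"
  by (induction I rule: infinite_finite_induct) auto

section \<open>The coboundary\<close>

lemma coboundary_0 [simp]: "coboundary X c 0 = 0"
  by (simp add: coboundary_def fun_eq_iff)

lemma coboundary_Suc:
  "singular_simplex (Suc n) X s \<Longrightarrow>
    coboundary X c (Suc n) s = (\<Sum>i\<le>Suc n. (-1) ^ i * c n (singular_face (Suc n) i s))"
  by (simp add: coboundary_def)

lemma coboundary_add [simp]: "coboundary X (c + d) = coboundary X c + coboundary X d"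
  by (simp add: coboundary_def fun_eq_iff algebra_simps sum.distrib)

lemma coboundary_scale [simp]: "coboundary X (scale a c) = scale a (coboundary X c)"
  by (simp add: coboundary_def fun_eq_iff sum_distrib_left mult.left_commute)

lemma coboundary_zero [simp]: "coboundary X 0 = 0"
  using coboundary_scale[of X 0 0] by simp

lemma coboundary_diff [simp]: "coboundary X (c - d) = coboundary X c - coboundary X d"
  by (simp add: diff_eq_scale)

lemma coboundary_sum: "coboundary X (\<Sum>i\<in>I. f i) = (\<Sum>i\<in>I. coboundary X (f i))"
  using sum_comp_morphism[of "coboundary X" f I] by (simp add: o_def)

lemma coboundary_cochains [simp]:
  assumes "c \<in> cochains X" shows "coboundary X c \<in> cochains X"
proof (rule cochains_supportI[where N = "Suc ` {n. c n \<noteq> 0}"])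
  show "coboundary X c n = 0" if "n \<notin> Suc ` {n. c n \<noteq> 0}" for n
    using that by (cases n) (auto simp: coboundary_def fun_eq_iff image_iff)
qed (use assms in \<open>auto simp: cochains_iff coboundary_def\<close>)

text \<open>The terms with \<open>i < j\<close> cancel against those with \<open>j \<le> i\<close>, by the bijection
  \<open>(j, i) \<mapsto> (i, j - 1)\<close>.\<close>

lemma sum_alternating_faces_eq_0:
  fixes a :: "nat \<Rightarrow> nat \<Rightarrow> 'k::comm_ring_1"
  assumes a: "\<And>i j. i \<le> j \<Longrightarrow> j \<le> n \<Longrightarrow> a (Suc j) i = a i j"
  shows "(\<Sum>j\<le>Suc n. \<Sum>i\<le>n. (-1) ^ j * (-1) ^ i * a j i) = 0"
proof -
  let ?f = "\<lambda>(j, i). (-1) ^ j * (-1) ^ i * a j i"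
  let ?L = "{(j, i). j \<le> i \<and> i \<le> n}" and ?U = "{(j, i). i < j \<and> j \<le> Suc n}"
  have fin: "finite ?L" "finite ?U"
    by (rule finite_subset[of _ "{..Suc n} \<times> {..Suc n}"]; auto)+
  have "(\<Sum>j\<le>Suc n. \<Sum>i\<le>n. (-1) ^ j * (-1) ^ i * a j i) = sum ?f ({..Suc n} \<times> {..n})"
    by (simp only: sum.cartesian_product)
  also have "{..Suc n} \<times> {..n} = ?L \<union> ?U"
    by auto
  also have "sum ?f (?L \<union> ?U) = sum ?f ?L + sum ?f ?U"
    by (rule sum.union_disjoint[OF fin]) auto
  also have "?U = (\<lambda>(j, i). (Suc i, j)) ` ?L"
  proof (intro equalityI subsetI)
    fix z assume "z \<in> ?U"
    then obtain i j where "z = (Suc j, i)" "i \<le> j" "j \<le> n"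
      by (cases z, cases "fst z") auto
    then show "z \<in> (\<lambda>(j, i). (Suc i, j)) ` ?L"
      by force
  qed auto
  also have "sum ?f \<dots> = (\<Sum>z\<in>?L. - ?f z)"
    by (subst sum.reindex) (force simp: inj_on_def a intro!: sum.cong)+
  finally show ?thesis
    by (simp only: sum_negf add.right_inverse)
qed

lemma singular_face_singular_face:
  assumes "i \<le> j" "j \<le> n" "0 < n"
  shows "singular_face n i (singular_face (Suc n) (Suc j) s) =
    singular_face n j (singular_face (Suc n) i s)"
proof
  fix t
  show "singular_face n i (singular_face (Suc n) (Suc j) s) t =
    singular_face n j (singular_face (Suc n) i s) t"
  proof (cases "t \<in> standard_simplex (n - Suc 0)")
    case True
    have "simplical_face i t \<in> standard_simplex n" "simplical_face j t \<in> standard_simplex n"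
      using True assms by (auto intro!: simplical_face_in_standard_simplex)
    moreover have "simplical_face (Suc j) (simplical_face i t) = simplical_face i (simplical_face j t)"
      using assms by (auto simp: simplical_face_def fun_eq_iff)
    ultimately show ?thesis
      using True by (simp add: singular_face_def)
  qed (simp add: singular_face_def)
qed

lemma coboundary_coboundary [simp]: "coboundary X (coboundary X c) = 0"
proof (intro ext)
  fix n s
  show "coboundary X (coboundary X c) n s = 0 n s"
  proof (cases "\<exists>m. n = Suc (Suc m) \<and> singular_simplex n X s")
    case True
    then obtain m where n: "n = Suc (Suc m)" and s: "singular_simplex n X s"
      by blast
    have "singular_simplex (Suc m) X (singular_face n j s)" if "j \<le> n" for j
      using singular_simplex_singular_face[OF s] that n by auto
    then have "coboundary X (coboundary X c) n s =
        (\<Sum>j\<le>n. (-1) ^ j * (\<Sum>i\<le>Suc m. (-1) ^ i * c m (singular_face (Suc m) i (singular_face n j s))))"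
      using s n by (simp add: coboundary_Suc del: sum.atMost_Suc)
    also have "\<dots> = (\<Sum>j\<le>n. \<Sum>i\<le>Suc m. (-1) ^ j * (-1) ^ i *
        c m (singular_face (Suc m) i (singular_face n j s)))"
      by (simp only: sum_distrib_left mult.assoc)
    also have "\<dots> = 0"
      unfolding n by (rule sum_alternating_faces_eq_0) (simp add: singular_face_singular_face)
    finally show ?thesis by simp
  next
    case False
    show ?thesis
    proof (cases n)
      case (Suc m)
      then show ?thesis using False
        by (cases m) (simp_all add: coboundary_def)
    qed simp
  qed
qed

section \<open>Cocycles and coboundaries\<close>

lemma cocycles_iff: "c \<in> cocycles X \<longleftrightarrow> c \<in> cochains X \<and> coboundary X c = 0"
  by (simp add: cocycles_def zero_fun_def)

lemma cocycles_imp_cochains: "c \<in> cocycles X \<Longrightarrow> c \<in> cochains X"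
  by (simp add: cocycles_iff)

lemma cocycles_closed [simp]:
  "0 \<in> cocycles X"
  "c \<in> cocycles X \<Longrightarrow> d \<in> cocycles X \<Longrightarrow> c + d \<in> cocycles X"
  "c \<in> cocycles X \<Longrightarrow> d \<in> cocycles X \<Longrightarrow> c - d \<in> cocycles X"
  "c \<in> cocycles X \<Longrightarrow> scale a c \<in> cocycles X"
  by (simp_all add: cocycles_iff)

lemma cocycles_sum: "(\<And>i. i \<in> I \<Longrightarrow> f i \<in> cocycles X) \<Longrightarrow> (\<Sum>i\<in>I. f i) \<in> cocycles X"
  by (induction I rule: infinite_finite_induct) auto

lemma coboundariesI: "c \<in> cochains X \<Longrightarrow> coboundary X c \<in> coboundaries X"
  by (simp add: coboundaries_def)

lemma coboundaries_closed [simp]: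
  "0 \<in> coboundaries X"
  "c \<in> coboundaries X \<Longrightarrow> d \<in> coboundaries X \<Longrightarrow> c + d \<in> coboundaries X"
  "c \<in> coboundaries X \<Longrightarrow> d \<in> coboundaries X \<Longrightarrow> c - d \<in> coboundaries X"
  "c \<in> coboundaries X \<Longrightarrow> scale a c \<in> coboundaries X"
proof -
  show "0 \<in> coboundaries X"
    using coboundariesI[of 0 X] by simp
  show "c \<in> coboundaries X \<Longrightarrow> d \<in> coboundaries X \<Longrightarrow> c + d \<in> coboundaries X"
    unfolding coboundaries_def by (auto simp flip: coboundary_add)
  show "c \<in> coboundaries X \<Longrightarrow> d \<in> coboundaries X \<Longrightarrow> c - d \<in> coboundaries X"
    unfolding coboundaries_def by (auto simp flip: coboundary_diff)
  show "c \<in> coboundaries X \<Longrightarrow> scale a c \<in> coboundaries X"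
    unfolding coboundaries_def by (auto simp flip: coboundary_scale)
qed

lemma coboundaries_sum:
  "(\<And>i. i \<in> I \<Longrightarrow> f i \<in> coboundaries X) \<Longrightarrow> (\<Sum>i\<in>I. f i) \<in> coboundaries X"
  by (induction I rule: infinite_finite_induct) auto

lemma coboundaries_cocycles: "c \<in> coboundaries X \<Longrightarrow> c \<in> cocycles X"
  by (auto simp: coboundaries_def cocycles_iff)

section \<open>Pullbacks\<close>

lemma singular_face_of_simplex_map:
  assumes "k \<le> Suc n"
  shows "singular_face (Suc n) k (simplex_map (Suc n) f s) =
    simplex_map n f (singular_face (Suc n) k s)"
proof -
  have "singular_face (Suc n) k (simplex_map (Suc n) f s) = simplex_map n f (s \<circ> simplical_face k)"
    using assms by (simp add: singular_face_simplex_map)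
  also have "\<dots> = simplex_map n f (singular_face (Suc n) k s)"
    by (auto simp: simplex_map_def singular_face_def fun_eq_iff restrict_def)
  finally show ?thesis .
qed

lemma pullback_cochain_apply:
  "singular_simplex n X s \<Longrightarrow> pullback_cochain X f c n s = c n (simplex_map n f s)"
  by (simp add: pullback_cochain_def)

lemma pullback_cochains [simp]:
  assumes "c \<in> cochains Y" shows "pullback_cochain X f c \<in> cochains X"
  using assms
  by (intro cochains_supportI[where N = "{n. c n \<noteq> 0}"])
    (auto simp: cochains_iff pullback_cochain_def fun_eq_iff)

lemma pullback_linear [simp]:
  "pullback_cochain X f (c + d) = pullback_cochain X f c + pullback_cochain X f d"
  "pullback_cochain X f (c - d) = pullback_cochain X f c - pullback_cochain X f d"
  "pullback_cochain X f (scale a c) = scale a (pullback_cochain X f c)"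
  "pullback_cochain X f 0 = 0"
  by (simp_all add: pullback_cochain_def fun_eq_iff)

lemma pullback_sum: "pullback_cochain X f (\<Sum>i\<in>I. c i) = (\<Sum>i\<in>I. pullback_cochain X f (c i))"
  using sum_comp_morphism[of "pullback_cochain X f" c I] by (simp add: o_def)

lemma pullback_coboundary:
  assumes "continuous_map X Y f"
  shows "pullback_cochain X f (coboundary Y c) = coboundary X (pullback_cochain X f c)"
proof (intro ext)
  fix n s
  show "pullback_cochain X f (coboundary Y c) n s = coboundary X (pullback_cochain X f c) n s"
  proof (cases "\<exists>m. n = Suc m \<and> singular_simplex n X s")
    case True
    then obtain m where n: "n = Suc m" and s: "singular_simplex n X s"
      by blast
    have "singular_simplex m X (singular_face n i s)" if "i \<le> n" for i
      using singular_simplex_singular_face[OF s] that n by auto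
    then have "coboundary X (pullback_cochain X f c) n s =
        (\<Sum>i\<le>n. (-1) ^ i * c m (simplex_map m f (singular_face n i s)))"
      using s n by (simp add: coboundary_Suc pullback_cochain_apply del: sum.atMost_Suc)
    also have "\<dots> = coboundary Y c n (simplex_map n f s)"
      using s n singular_simplex_simplex_map[OF s assms]
      by (simp add: coboundary_Suc singular_face_of_simplex_map del: sum.atMost_Suc)
    finally show ?thesis
      using s by (simp add: pullback_cochain_apply)
  qed (cases n; auto simp: coboundary_def pullback_cochain_def)
qed

lemma pullback_cocycles [simp]:
  assumes "continuous_map X Y f" "c \<in> cocycles Y"
  shows "pullback_cochain X f c \<in> cocycles X"
  using assms pullback_cochains[of c Y X f] by (simp add: cocycles_iff flip: pullback_coboundary)

lemma pullback_coboundaries [simp]: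
  assumes "continuous_map X Y f" "c \<in> coboundaries Y"
  shows "pullback_cochain X f c \<in> coboundaries X"
  using assms by (auto simp: coboundaries_def pullback_coboundary)

lemma pullback_compose:
  assumes "continuous_map X Y f"
  shows "pullback_cochain X f (pullback_cochain Y g c) = pullback_cochain X (g \<circ> f) c"
  using singular_simplex_simplex_map[OF _ assms]
  by (auto simp: fun_eq_iff pullback_cochain_def simplex_map_compose)

lemma pullback_cong:
  assumes "\<And>x. x \<in> topspace X \<Longrightarrow> f x = g x"
  shows "pullback_cochain X f c = pullback_cochain X g c"
proof -
  have "simplex_map n f s = simplex_map n g s" if "singular_simplex n X s" for n s
    using that assms by (rule simplex_map_eq)
  then show ?thesis
    unfolding pullback_cochain_def by (intro ext) simp
qed

lemma pullback_id:
  assumes "\<And>x. x \<in> topspace X \<Longrightarrow> f x = x" "c \<in> cochains X"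
  shows "pullback_cochain X f c = c"
proof -
  have "simplex_map n f s = s" if "singular_simplex n X s" for n s
    using that assms(1) by (rule simplex_map_id_gen)
  then show ?thesis
    using assms(2) unfolding pullback_cochain_def by (intro ext) (simp add: cochains_iff)
qed

lemma pullback_unit_cochain:
  assumes "continuous_map X Y f"
  shows "pullback_cochain X f (unit_cochain Y) = unit_cochain X"
  using singular_simplex_simplex_map[OF _ assms]
  by (auto simp: fun_eq_iff pullback_cochain_def unit_cochain_def)

section \<open>Front and back faces\<close>

definition shift_simplex :: "nat \<Rightarrow> (nat \<Rightarrow> real) \<Rightarrow> nat \<Rightarrow> real" where
  "shift_simplex p x = (\<lambda>i. if i < p then 0 else x (i - p))"

lemma back_face_eq: "back_face p q s = restrict (s \<circ> shift_simplex p) (standard_simplex q)"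
  by (simp add: back_face_def shift_simplex_def o_def)

lemma shift_simplex_in_standard_simplex:
  assumes "x \<in> standard_simplex q"
  shows "shift_simplex p x \<in> standard_simplex (p + q)"
proof -
  have "(\<Sum>i\<le>p + q. shift_simplex p x i) = (\<Sum>i\<in>{p..p + q}. x (i - p))"
    by (rule sum.mono_neutral_cong_right) (auto simp: shift_simplex_def)
  also have "\<dots> = (\<Sum>i\<le>q. x i)"
    by (rule sum.reindex_bij_witness[where i = "\<lambda>i. i + p" and j = "\<lambda>i. i - p"]) auto
  finally show ?thesis
    using assms by (auto simp: standard_simplex_def shift_simplex_def)
qed

lemma singular_simplex_front_face:
  assumes "singular_simplex n X s" "p \<le> n"
  shows "singular_simplex p X (front_face p s)"
  using assms standard_simplex_mono[of p n]
  by (auto simp: singular_simplex_def front_face_def intro: continuous_map_from_subtopology_mono)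

lemma singular_simplex_back_face:
  assumes "singular_simplex (p + q) X s"
  shows "singular_simplex q X (back_face p q s)"
proof -
  have "continuous_map (powertop_real UNIV) euclideanreal (\<lambda>x. shift_simplex p x k)" for k
    by (auto simp: shift_simplex_def intro: continuous_map_product_projection)
  then have "continuous_map (subtopology (powertop_real UNIV) (standard_simplex q))
      (subtopology (powertop_real UNIV) (standard_simplex (p + q))) (shift_simplex p)"
    by (auto simp: continuous_map_in_subtopology continuous_map_componentwise_UNIV
        shift_simplex_in_standard_simplex intro: continuous_map_from_subtopology)
  with assms show ?thesis
    by (auto simp: singular_simplex_def back_face_eq intro: continuous_map_compose)
qed

lemma front_face_simplex_map:
  assumes "p \<le> n" shows "front_face p (simplex_map n f s) = simplex_map p f (front_face p s)"
  using standard_simplex_mono[OF assms]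
  by (auto simp: front_face_def simplex_map_def fun_eq_iff restrict_def)

lemma back_face_simplex_map:
  "back_face p q (simplex_map (p + q) f s) = simplex_map q f (back_face p q s)"
  using shift_simplex_in_standard_simplex[of _ q p]
  by (auto simp: back_face_eq simplex_map_def fun_eq_iff restrict_def)

lemma front_face_singular_face:
  assumes "p \<le> n" "i \<le> Suc n"
  shows "front_face p (singular_face (Suc n) i s) =
    (if i \<le> p then singular_face (Suc p) i (front_face (Suc p) s) else front_face p s)"
proof
  fix x
  show "front_face p (singular_face (Suc n) i s) x =
    (if i \<le> p then singular_face (Suc p) i (front_face (Suc p) s) else front_face p s) x"
  proof (cases "x \<in> standard_simplex p")
    case True
    then have "x \<in> standard_simplex n"
      using standard_simplex_mono[OF assms(1)] by blast
    moreover have "simplical_face i x \<in> standard_simplex (Suc p)" if "i \<le> p"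
      using simplical_face_in_standard_simplex[of "Suc p" i x] that True by simp
    moreover have "simplical_face i x = x" if "\<not> i \<le> p"
      using that True by (auto simp: simplical_face_def standard_simplex_def fun_eq_iff)
    ultimately show ?thesis
      using True by (simp add: front_face_def singular_face_def)
  qed (simp add: front_face_def singular_face_def)
qed

lemma back_face_singular_face:
  assumes "i \<le> Suc (p + q)"
  shows "back_face p q (singular_face (Suc (p + q)) i s) =
    (if i \<le> p then back_face (Suc p) q s else singular_face (Suc q) (i - p) (back_face p (Suc q) s))"
proof
  fix x
  show "back_face p q (singular_face (Suc (p + q)) i s) x =
    (if i \<le> p then back_face (Suc p) q s else singular_face (Suc q) (i - p) (back_face p (Suc q) s)) x"
  proof (cases "x \<in> standard_simplex q")
    case True
    have "simplical_face (i - p) x \<in> standard_simplex (Suc q)"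
      using simplical_face_in_standard_simplex[of "Suc q" "i - p" x] assms True by simp
    moreover have "simplical_face i (shift_simplex p x) =
        (if i \<le> p then shift_simplex (Suc p) x else shift_simplex p (simplical_face (i - p) x))"
      by (auto simp: simplical_face_def shift_simplex_def fun_eq_iff
          intro!: arg_cong[where f = x])
    ultimately show ?thesis
      using True by (simp add: back_face_eq singular_face_def shift_simplex_in_standard_simplex)
  qed (simp add: back_face_eq singular_face_def)
qed

lemma last_singular_face_front_face:
  "singular_face (Suc p) (Suc p) (front_face (Suc p) s) = front_face p s"
proof
  fix x
  have "simplical_face (Suc p) x = x" "x \<in> standard_simplex (Suc p)" if "x \<in> standard_simplex p"
    using that standard_simplex_mono[of p "Suc p"]
    by (auto simp: simplical_face_def standard_simplex_def fun_eq_iff)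
  then show "singular_face (Suc p) (Suc p) (front_face (Suc p) s) x = front_face p s x"
    by (simp add: front_face_def singular_face_def)
qed

lemma first_singular_face_back_face:
  "singular_face (Suc q) 0 (back_face p (Suc q) s) = back_face (Suc p) q s"
proof
  fix x :: "nat \<Rightarrow> real"
  have "simplical_face 0 x \<in> standard_simplex (Suc q)" if "x \<in> standard_simplex q"
    using simplical_face_in_standard_simplex[of "Suc q" 0 x] that by simp
  moreover have "shift_simplex p (simplical_face 0 x) = shift_simplex (Suc p) x"
    by (auto simp: simplical_face_def shift_simplex_def fun_eq_iff intro!: arg_cong[where f = x])
  ultimately show "singular_face (Suc q) 0 (back_face p (Suc q) s) x = back_face (Suc p) q s x"
    by (simp add: back_face_eq singular_face_def)
qed

section \<open>The cup product\<close>

lemma cup_apply: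
  "singular_simplex n X s \<Longrightarrow>
    cup X c d n s = (\<Sum>p\<le>n. c p (front_face p s) * d (n - p) (back_face p (n - p) s))"
  by (simp add: cup_def)

lemma cup_linear [simp]:
  "cup X (c + c') d = cup X c d + cup X c' d"
  "cup X (c - c') d = cup X c d - cup X c' d"
  "cup X (scale a c) d = scale a (cup X c d)"
  "cup X c (d + d') = cup X c d + cup X c d'"
  "cup X c (d - d') = cup X c d - cup X c d'"
  "cup X c (scale a d) = scale a (cup X c d)"
  "cup X 0 d = 0" "cup X c 0 = 0"
  by (auto simp: cup_def fun_eq_iff algebra_simps sum.distrib sum_subtractf sum_distrib_left)

lemma cup_cochains [simp]:
  assumes "c \<in> cochains X" "d \<in> cochains X"
  shows "cup X c d \<in> cochains X"
proof (rule cochains_supportI[where N = "(\<lambda>(p, q). p + q) ` ({p. c p \<noteq> 0} \<times> {q. d q \<noteq> 0})"])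
  fix n assume n: "n \<notin> (\<lambda>(p, q). p + q) ` ({p. c p \<noteq> 0} \<times> {q. d q \<noteq> 0})"
  have "c p = 0 \<or> d (n - p) = 0" if "p \<le> n" for p
  proof (rule ccontr)
    assume "\<not> (c p = 0 \<or> d (n - p) = 0)"
    then have "(\<lambda>(p, q). p + q) (p, n - p) \<in> (\<lambda>(p, q). p + q) ` ({p. c p \<noteq> 0} \<times> {q. d q \<noteq> 0})"
      by blast
    with n that show False by simp
  qed
  then have "(\<Sum>p\<le>n. c p (front_face p s) * d (n - p) (back_face p (n - p) s)) = 0" for s
    by (intro sum.neutral) (metis atMost_iff mult_zero_left mult_zero_right zero_fun_apply)
  then show "cup X c d n = 0"
    unfolding cup_def by (intro ext) (simp only: if_cancel zero_fun_apply)
qed (use assms in \<open>auto simp: cup_def cochains_iff\<close>)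

lemma pullback_cup:
  assumes "continuous_map X Y f"
  shows "pullback_cochain X f (cup Y c d) = cup X (pullback_cochain X f c) (pullback_cochain X f d)"
proof (intro ext)
  fix n s
  show "pullback_cochain X f (cup Y c d) n s =
    cup X (pullback_cochain X f c) (pullback_cochain X f d) n s"
  proof (cases "singular_simplex n X s")
    case True
    have "back_face p (n - p) (simplex_map n f s) = simplex_map (n - p) f (back_face p (n - p) s)"
      if "p \<le> n" for p
      using back_face_simplex_map[of p "n - p" f s] that by simp
    then show ?thesis
      using True singular_simplex_simplex_map[OF True assms]
        singular_simplex_front_face[OF True] singular_simplex_back_face[of _ "n - _" X s]
      by (simp add: pullback_cochain_apply cup_apply front_face_simplex_map)
  qed (simp add: pullback_cochain_def cup_def)
qed

text \<open>Cochains are not assumed homogeneous, so the sign \<open>(-1)\<^sup>n\<close> of the Leibniz rule has to be inserted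
  degree by degree.\<close>

definition sign_cochain :: "('a, 'k::field) cochain \<Rightarrow> ('a, 'k) cochain" where
  "sign_cochain c = (\<lambda>n s. (-1) ^ n * c n s)"

lemma sign_cochains: "c \<in> cochains X \<Longrightarrow> sign_cochain c \<in> cochains X"
  by (auto simp: cochains_iff sign_cochain_def fun_eq_iff)

text \<open>The Leibniz rule. Fix the degree \<open>p\<close> of the left factor. The faces \<open>d\<^sub>i s\<close> with \<open>i \<le> p\<close> alter the front part
  and those with \<open>i > p\<close> alter the back part. The right-hand side has two extra terms, from the last face
  of the front part and the first face of the back part; they involve the same values and carry opposite
  signs.\<close>

lemma coboundary_cup:
  "coboundary X (cup X c d) = cup X (coboundary X c) d + cup X (sign_cochain c) (coboundary X d)"
proof (intro ext)
  fix m s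
  show "coboundary X (cup X c d) m s =
    (cup X (coboundary X c) d + cup X (sign_cochain c) (coboundary X d)) m s"
  proof (cases "\<exists>n. m = Suc n \<and> singular_simplex m X s")
    case True
    then obtain n where m: "m = Suc n" and s: "singular_simplex (Suc n) X s"
      by blast
    \<comment> \<open>The contributions of a face of the front part and of a face of the back part.\<close>
    define l where "l p i = c p (singular_face (Suc p) i (front_face (Suc p) s)) *
      d (n - p) (back_face (Suc p) (n - p) s)" for p i
    define r where "r p i = c p (front_face p s) *
      d (n - p) (singular_face (Suc (n - p)) (i - p) (back_face p (Suc (n - p)) s))" for p i
    have face: "singular_simplex n X (singular_face (Suc n) i s)" if "i \<le> Suc n" for i
      using singular_simplex_singular_face[OF s _ that] by simp
    have lr: "c p (front_face p (singular_face (Suc n) i s)) *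
        d (n - p) (back_face p (n - p) (singular_face (Suc n) i s)) = (if i \<le> p then l p i else r p i)"
      if "p \<le> n" "i \<le> Suc n" for p i
      using that back_face_singular_face[of i p "n - p" s]
      by (simp add: front_face_singular_face l_def r_def)
    have front_s: "singular_simplex p X (front_face p s)" if "p \<le> Suc n" for p
      using singular_simplex_front_face[OF s that] .
    have back_s: "singular_simplex (Suc (n - p)) X (back_face p (Suc (n - p)) s)" if "p \<le> n" for p
      using singular_simplex_back_face[of p "Suc (n - p)" X s] s that by simp
    have "coboundary X (cup X c d) m s =
        (\<Sum>i\<le>Suc n. (-1) ^ i * (\<Sum>p\<le>n. if i \<le> p then l p i else r p i))"
      using s face lr by (simp add: m coboundary_Suc cup_apply del: sum.atMost_Suc)
    also have "\<dots> = (\<Sum>p\<le>n. \<Sum>i\<le>Suc n. (-1) ^ i * (if i \<le> p then l p i else r p i))"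
      by (subst sum.swap) (simp only: sum_distrib_left)
    also have "\<dots> = (\<Sum>p\<le>n. (\<Sum>i\<le>Suc p. (-1) ^ i * l p i) + (\<Sum>i=p..Suc n. (-1) ^ i * r p i))"
    proof (rule sum.cong[OF refl])
      fix p assume "p \<in> {..n}"
      then have p: "p \<le> n" by simp
      have split: "{..Suc n} = {..p} \<union> {Suc p..Suc n}"
        using p by auto
      have "(\<Sum>i\<le>Suc n. (-1) ^ i * (if i \<le> p then l p i else r p i)) =
          (\<Sum>i\<le>p. (-1) ^ i * (if i \<le> p then l p i else r p i)) +
          (\<Sum>i=Suc p..Suc n. (-1) ^ i * (if i \<le> p then l p i else r p i))"
        unfolding split by (rule sum.union_disjoint) auto
      also have "\<dots> = (\<Sum>i\<le>p. (-1) ^ i * l p i) + (\<Sum>i=Suc p..Suc n. (-1) ^ i * r p i)"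
        by (intro arg_cong2[where f = "(+)"] sum.cong) auto
      also have "\<dots> = (\<Sum>i\<le>Suc p. (-1) ^ i * l p i) + (\<Sum>i=p..Suc n. (-1) ^ i * r p i)"
      proof -
        \<comment> \<open>Both terms belong to the splitting of \<open>s\<close> into a \<open>p\<close>-simplex and an \<open>(n - p)\<close>-simplex
          that omits the edge between them, and cancel by their signs.\<close>
        have "l p (Suc p) = r p p"
          by (simp add: l_def r_def last_singular_face_front_face first_singular_face_back_face)
        moreover have "(\<Sum>i=p..Suc n. (-1) ^ i * r p i) = (-1) ^ p * r p p + (\<Sum>i=Suc p..Suc n. (-1) ^ i * r p i)"
          using p by (intro sum.atLeast_Suc_atMost) simp
        ultimately show ?thesis by simp
      qed
      finally show "(\<Sum>i\<le>Suc n. (-1) ^ i * (if i \<le> p then l p i else r p i)) =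
          (\<Sum>i\<le>Suc p. (-1) ^ i * l p i) + (\<Sum>i=p..Suc n. (-1) ^ i * r p i)" .
    qed
    also have "\<dots> = (\<Sum>p\<le>n. \<Sum>i\<le>Suc p. (-1) ^ i * l p i) + (\<Sum>p\<le>n. \<Sum>i=p..Suc n. (-1) ^ i * r p i)"
      by (rule sum.distrib)
    also have "(\<Sum>p\<le>n. \<Sum>i\<le>Suc p. (-1) ^ i * l p i) = cup X (coboundary X c) d m s"
    proof -
      have "cup X (coboundary X c) d m s =
          (\<Sum>p\<le>n. coboundary X c (Suc p) (front_face (Suc p) s) * d (n - p) (back_face (Suc p) (n - p) s))"
        using s by (simp add: m cup_apply sum.atMost_Suc_shift del: sum.atMost_Suc)
      then show ?thesis
        using front_s by (simp add: coboundary_Suc l_def sum_distrib_right mult.assoc del: sum.atMost_Suc)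
    qed
    also have "(\<Sum>p\<le>n. \<Sum>i=p..Suc n. (-1) ^ i * r p i) =
        cup X (sign_cochain c) (coboundary X d) m s"
    proof -
      have "cup X (sign_cochain c) (coboundary X d) m s =
          (\<Sum>p\<le>n. (-1) ^ p * c p (front_face p s) * coboundary X d (Suc (n - p)) (back_face p (Suc (n - p)) s))"
        using s by (simp add: m cup_apply sign_cochain_def Suc_diff_le)
      moreover have "(\<Sum>i=p..Suc n. (-1) ^ i * r p i) =
          (-1) ^ p * c p (front_face p s) * coboundary X d (Suc (n - p)) (back_face p (Suc (n - p)) s)"
        if "p \<le> n" for p
      proof -
        have "(\<Sum>i=p..Suc n. (-1) ^ i * r p i) = (\<Sum>j\<le>Suc (n - p). (-1) ^ (p + j) * r p (p + j))"
          by (rule sum.reindex_bij_witness[where i = "\<lambda>j. p + j" and j = "\<lambda>i. i - p"]) (use that in auto)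
        also have "\<dots> = (-1) ^ p * c p (front_face p s) *
            coboundary X d (Suc (n - p)) (back_face p (Suc (n - p)) s)"
          using back_s[OF that]
          by (simp add: coboundary_Suc r_def sum_distrib_left power_add mult_ac del: sum.atMost_Suc)
        finally show ?thesis .
      qed
      ultimately show ?thesis by simp
    qed
    finally show ?thesis by simp
  qed (cases m; auto simp: coboundary_def cup_def)
qed

section \<open>The cohomology algebra\<close>

lemma cohomology_class_iff: "d \<in> cohomology_class X c \<longleftrightarrow> d - c \<in> coboundaries X"
proof -
  have "cohomology_class X c = (\<lambda>h. h + c) ` coboundaries X"
    by (auto simp: cohomology_class_def a_r_coset_def r_coset_def cocycle_ring_def plus_fun_def)
  moreover have "d = (d - c) + c"
    by (simp add: fun_eq_iff)
  ultimately show ?thesis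
    by (metis (no_types, lifting) add_diff_cancel_right' imageE imageI)
qed

lemma cohomology_class_self [simp]: "c \<in> cohomology_class X c"
  by (simp add: cohomology_class_iff)

lemma cohomology_class_eq_iff:
  "cohomology_class X c = cohomology_class X d \<longleftrightarrow> c - d \<in> coboundaries X"
proof
  assume "c - d \<in> coboundaries X"
  moreover have "e - c = (e - d) - (c - d)" "e - d = (e - c) + (c - d)" for e
    by (simp_all add: fun_eq_iff)
  ultimately show "cohomology_class X c = cohomology_class X d"
    unfolding set_eq_iff cohomology_class_iff by (metis coboundaries_closed(2,3))
qed (use cohomology_class_iff cohomology_class_self in blast)

lemma cohomology_class_mem_cocycles:
  assumes "c \<in> cocycles X" "d \<in> cohomology_class X c" shows "d \<in> cocycles X"
proof -
  have "d = (d - c) + c"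
    by (simp add: fun_eq_iff)
  then show ?thesis
    using assms by (metis coboundaries_cocycles cocycles_closed(2) cohomology_class_iff)
qed

lemmas cohomology_algebra_defs =
  cohomology_algebra_def ring.extend_def module.fields_def FactRing_def

lemma carrier_cohomology_algebra:
  "carrier (cohomology_algebra X) = cohomology_class X ` cocycles X"
  by (auto simp: cohomology_algebra_defs A_RCOSETS_def RCOSETS_def cohomology_class_def a_r_coset_def
      cocycle_ring_def)

lemma cohomology_class_carrier [simp]:
  "c \<in> cocycles X \<Longrightarrow> cohomology_class X c \<in> carrier (cohomology_algebra X)"
  by (simp add: carrier_cohomology_algebra)

lemma cohomology_carrierE:
  assumes "x \<in> carrier (cohomology_algebra X)"
  obtains c where "c \<in> cocycles X" "x = cohomology_class X c"
  using assms by (auto simp: carrier_cohomology_algebra)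

lemma cohomology_one: "\<one>\<^bsub>cohomology_algebra X\<^esub> = cohomology_class X (unit_cochain X)"
  by (simp add: cohomology_algebra_defs cohomology_class_def cocycle_ring_def unit_cochain_def)

lemma cohomology_zero: "\<zero>\<^bsub>cohomology_algebra X\<^esub> = cohomology_class X 0"
  by (auto simp: cohomology_algebra_defs cohomology_class_iff)

lemma cohomology_add:
  "cohomology_class X c \<oplus>\<^bsub>cohomology_algebra X\<^esub> cohomology_class X d = cohomology_class X (c + d)"
proof -
  have "cohomology_class X c \<oplus>\<^bsub>cohomology_algebra X\<^esub> cohomology_class X d =
      {a + b | a b. a \<in> cohomology_class X c \<and> b \<in> cohomology_class X d}"
    by (auto simp: cohomology_algebra_defs set_add_def set_mult_def cocycle_ring_def plus_fun_def)
  also have "\<dots> = cohomology_class X (c + d)"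
  proof (intro equalityI subsetI)
    fix e assume "e \<in> {a + b | a b. a \<in> cohomology_class X c \<and> b \<in> cohomology_class X d}"
    then obtain a b where "e = a + b" "a - c \<in> coboundaries X" "b - d \<in> coboundaries X"
      by (auto simp: cohomology_class_iff)
    moreover have "a + b - (c + d) = (a - c) + (b - d)"
      by (simp add: fun_eq_iff)
    ultimately show "e \<in> cohomology_class X (c + d)"
      by (simp only: cohomology_class_iff coboundaries_closed)
  next
    fix e assume "e \<in> cohomology_class X (c + d)"
    moreover have "e - (c + d) = (e - d) - c" "e = (e - d) + d"
      by (simp_all add: fun_eq_iff)
    ultimately show "e \<in> {a + b | a b. a \<in> cohomology_class X c \<and> b \<in> cohomology_class X d}"
      by (metis (mono_tags, lifting) cohomology_class_iff cohomology_class_self mem_Collect_eq)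
  qed
  finally show ?thesis .
qed

text \<open>For cocycles, \<open>c' \<union> d' - c \<union> d = (c' - c) \<union> d' + c \<union> (d' - d)\<close>, and the Leibniz rule gives a
  primitive of each summand. Hence the cup product descends to cohomology classes.\<close>

lemma cup_congruence:
  assumes "c \<in> cocycles X" "d \<in> cocycles X" "c' \<in> cocycles X" "d' \<in> cocycles X"
    and "c' - c \<in> coboundaries X" "d' - d \<in> coboundaries X"
  shows "cup X c' d' - cup X c d \<in> coboundaries X"
proof -
  obtain a b where a: "a \<in> cochains X" "c' - c = coboundary X a"
    and b: "b \<in> cochains X" "d' - d = coboundary X b"
    using assms by (auto simp: coboundaries_def)
  have sign: "sign_cochain (sign_cochain c) = c"
    by (simp add: sign_cochain_def fun_eq_iff flip: power_add mult.assoc)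
  have sign_c: "coboundary X (sign_cochain c) = 0"
  proof (intro ext)
    fix n s
    have "coboundary X (sign_cochain c) n s = (-1) ^ (n - 1) * coboundary X c n s"
      by (simp add: coboundary_def sign_cochain_def sum_distrib_left mult.left_commute)
    then show "coboundary X (sign_cochain c) n s = 0 n s"
      using assms(1) by (simp add: cocycles_iff)
  qed
  have "cup X c' d' - cup X c d = cup X (c' - c) d' + cup X c (d' - d)"
    by simp
  also have "\<dots> = coboundary X (cup X a d' + cup X (sign_cochain c) b)"
    using assms by (simp add: a b coboundary_cup sign sign_c cocycles_iff)
  finally show ?thesis
    using assms a b by (simp add: coboundariesI cocycles_iff sign_cochains)
qed

lemma cup_cocycles [simp]: "c \<in> cocycles X \<Longrightarrow> d \<in> cocycles X \<Longrightarrow> cup X c d \<in> cocycles X"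
  by (simp add: cocycles_iff coboundary_cup)

lemma cohomology_mult:
  assumes "c \<in> cocycles X" "d \<in> cocycles X"
  shows "cohomology_class X c \<otimes>\<^bsub>cohomology_algebra X\<^esub> cohomology_class X d = cohomology_class X (cup X c d)"
proof -
  have "cohomology_class X c \<otimes>\<^bsub>cohomology_algebra X\<^esub> cohomology_class X d =
      (\<Union>a\<in>cohomology_class X c. \<Union>b\<in>cohomology_class X d. cohomology_class X (cup X a b))"
    by (simp add: cohomology_algebra_defs rcoset_mult_def cohomology_class_def cocycle_ring_def)
  also have "\<dots> = cohomology_class X (cup X c d)"
  proof -
    have "cohomology_class X (cup X a b) = cohomology_class X (cup X c d)"
      if "a \<in> cohomology_class X c" "b \<in> cohomology_class X d" for a b
      unfolding cohomology_class_eq_iff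
      by (rule cup_congruence) (use that assms in \<open>auto intro: cohomology_class_mem_cocycles simp: cohomology_class_iff\<close>)
    then show ?thesis
      using cohomology_class_self by blast
  qed
  finally show ?thesis .
qed

lemma cohomology_smult:
  "a \<odot>\<^bsub>cohomology_algebra X\<^esub> cohomology_class X c = cohomology_class X (scale a c)"
proof -
  have "cohomology_class X (scale a d) = cohomology_class X (scale a c)" if "d \<in> cohomology_class X c" for d
    using that coboundaries_closed(4)[of "d - c" X a] by (simp add: cohomology_class_eq_iff cohomology_class_iff)
  moreover have "a \<odot>\<^bsub>cohomology_algebra X\<^esub> cohomology_class X c =
      (\<Union>d\<in>cohomology_class X c. cohomology_class X (scale a d))"
    by (simp add: cohomology_algebra_defs scale_def)
  ultimately show ?thesis
    using cohomology_class_self by blast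
qed

lemma induced_map_class:
  assumes "continuous_map X Y f"
  shows "induced_map X f (cohomology_class Y c) = cohomology_class X (pullback_cochain X f c)"
proof -
  have "cohomology_class X (pullback_cochain X f d) = cohomology_class X (pullback_cochain X f c)"
    if "d \<in> cohomology_class Y c" for d
    using that pullback_coboundaries[OF assms, of "d - c"]
    by (simp add: cohomology_class_eq_iff cohomology_class_iff)
  then show ?thesis
    using cohomology_class_self unfolding induced_map_def by blast
qed

lemma unit_cochain_cocycle [simp]: "unit_cochain X \<in> cocycles X"
  (is "?u \<in> _")
proof -
  have "coboundary X ?u n s = 0 n s" for n s
  proof (cases "n = 1 \<and> singular_simplex 1 X s")
    case True
    then show ?thesis
      using singular_simplex_singular_face[of 1 X s]
      by (simp add: coboundary_def unit_cochain_def)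
  next
    case False
    then show ?thesis
      by (auto simp: coboundary_def unit_cochain_def le_Suc_eq intro!: sum.neutral)
  qed
  moreover have "?u \<in> cochains X"
    by (rule cochains_supportI[where N = "{0}"]) (auto simp: unit_cochain_def fun_eq_iff)
  ultimately show ?thesis
    by (simp add: cocycles_iff fun_eq_iff)
qed

text \<open>The finite sums that occur in the linear extension of the cross product are sums in this group.\<close>

lemma abelian_group_cohomology: "abelian_group (cohomology_algebra X)"
proof (rule abelian_groupI)
  fix x assume "x \<in> carrier (cohomology_algebra X)"
  then obtain c where c: "c \<in> cocycles X" "x = cohomology_class X c"
    by (rule cohomology_carrierE)
  then have "cohomology_class X (0 - c) \<oplus>\<^bsub>cohomology_algebra X\<^esub> x = \<zero>\<^bsub>cohomology_algebra X\<^esub>"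
    by (simp only: cohomology_add cohomology_zero diff_add_cancel)
  with c show "\<exists>y\<in>carrier (cohomology_algebra X). y \<oplus>\<^bsub>cohomology_algebra X\<^esub> x = \<zero>\<^bsub>cohomology_algebra X\<^esub>"
    using cohomology_class_carrier cocycles_closed(1,3) by blast
qed (auto elim!: cohomology_carrierE simp: cohomology_add cohomology_zero ac_simps)

lemma cohomology_finsum:
  assumes "finite I" "\<And>i. i \<in> I \<Longrightarrow> c i \<in> cocycles X"
  shows "(\<Oplus>\<^bsub>cohomology_algebra X\<^esub>i\<in>I. cohomology_class X (c i)) = cohomology_class X (\<Sum>i\<in>I. c i)"
proof -
  interpret abelian_group "cohomology_algebra X"
    by (rule abelian_group_cohomology)
  show ?thesis
    using assms by (induction I rule: finite_induct) (auto simp: cohomology_zero cohomology_add)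
qed

section \<open>Homotopy invariance\<close>

definition degeneracy :: "nat \<Rightarrow> (nat \<Rightarrow> real) \<Rightarrow> nat \<Rightarrow> real" where
  "degeneracy i x = (\<lambda>k. if k < i then x k else if k = i then x i + x (Suc i) else x (Suc k))"

text \<open>The \<open>i\<close>-th simplex of the standard triangulation of \<open>\<Delta>\<^sup>n \<times> [0, 1]\<close>, pushed forward along \<open>s\<close> and the
  homotopy \<open>h\<close>: its vertices \<open>0, \<dots>, i\<close> are the vertices \<open>0, \<dots>, i\<close> of \<open>\<Delta>\<^sup>n\<close> at time \<open>0\<close>, its vertices
  \<open>i + 1, \<dots>, n + 1\<close> are the vertices \<open>i, \<dots>, n\<close> at time \<open>1\<close>.\<close>

definition prism :: "nat \<Rightarrow> (real \<times> 'a \<Rightarrow> 'b) \<Rightarrow> nat \<Rightarrow> 'a simplex \<Rightarrow> 'b simplex" where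
  "prism n h i s =
    restrict (\<lambda>x. h (1 - (\<Sum>k\<le>i. x k), s (degeneracy i x))) (standard_simplex (Suc n))"

lemma sum_degeneracy:
  assumes "i \<le> n" shows "(\<Sum>k\<le>n. degeneracy i x k) = (\<Sum>k\<le>Suc n. x k)"
  using assms
proof (induction n rule: dec_induct)
  case base
  have "(\<Sum>k\<le>i. degeneracy i x k) = (\<Sum>k<i. x k) + (x i + x (Suc i))"
    by (simp add: degeneracy_def flip: lessThan_Suc_atMost)
  then show ?case by (simp flip: lessThan_Suc_atMost)
next
  case (step n)
  then show ?case by (simp add: degeneracy_def)
qed

lemma degeneracy_in_standard_simplex:
  assumes "i \<le> n" "x \<in> standard_simplex (Suc n)"
  shows "degeneracy i x \<in> standard_simplex n"
proof -
  have x: "0 \<le> x k" "x k \<le> 1" "k > Suc n \<Longrightarrow> x k = 0" "(\<Sum>k\<le>Suc n. x k) = 1" for k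
    using assms(2) by (auto simp: standard_simplex_def)
  have nonneg: "0 \<le> degeneracy i x k" for k
    using x by (simp add: degeneracy_def)
  have zero: "degeneracy i x k = 0" if "k > n" for k
    using x assms(1) that by (simp add: degeneracy_def)
  have sum: "(\<Sum>k\<le>n. degeneracy i x k) = 1"
    using sum_degeneracy[OF assms(1), of x] x(4) by simp
  have "degeneracy i x k \<le> 1" for k
  proof (cases "k \<le> n")
    case True
    then have "degeneracy i x k \<le> (\<Sum>k\<le>n. degeneracy i x k)"
      by (intro member_le_sum) (auto simp: nonneg)
    then show ?thesis by (simp add: sum)
  qed (simp add: zero)
  then show ?thesis
    using nonneg zero sum by (simp add: standard_simplex_def)
qed

lemma sum_partial_standard_simplex:
  assumes "x \<in> standard_simplex n"
  shows "0 \<le> (\<Sum>k\<le>i. x k)" "(\<Sum>k\<le>i. x k) \<le> 1"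
proof -
  have x: "0 \<le> x k" "k > n \<Longrightarrow> x k = 0" "(\<Sum>k\<le>n. x k) = 1" for k
    using assms by (auto simp: standard_simplex_def)
  show "0 \<le> (\<Sum>k\<le>i. x k)"
    by (simp add: sum_nonneg x)
  have "(\<Sum>k\<le>i. x k) \<le> (\<Sum>k\<le>max i n. x k)"
    by (rule sum_mono2) (auto simp: x)
  also have "\<dots> = (\<Sum>k\<le>n. x k)"
    by (rule sum.mono_neutral_right) (auto simp: x)
  finally show "(\<Sum>k\<le>i. x k) \<le> 1"
    by (simp add: x)
qed

lemma singular_simplex_prism:
  assumes h: "continuous_map (prod_topology (top_of_set {0..1}) X) Y h"
    and s: "singular_simplex n X s" and i: "i \<le> n"
  shows "singular_simplex (Suc n) Y (prism n h i s)"
proof -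
  let ?D = "\<lambda>n. subtopology (powertop_real UNIV) (standard_simplex n)"
  have proj: "continuous_map (powertop_real UNIV) euclideanreal (\<lambda>x. x k)" for k :: nat
    using continuous_map_product_projection[of k UNIV "\<lambda>_. euclideanreal"] by simp
  then have "continuous_map (powertop_real UNIV) euclideanreal (\<lambda>x. degeneracy i x k)" for k
    using continuous_map_add[OF proj[of i] proj[of "Suc i"]]
    by (cases k i rule: linorder_cases) (simp_all add: degeneracy_def)
  then have "continuous_map (?D (Suc n)) (?D n) (degeneracy i)"
    using degeneracy_in_standard_simplex[OF i]
    by (auto simp: continuous_map_in_subtopology continuous_map_componentwise_UNIV
        intro: continuous_map_from_subtopology)
  moreover have "continuous_map (?D n) X s"
    using s by (simp add: singular_simplex_def)
  ultimately have 1: "continuous_map (?D (Suc n)) X (s \<circ> degeneracy i)"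
    by (rule continuous_map_compose)
  have "continuous_map (powertop_real UNIV) euclideanreal (\<lambda>x. 1 - (\<Sum>k\<le>i. x k))"
    by (intro continuous_map_diff continuous_map_sum) (auto intro: continuous_map_product_projection)
  then have 2: "continuous_map (?D (Suc n)) (top_of_set {0..1}) (\<lambda>x. 1 - (\<Sum>k\<le>i. x k))"
    using sum_partial_standard_simplex[of _ "Suc n" i]
    by (auto simp: continuous_map_in_subtopology intro: continuous_map_from_subtopology)
  have "continuous_map (?D (Suc n)) Y (h \<circ> (\<lambda>x. (1 - (\<Sum>k\<le>i. x k), (s \<circ> degeneracy i) x)))"
    by (rule continuous_map_compose[OF continuous_map_pairedI[OF 2 1] h])
  then show ?thesis
    by (simp add: singular_simplex_def prism_def o_def)
qed

lemma sum_simplical_face: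
  "(\<Sum>k\<le>i. simplical_face j x k) = (if i < j then \<Sum>k\<le>i. x k else \<Sum>k<i. x k)" for x :: "nat \<Rightarrow> real"
proof (induction i)
  case (Suc i)
  then show ?case
    by (auto simp: simplical_face_def less_Suc_eq simp flip: lessThan_Suc_atMost)
qed (simp add: simplical_face_def)

lemma degeneracy_simplical_face:
  "j < i \<Longrightarrow> degeneracy i (simplical_face j x) = simplical_face j (degeneracy (i - 1) x)"
  "degeneracy i (simplical_face i x) = x"
  "degeneracy i (simplical_face (Suc i) x) = x"
  "Suc i < j \<Longrightarrow> degeneracy i (simplical_face j x) = simplical_face (j - 1) (degeneracy i x)"
  by (auto simp: degeneracy_def simplical_face_def fun_eq_iff
      intro: arg_cong[where f = x])

lemma singular_face_prism_apply:
  assumes "j \<le> Suc n" "x \<in> standard_simplex n"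
  shows "singular_face (Suc n) j (prism n h i s) x =
    h (1 - (if i < j then \<Sum>k\<le>i. x k else \<Sum>k<i. x k), s (degeneracy i (simplical_face j x)))"
  using assms simplical_face_in_standard_simplex[of "Suc n" j x]
  by (simp add: singular_face_def prism_def sum_simplical_face)

text \<open>The first two kinds of faces are prisms over faces of \<open>s\<close>; the third is the wall shared by two adjacent
  prism simplices; the last two are the top and the bottom of the prism.\<close>

lemma prism_faces:
  shows "j < i \<Longrightarrow> i \<le> n \<Longrightarrow> singular_face (Suc n) j (prism n h i s) = prism (n - 1) h (i - 1) (singular_face n j s)"
    and "Suc i < j \<Longrightarrow> j \<le> Suc n \<Longrightarrow>
      singular_face (Suc n) j (prism n h i s) = prism (n - 1) h i (singular_face n (j - 1) s)"
    and "Suc i \<le> n \<Longrightarrow> singular_face (Suc n) (Suc i) (prism n h (Suc i) s) =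
      singular_face (Suc n) (Suc i) (prism n h i s)"
    and "singular_face (Suc n) 0 (prism n h 0 s) = simplex_map n (\<lambda>x. h (1, x)) s"
    and "singular_face (Suc n) (Suc n) (prism n h n s) = simplex_map n (\<lambda>x. h (0, x)) s"
proof -
  have ext: "f = g" if "\<And>x. x \<in> standard_simplex n \<Longrightarrow> f x = g x"
    "f \<in> extensional (standard_simplex n)" "g \<in> extensional (standard_simplex n)" for f g :: "'a simplex"
    using that by (auto intro: extensionalityI)
  have face_ext: "singular_face (Suc n) j t \<in> extensional (standard_simplex n)" for j and t :: "'a simplex"
    by (simp add: singular_face_def)
  have prism_ext: "prism (n - Suc 0) h i t \<in> extensional (standard_simplex n)" if "n \<noteq> 0" for i and t :: "'b simplex"
    using that by (cases n) (auto simp: prism_def)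
  have face_apply: "singular_face n j s (degeneracy k x) = s (simplical_face j (degeneracy k x))"
    if "0 < n" "k \<le> n - 1" "x \<in> standard_simplex n" for k j x
    using that degeneracy_in_standard_simplex[of k "n - 1" x] by (simp add: singular_face_def)
  have lt_atMost: "{..<i} = {..i - 1}" if "0 < i" for i :: nat
    using that by auto
  show "singular_face (Suc n) j (prism n h i s) = prism (n - 1) h (i - 1) (singular_face n j s)"
    if "j < i" "i \<le> n"
  proof (rule ext)
    fix x assume x: "x \<in> standard_simplex n"
    then show "singular_face (Suc n) j (prism n h i s) x = prism (n - 1) h (i - 1) (singular_face n j s) x"
      using that face_apply[of "i - 1" x j]
      by (subst singular_face_prism_apply) (simp_all add: singular_face_prism_apply degeneracy_simplical_face prism_def lt_atMost)
  qed (use that in \<open>simp_all add: face_ext prism_ext\<close>)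
  show "singular_face (Suc n) j (prism n h i s) = prism (n - 1) h i (singular_face n (j - 1) s)"
    if "Suc i < j" "j \<le> Suc n"
  proof (rule ext)
    fix x assume x: "x \<in> standard_simplex n"
    then show "singular_face (Suc n) j (prism n h i s) x = prism (n - 1) h i (singular_face n (j - 1) s) x"
      using that face_apply[of i x "j - 1"]
      by (subst singular_face_prism_apply) (simp_all add: degeneracy_simplical_face prism_def)
  qed (use that in \<open>simp_all add: face_ext prism_ext\<close>)
  show "singular_face (Suc n) (Suc i) (prism n h (Suc i) s) =
      singular_face (Suc n) (Suc i) (prism n h i s)" if "Suc i \<le> n"
    by (rule ext) (use that in \<open>auto simp: face_ext singular_face_prism_apply degeneracy_simplical_face
      lessThan_Suc_atMost\<close>)
  have map_ext: "simplex_map n f s \<in> extensional (standard_simplex n)" for f :: "'b \<Rightarrow> 'a"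
    by (simp add: simplex_map_def)
  show "singular_face (Suc n) 0 (prism n h 0 s) = simplex_map n (\<lambda>x. h (1, x)) s"
    by (rule ext) (auto simp: face_ext map_ext singular_face_prism_apply degeneracy_simplical_face simplex_map_def)
  show "singular_face (Suc n) (Suc n) (prism n h n s) = simplex_map n (\<lambda>x. h (0, x)) s"
  proof (rule ext)
    fix x assume x: "x \<in> standard_simplex n"
    then have "(\<Sum>k\<le>n. x k) = 1"
      by (simp add: standard_simplex_def)
    then show "singular_face (Suc n) (Suc n) (prism n h n s) x = simplex_map n (\<lambda>x. h (0, x)) s x"
      using x by (simp add: singular_face_prism_apply degeneracy_simplical_face simplex_map_def)
  qed (auto simp: face_ext map_ext)
qed

text \<open>The terms with \<open>j = i\<close> or \<open>j = i + 1\<close> telescope to the two ends of the prism. Each remaining term drops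
  one of its indices by one, which changes its sign.\<close>

lemma sum_prism_faces:
  fixes a b :: "nat \<Rightarrow> nat \<Rightarrow> 'k::comm_ring_1"
  assumes below: "\<And>i j. j \<le> i \<Longrightarrow> i < n \<Longrightarrow> a (Suc i) j = b i j"
    and above: "\<And>i j. i < j \<Longrightarrow> j \<le> n \<Longrightarrow> a i (Suc j) = b i j"
    and diagonal: "\<And>i. i < n \<Longrightarrow> a (Suc i) (Suc i) = a i (Suc i)"
  shows "(\<Sum>i\<le>n. \<Sum>j\<le>Suc n. (-1) ^ i * (-1) ^ j * a i j) =
    a 0 0 - a n (Suc n) - (\<Sum>i<n. \<Sum>j\<le>n. (-1) ^ i * (-1) ^ j * b i j)"
proof -
  let ?f = "\<lambda>(i, j). (-1) ^ i * (-1) ^ j * a i j" and ?g = "\<lambda>(i, j). (-1) ^ i * (-1) ^ j * b i j"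
  let ?B = "{(i, j). j < i \<and> i \<le> n}" and ?A = "{(i, j). Suc i < j \<and> j \<le> Suc n}"
    and ?D = "(\<lambda>i. (i, i)) ` {..n}" and ?E = "(\<lambda>i. (i, Suc i)) ` {..n}"
    and ?B' = "{(i, j). j \<le> i \<and> i < n}" and ?A' = "{(i, j). i < j \<and> j \<le> n}"
  have fin: "finite ?B" "finite ?A" "finite ?B'" "finite ?A'" "finite ?D" "finite ?E"
    by (rule finite_subset[of _ "{..Suc n} \<times> {..Suc n}"]; force)+
  have part: "{..n} \<times> {..Suc n} = ?B \<union> (?A \<union> (?D \<union> ?E))"
    by (auto simp: image_iff)
  have "sum ?f ({..n} \<times> {..Suc n}) = sum ?f ?B + sum ?f (?A \<union> (?D \<union> ?E))"
    unfolding part by (rule sum.union_disjoint) (simp_all only: fin finite_Un simp_thms, force)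
  also have "sum ?f (?A \<union> (?D \<union> ?E)) = sum ?f ?A + sum ?f (?D \<union> ?E)"
    by (rule sum.union_disjoint) (simp_all only: fin finite_Un simp_thms, force)
  also have "sum ?f (?D \<union> ?E) = sum ?f ?D + sum ?f ?E"
    by (rule sum.union_disjoint) (simp_all only: fin finite_Un simp_thms, force)
  also have "sum ?f ?D + sum ?f ?E = (\<Sum>i\<le>n. a i i - a i (Suc i))"
    by (subst (1 2) sum.reindex) (auto simp: inj_on_def sum_subtractf sum_negf simp flip: power_add mult_2)
  also have "\<dots> = a 0 0 - a n (Suc n)"
    using diagonal
  proof (induction n)
    case (Suc n)
    then show ?case by simp
  qed simp
  also have "?B = (\<lambda>(i, j). (Suc i, j)) ` ?B'"
  proof (intro equalityI subsetI)
    fix z assume "z \<in> ?B"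
    then obtain i j where "z = (Suc i, j)" "j \<le> i" "i < n"
      by (cases z, cases "fst z") auto
    then show "z \<in> (\<lambda>(i, j). (Suc i, j)) ` ?B'" by force
  qed auto
  also have "sum ?f \<dots> = (\<Sum>z\<in>?B'. - ?g z)"
    by (subst sum.reindex) (force simp: inj_on_def below intro!: sum.cong)+
  also have "?A = (\<lambda>(i, j). (i, Suc j)) ` ?A'"
  proof (intro equalityI subsetI)
    fix z assume "z \<in> ?A"
    then obtain i j where "z = (i, Suc j)" "i < j" "j \<le> n"
      by (cases z, cases "snd z") auto
    then show "z \<in> (\<lambda>(i, j). (i, Suc j)) ` ?A'" by force
  qed auto
  also have "sum ?f \<dots> = (\<Sum>z\<in>?A'. - ?g z)"
    by (subst sum.reindex) (force simp: inj_on_def above intro!: sum.cong)+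
  also have "(\<Sum>z\<in>?B'. - ?g z) + ((\<Sum>z\<in>?A'. - ?g z) + (a 0 0 - a n (Suc n))) =
      a 0 0 - a n (Suc n) - (sum ?g ?B' + sum ?g ?A')"
    by (simp only: sum_negf) (simp add: algebra_simps)
  also have "sum ?g ?B' + sum ?g ?A' = sum ?g (?B' \<union> ?A')"
    by (rule sum.union_disjoint[symmetric]) (simp_all only: fin finite_Un simp_thms, force)
  also have "?B' \<union> ?A' = {..<n} \<times> {..n}"
    by auto
  finally show ?thesis
    by (simp only: sum.cartesian_product)
qed

text \<open>The alternating sum over the prism simplices is a cochain homotopy \<open>P\<close> with
  \<open>\<delta> P + P \<delta> = g\<^sup>* - f\<^sup>*\<close>, so \<open>P c\<close> is a primitive.\<close>

lemma homotopic_pullback_coboundaries: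
  fixes X :: "'a topology" and Y :: "'b topology"
  assumes "homotopic_with (\<lambda>x. True) X Y f g" and c: "c \<in> cocycles Y"
  shows "pullback_cochain X g c - pullback_cochain X f c \<in> coboundaries X"
proof -
  obtain h :: "real \<times> 'a \<Rightarrow> 'b" where h: "continuous_map (prod_topology (top_of_set {0..1}) X) Y h"
    and h0: "\<And>x. h (0, x) = f x" and h1: "\<And>x. h (1, x) = g x"
    using assms(1) by (auto simp: homotopic_with_def)
  define P where "P = (\<lambda>n s. if singular_simplex n X s
    then \<Sum>i\<le>n. (-1) ^ i * c (Suc n) (prism n h i s) else 0)"
  have P: "P \<in> cochains X"
  proof (rule cochains_supportI[where N = "(\<lambda>n. n - 1) ` {n. c n \<noteq> 0}"])
    show "P n = 0" if "n \<notin> (\<lambda>n. n - 1) ` {n. c n \<noteq> 0}" for n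
    proof -
      have "c (Suc n) = 0"
        using that by (metis (mono_tags, lifting) diff_Suc_1 imageI mem_Collect_eq)
      then show ?thesis by (simp add: P_def fun_eq_iff)
    qed
  qed (use c in \<open>auto simp: P_def cocycles_iff cochains_iff\<close>)
  have "pullback_cochain X g c - pullback_cochain X f c = coboundary X P"
  proof (rule cochains_eqI)
    fix n s assume s: "singular_simplex n X s"
    define a where "a i j = c n (singular_face (Suc n) j (prism n h i s))" for i j
    define b where "b i j = c n (prism (n - 1) h i (singular_face n j s))" for i j
    have "0 = (\<Sum>i\<le>n. (-1) ^ i * coboundary Y c (Suc n) (prism n h i s))"
      using c by (simp add: cocycles_iff)
    also have "\<dots> = (\<Sum>i\<le>n. \<Sum>j\<le>Suc n. (-1) ^ i * (-1) ^ j * a i j)"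
      using singular_simplex_prism[OF h s]
      by (simp add: coboundary_Suc a_def sum_distrib_left mult.assoc del: sum.atMost_Suc)
    also have "\<dots> = a 0 0 - a n (Suc n) - (\<Sum>i<n. \<Sum>j\<le>n. (-1) ^ i * (-1) ^ j * b i j)"
      by (rule sum_prism_faces) (simp_all add: a_def b_def prism_faces)
    also have "a 0 0 - a n (Suc n) = pullback_cochain X g c n s - pullback_cochain X f c n s"
      using s by (simp add: a_def prism_faces(4,5) h0 h1 pullback_cochain_apply)
    also have "(\<Sum>i<n. \<Sum>j\<le>n. (-1) ^ i * (-1) ^ j * b i j) = coboundary X P n s"
    proof (cases n)
      case (Suc m)
      have "singular_simplex m X (singular_face n j s)" if "j \<le> n" for j
        using singular_simplex_singular_face[OF s] that Suc by auto
      then have "coboundary X P n s = (\<Sum>j\<le>n. (-1) ^ j * (\<Sum>i\<le>m. (-1) ^ i * b i j))"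
        using s Suc by (simp add: coboundary_Suc P_def b_def del: sum.atMost_Suc)
      also have "\<dots> = (\<Sum>j\<le>n. \<Sum>i<n. (-1) ^ i * (-1) ^ j * b i j)"
        by (simp only: sum_distrib_left Suc lessThan_Suc_atMost mult_ac)
      finally show ?thesis
        by (subst sum.swap) simp
    qed simp
    finally show "(pullback_cochain X g c - pullback_cochain X f c) n s = coboundary X P n s"
      by simp
  qed (use P c in \<open>auto simp: cocycles_iff intro: pullback_cochains\<close>)
  with P show ?thesis
    by (simp add: coboundariesI)
qed

section \<open>Covering space actions\<close>

text \<open>The laws are only required on the points of \<open>Y\<close>. A locale of homomorphisms into the group of extensional
  bijections would exclude the diagonal action, whose components are applied separately and which
  therefore has no fixed value outside of the product space.\<close>

locale continuous_group_action = group G for G (structure) +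
  fixes Y :: "'y topology" and \<psi> :: "'a \<Rightarrow> 'y \<Rightarrow> 'y"
  assumes continuous_act: "g \<in> carrier G \<Longrightarrow> continuous_map Y Y (\<psi> g)"
    and act_one: "y \<in> topspace Y \<Longrightarrow> \<psi> \<one> y = y"
    and act_mult: "g \<in> carrier G \<Longrightarrow> h \<in> carrier G \<Longrightarrow> y \<in> topspace Y \<Longrightarrow>
      \<psi> (g \<otimes> h) y = \<psi> g (\<psi> h y)"
begin

lemma act_closed: "g \<in> carrier G \<Longrightarrow> y \<in> topspace Y \<Longrightarrow> \<psi> g y \<in> topspace Y"
  using continuous_act by (auto simp: continuous_map_def)

lemma act_inv: "g \<in> carrier G \<Longrightarrow> y \<in> topspace Y \<Longrightarrow> \<psi> (inv g) (\<psi> g y) = y"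
  by (simp add: act_one flip: act_mult)

lemma orbit_eq_iff:
  assumes "y \<in> topspace Y" "z \<in> topspace Y"
  shows "orbit G \<psi> y = orbit G \<psi> z \<longleftrightarrow> (\<exists>g\<in>carrier G. z = \<psi> g y)"
proof
  assume "orbit G \<psi> y = orbit G \<psi> z"
  moreover have "z \<in> orbit G \<psi> z"
    using assms(2) act_one one_closed by (force simp: orbit_def)
  ultimately show "\<exists>g\<in>carrier G. z = \<psi> g y"
    by (auto simp: orbit_def)
next
  assume "\<exists>g\<in>carrier G. z = \<psi> g y"
  then obtain g where g: "g \<in> carrier G" "z = \<psi> g y" by blast
  have "orbit G \<psi> z \<subseteq> orbit G \<psi> y"
    using g assms by (force simp: orbit_def simp flip: act_mult)
  moreover have "orbit G \<psi> y \<subseteq> orbit G \<psi> z"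
  proof
    fix w assume "w \<in> orbit G \<psi> y"
    then obtain h where h: "h \<in> carrier G" "w = \<psi> h y" by (auto simp: orbit_def)
    then have "w = \<psi> (h \<otimes> inv g) z"
      using g assms by (simp add: act_mult act_inv act_closed)
    then show "w \<in> orbit G \<psi> z"
      using g h by (auto simp: orbit_def)
  qed
  ultimately show "orbit G \<psi> y = orbit G \<psi> z" by blast
qed

abbreviation orbit_space :: "'y set topology" where
  "orbit_space \<equiv> quotient_topology Y (orbit G \<psi>)"

lemma continuous_orbit: "continuous_map Y orbit_space (orbit G \<psi>)"
  by (simp add: quotient_imp_continuous_map quotient_map_quotient_topology)

text \<open>The saturation of an open set is the union of its translates.\<close>

lemma open_orbit_map:
  assumes V: "openin Y V" shows "openin orbit_space (orbit G \<psi> ` V)"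
proof -
  have sub: "V \<subseteq> topspace Y"
    using V by (rule openin_subset)
  have "{y \<in> topspace Y. orbit G \<psi> y \<in> orbit G \<psi> ` V} = (\<Union>g\<in>carrier G. {y \<in> topspace Y. \<psi> g y \<in> V})"
  proof (intro equalityI subsetI)
    fix y assume "y \<in> {y \<in> topspace Y. orbit G \<psi> y \<in> orbit G \<psi> ` V}"
    then obtain v where v: "y \<in> topspace Y" "v \<in> V" "orbit G \<psi> y = orbit G \<psi> v"
      by blast
    then obtain g where "g \<in> carrier G" "v = \<psi> g y"
      using orbit_eq_iff[of y v] sub by blast
    with v show "y \<in> (\<Union>g\<in>carrier G. {y \<in> topspace Y. \<psi> g y \<in> V})"
      by blast
  next
    fix y assume "y \<in> (\<Union>g\<in>carrier G. {y \<in> topspace Y. \<psi> g y \<in> V})"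
    then obtain g where g: "g \<in> carrier G" "y \<in> topspace Y" "\<psi> g y \<in> V"
      by blast
    then have "orbit G \<psi> y = orbit G \<psi> (\<psi> g y)"
      by (auto simp: orbit_eq_iff act_closed)
    with g show "y \<in> {y \<in> topspace Y. orbit G \<psi> y \<in> orbit G \<psi> ` V}"
      by blast
  qed
  moreover have "openin Y {y \<in> topspace Y. \<psi> g y \<in> V}" if "g \<in> carrier G" for g
    using openin_continuous_map_preimage[OF continuous_act[OF that] V] .
  ultimately show ?thesis
    using sub by (auto simp: openin_quotient_topology)
qed

end

lemma continuous_group_action_if_continuous_action:
  assumes "group G" "continuous_action G X \<phi>"
  shows "continuous_group_action G X \<phi>"
proof -
  have act: "group_action G (topspace X) \<phi>"
    using assms(2) by (simp add: continuous_action_def)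
  show ?thesis
    using assms group_action.id_eq_one[OF act] group_action.composition_rule[OF act]
    by (auto simp: continuous_group_action_def continuous_group_action_axioms_def continuous_action_def
        dest: fun_cong simp flip: fun_eq_iff) (metis restrict_apply')
qed

locale covering_space_action = continuous_group_action G Y \<psi>
  for G (structure) and Y :: "'y topology" and \<psi> :: "'a \<Rightarrow> 'y \<Rightarrow> 'y" +
  assumes even_neighbourhood: "\<And>y. y \<in> topspace Y \<Longrightarrow>
    \<exists>U. openin Y U \<and> y \<in> U \<and> (\<forall>g\<in>carrier G. g \<noteq> \<one> \<longrightarrow> \<psi> g ` U \<inter> U = {})"
begin

lemma even_neighbourhoodE:
  assumes "y \<in> topspace Y"
  obtains U where "openin Y U" "y \<in> U" "\<And>g u. g \<in> carrier G \<Longrightarrow> u \<in> U \<Longrightarrow> \<psi> g u \<in> U \<Longrightarrow> g = \<one>"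
  using even_neighbourhood[OF assms] by blast

lemma free:
  assumes "g \<in> carrier G" "h \<in> carrier G" "y \<in> topspace Y" "\<psi> g y = \<psi> h y"
  shows "g = h"
proof -
  have "\<psi> (inv h \<otimes> g) y = y"
    using assms by (simp add: act_mult act_inv)
  then have "inv h \<otimes> g = \<one>"
    using even_neighbourhoodE[OF assms(3)] assms(1,2) by (metis inv_closed m_closed)
  then show ?thesis
    using assms by (metis inv_equality inv_inv inv_closed)
qed

text \<open>The sets on which \<open>m\<close> is the translate of \<open>l\<close> by \<open>g\<close> cover \<open>T\<close>, are pairwise disjoint because the action is
  free, and are open: near a point of such a set both \<open>m\<close> and the translate of \<open>l\<close> stay in a neighbourhood
  that contains at most one point of each orbit. A connected space has room for one of them only.\<close>

lemma lifts_differ_by_translation: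
  assumes T: "connected_space T"
    and l: "continuous_map T Y l" and m: "continuous_map T Y m"
    and eq: "\<And>t. t \<in> topspace T \<Longrightarrow> orbit G \<psi> (l t) = orbit G \<psi> (m t)"
  obtains g where "g \<in> carrier G" "\<And>t. t \<in> topspace T \<Longrightarrow> m t = \<psi> g (l t)"
proof (cases "topspace T = {}")
  case False
  define A where "A g = {t \<in> topspace T. m t = \<psi> g (l t)}" for g
  have lY: "l t \<in> topspace Y" and mY: "m t \<in> topspace Y" if "t \<in> topspace T" for t
    using that l m by (auto simp: continuous_map_def)
  have cover: "\<exists>g\<in>carrier G. t \<in> A g" if "t \<in> topspace T" for t
    using eq[OF that] lY[OF that] mY[OF that] that by (auto simp: orbit_eq_iff A_def)
  have openA: "openin T (A g)" if g: "g \<in> carrier G" for g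
  proof (subst openin_subopen, intro ballI)
    fix t assume t: "t \<in> A g"
    then have tT: "t \<in> topspace T" by (simp add: A_def)
    obtain U where U: "openin Y U" "m t \<in> U"
      "\<And>g u. g \<in> carrier G \<Longrightarrow> u \<in> U \<Longrightarrow> \<psi> g u \<in> U \<Longrightarrow> g = \<one>"
      using even_neighbourhoodE[OF mY[OF tT]] by metis
    have "continuous_map T Y (\<psi> g \<circ> l)"
      using l continuous_act[OF g] by (rule continuous_map_compose)
    then have "openin T ({t \<in> topspace T. m t \<in> U} \<inter> {t \<in> topspace T. (\<psi> g \<circ> l) t \<in> U})"
      by (intro openin_Int openin_continuous_map_preimage[OF _ U(1)] m)
    moreover have "t \<in> {t \<in> topspace T. m t \<in> U} \<inter> {t \<in> topspace T. (\<psi> g \<circ> l) t \<in> U}"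
      using t U(2) by (auto simp: A_def)
    moreover have "{t \<in> topspace T. m t \<in> U} \<inter> {t \<in> topspace T. (\<psi> g \<circ> l) t \<in> U} \<subseteq> A g"
    proof
      fix t assume "t \<in> {t \<in> topspace T. m t \<in> U} \<inter> {t \<in> topspace T. (\<psi> g \<circ> l) t \<in> U}"
      then have t: "t \<in> topspace T" "m t \<in> U" "\<psi> g (l t) \<in> U" by auto
      obtain k where k: "k \<in> carrier G" "m t = \<psi> k (l t)"
        using cover[OF t(1)] by (auto simp: A_def)
      have "\<psi> (k \<otimes> inv g) (\<psi> g (l t)) = m t"
        using k g lY[OF t(1)] by (simp add: act_mult act_inv act_closed)
      then have "k \<otimes> inv g = \<one>"
        using U(3)[of "k \<otimes> inv g" "\<psi> g (l t)"] t k g by simp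
      then have "k = g"
        using k g by (metis inv_closed inv_equality inv_inv)
      then show "t \<in> A g"
        using t k by (simp add: A_def)
    qed
    ultimately show "\<exists>N. openin T N \<and> t \<in> N \<and> N \<subseteq> A g"
      by blast
  qed
  obtain t g where t: "t \<in> topspace T" and g: "g \<in> carrier G" "t \<in> A g"
    using False cover by blast
  have "topspace T - A g = (\<Union>h\<in>carrier G - {g}. A h)"
  proof (intro equalityI subsetI)
    fix t assume "t \<in> topspace T - A g"
    then show "t \<in> (\<Union>h\<in>carrier G - {g}. A h)"
      using cover[of t] by auto
  next
    fix t assume "t \<in> (\<Union>h\<in>carrier G - {g}. A h)"
    then obtain h where h: "h \<in> carrier G" "h \<noteq> g" "t \<in> topspace T" "m t = \<psi> h (l t)"
      by (auto simp: A_def)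
    then have "t \<notin> A g"
      using free[OF h(1) g(1) lY[OF h(3)]] by (auto simp: A_def)
    with h(3) show "t \<in> topspace T - A g" by blast
  qed
  moreover have "openin T (\<Union>h\<in>carrier G - {g}. A h)"
    using openA by (intro openin_Union) auto
  ultimately have "closedin T (A g)"
    by (auto simp: closedin_def A_def)
  then have "A g = topspace T"
    using T openA[OF g(1)] g(2) by (auto simp: connected_space_clopen_in)
  then show ?thesis
    using that[OF g(1)] by (auto simp: A_def)
qed (use that[OF one_closed] in simp)

definition liftable :: "'t topology \<Rightarrow> ('t \<Rightarrow> 'y set) \<Rightarrow> 't set \<Rightarrow> bool" where
  "liftable T \<sigma> S \<longleftrightarrow>
    (\<exists>l. continuous_map (subtopology T S) Y l \<and> (\<forall>t\<in>topspace T \<inter> S. orbit G \<psi> (l t) = \<sigma> t))"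

lemma liftable_subset:
  assumes "liftable T \<sigma> S" "S' \<subseteq> S" shows "liftable T \<sigma> S'"
proof -
  obtain l where "continuous_map (subtopology T S) Y l"
      "\<forall>t\<in>topspace T \<inter> S. orbit G \<psi> (l t) = \<sigma> t"
    using assms(1) unfolding liftable_def by blast
  then show ?thesis
    unfolding liftable_def using assms(2) continuous_map_from_subtopology_mono by (intro exI[of _ l]) blast
qed

text \<open>On a neighbourhood \<open>U\<close> that is disjoint from its nontrivial translates, the orbit map is open and injective, so it has a continuous
  inverse there.\<close>

lemma locally_liftable:
  assumes \<sigma>: "continuous_map T orbit_space \<sigma>" and t: "t \<in> topspace T"
  shows "\<exists>N. openin T N \<and> t \<in> N \<and> liftable T \<sigma> N"
proof -
  have "\<sigma> t \<in> orbit G \<psi> ` topspace Y"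
    using \<sigma> t by (auto simp: continuous_map_def topspace_quotient_topology)
  then obtain y where y: "y \<in> topspace Y" "\<sigma> t = orbit G \<psi> y" by blast
  obtain U where U: "openin Y U" "y \<in> U"
    "\<And>g u. g \<in> carrier G \<Longrightarrow> u \<in> U \<Longrightarrow> \<psi> g u \<in> U \<Longrightarrow> g = \<one>"
    using even_neighbourhoodE[OF y(1)] by metis
  have UY: "U \<subseteq> topspace Y"
    using U(1) by (rule openin_subset)
  have inj: "inj_on (orbit G \<psi>) U"
    using U(3) UY act_one by (intro inj_onI) (metis orbit_eq_iff subsetD)
  define N where "N = {t \<in> topspace T. \<sigma> t \<in> orbit G \<psi> ` U}"
  define l where "l = inv_into U (orbit G \<psi>) \<circ> \<sigma>"
  have "openin T N"
    unfolding N_def by (rule openin_continuous_map_preimage[OF \<sigma> open_orbit_map[OF U(1)]])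
  moreover have "t \<in> N"
    using t y U by (auto simp: N_def)
  moreover have l: "l t \<in> U" "orbit G \<psi> (l t) = \<sigma> t" if "t \<in> N" for t
    using that by (auto simp: N_def l_def inv_into_into f_inv_into_f)
  have "continuous_map (subtopology T N) Y l"
    unfolding continuous_map_def
  proof (intro conjI allI impI)
    show "l \<in> topspace (subtopology T N) \<rightarrow> topspace Y"
      using l UY by (auto simp: N_def)
    fix V assume V: "openin Y V"
    have "{t \<in> topspace (subtopology T N). l t \<in> V} = {t \<in> topspace T. \<sigma> t \<in> orbit G \<psi> ` (V \<inter> U)} \<inter> N"
    proof (intro equalityI subsetI)
      fix t assume "t \<in> {t \<in> topspace (subtopology T N). l t \<in> V}"
      then show "t \<in> {t \<in> topspace T. \<sigma> t \<in> orbit G \<psi> ` (V \<inter> U)} \<inter> N"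
        using l[of t] by (auto simp: image_iff intro!: bexI[of _ "l t"])
    next
      fix t assume t: "t \<in> {t \<in> topspace T. \<sigma> t \<in> orbit G \<psi> ` (V \<inter> U)} \<inter> N"
      then obtain u where u: "u \<in> V" "u \<in> U" "\<sigma> t = orbit G \<psi> u" by blast
      then have "l t = u"
        using inj by (simp add: l_def)
      with t u show "t \<in> {t \<in> topspace (subtopology T N). l t \<in> V}" by auto
    qed
    moreover have "openin T {t \<in> topspace T. \<sigma> t \<in> orbit G \<psi> ` (V \<inter> U)}"
      by (intro openin_continuous_map_preimage[OF \<sigma>] open_orbit_map openin_Int V U(1))
    ultimately show "openin (subtopology T N) {t \<in> topspace (subtopology T N). l t \<in> V}"
      by (auto simp: openin_subtopology)
  qed
  then have "liftable T \<sigma> N"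
    using l by (auto simp: liftable_def)
  ultimately show ?thesis by blast
qed

text \<open>Over the connected intersection the two lifts differ by a translation; after translating one of them
  they agree there and can be pasted.\<close>

lemma liftable_Un:
  assumes S: "liftable T \<sigma> S" "liftable T \<sigma> S'" and closed: "closedin T S" "closedin T S'"
    and conn: "connectedin T (S \<inter> S')"
  shows "liftable T \<sigma> (S \<union> S')"
proof -
  obtain l where l: "continuous_map (subtopology T S) Y l"
      "\<forall>t\<in>topspace T \<inter> S. orbit G \<psi> (l t) = \<sigma> t"
    using S(1) unfolding liftable_def by blast
  obtain l' where l': "continuous_map (subtopology T S') Y l'"
      "\<forall>t\<in>topspace T \<inter> S'. orbit G \<psi> (l' t) = \<sigma> t"
    using S(2) unfolding liftable_def by blast
  have sub: "S \<subseteq> topspace T" "S' \<subseteq> topspace T"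
    using closed by (auto dest: closedin_subset)
  obtain g where g: "g \<in> carrier G"
    "\<And>t. t \<in> topspace (subtopology T (S \<inter> S')) \<Longrightarrow> l' t = \<psi> g (l t)"
  proof (rule lifts_differ_by_translation)
    show "connected_space (subtopology T (S \<inter> S'))"
      using conn by (simp add: connectedin_def)
    show "continuous_map (subtopology T (S \<inter> S')) Y l" "continuous_map (subtopology T (S \<inter> S')) Y l'"
      using l(1) l'(1) by (auto intro: continuous_map_from_subtopology_mono)
  qed (use l(2) l'(2) in auto)
  have gl: "continuous_map (subtopology T S) Y (\<psi> g \<circ> l)"
    using l(1) continuous_act[OF g(1)] by (rule continuous_map_compose)
  define f where "f b = (if b then \<psi> g \<circ> l else l')" for b :: bool
  define C where "C b = (if b then S else S')" for b :: bool
  define m where "m t = (if t \<in> S then \<psi> g (l t) else l' t)" for t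
  have "continuous_map (subtopology T (S \<union> S')) Y m"
  proof (rule pasting_lemma_closed[where I = UNIV and T = C and f = f])
    show "closedin (subtopology T (S \<union> S')) (C b)" for b
      using closed by (cases b) (simp_all add: C_def closedin_subset_topspace)
    show "continuous_map (subtopology (subtopology T (S \<union> S')) (C b)) Y (f b)" for b
      using gl l'(1) by (cases b) (simp_all add: C_def f_def subtopology_subtopology Int_absorb1)
    show "f b t = f b' t" if "t \<in> topspace (subtopology T (S \<union> S')) \<inter> C b \<inter> C b'" for b b' t
      using that g(2)[of t] by (cases b; cases b') (simp_all add: C_def f_def)
    show "\<exists>b. b \<in> UNIV \<and> t \<in> C b \<and> m t = f b t" if "t \<in> topspace (subtopology T (S \<union> S'))" for t
      using that by (intro exI[of _ "t \<in> S"]) (auto simp: C_def f_def m_def)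
  qed auto
  moreover have "orbit G \<psi> (m t) = \<sigma> t" if "t \<in> S \<union> S'" for t
  proof (cases "t \<in> S")
    case True
    then have "l t \<in> topspace Y"
      using l(1) sub by (auto simp: continuous_map_def)
    then have "orbit G \<psi> (l t) = orbit G \<psi> (\<psi> g (l t))"
      using g(1) act_closed orbit_eq_iff by blast
    then show ?thesis
      using True l(2) sub by (auto simp: m_def)
  qed (use that l'(2) sub in \<open>auto simp: m_def\<close>)
  ultimately show ?thesis
    by (auto simp: liftable_def)
qed

end

section \<open>Lifting simplices through a covering\<close>

lemma connectedin_convex_functions:
  fixes S :: "(nat \<Rightarrow> real) set"
  assumes "\<And>x y u. x \<in> S \<Longrightarrow> y \<in> S \<Longrightarrow> 0 \<le> u \<Longrightarrow> u \<le> 1 \<Longrightarrow> (\<lambda>i. (1 - u) * x i + u * y i) \<in> S"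
  shows "connectedin (powertop_real UNIV) S"
proof (rule path_connectedin_imp_connectedin)
  define g :: "(nat \<Rightarrow> real) \<Rightarrow> (nat \<Rightarrow> real) \<Rightarrow> real \<Rightarrow> nat \<Rightarrow> real"
    where "g x y = (\<lambda>u i. (1 - u) * x i + u * y i)" for x y
  have "continuous_map (top_of_set {0..1}) (powertop_real UNIV) (g x y)" for x y
    unfolding g_def continuous_map_componentwise by (force intro: continuous_intros)
  moreover have "g x y \<in> {0..1} \<rightarrow> S" "g x y 0 = x" "g x y 1 = y" if "x \<in> S" "y \<in> S" for x y
    using that assms by (auto simp: g_def)
  ultimately show "path_connectedin (powertop_real UNIV) S"
    unfolding path_connectedin_def path_connected_space_def pathin_def
    by (metis continuous_map_in_subtopology euclidean_product_topology top_greatest topspace_euclidean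
        topspace_euclidean_subtopology)
qed

text \<open>The coordinates above \<open>n\<close> vanish on the simplex, so that finitely many constraints suffice.\<close>

lemma standard_simplex_box_neighbourhood:
  assumes W: "openin (powertop_real UNIV) W" "c \<in> W" and c: "\<And>i. n < i \<Longrightarrow> c i = 0"
  shows "\<exists>e>0. \<forall>x\<in>standard_simplex n. (\<forall>i\<le>n. \<bar>x i - c i\<bar> \<le> e) \<longrightarrow> x \<in> W"
proof -
  obtain U where U: "\<forall>i\<in>UNIV. openin euclideanreal (U i)" "c \<in> PiE UNIV U" "PiE UNIV U \<subseteq> W"
    using bspec[OF W(1)[unfolded openin_product_topology_alt] W(2)] by (elim exE conjE)
  have "\<exists>e>0. \<forall>r. \<bar>r - c i\<bar> \<le> e \<longrightarrow> r \<in> U i" for i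
  proof -
    have "open (U i)" "c i \<in> U i"
      using U(1) PiE_mem[OF U(2)] by simp_all
    then obtain e where "e > 0" "cball (c i) e \<subseteq> U i"
      unfolding open_contains_cball by blast
    then show ?thesis
      by (intro exI[of _ e]) (auto simp: dist_real_def abs_minus_commute subset_iff)
  qed
  then obtain e where "\<forall>i. e i > 0 \<and> (\<forall>r. \<bar>r - c i\<bar> \<le> e i \<longrightarrow> r \<in> U i)"
    by (rule choice[OF allI, THEN exE])
  then have e: "e i > 0" "\<bar>r - c i\<bar> \<le> e i \<Longrightarrow> r \<in> U i" for i r
    by simp_all
  have "x \<in> W" if x: "x \<in> standard_simplex n" "\<forall>i\<le>n. \<bar>x i - c i\<bar> \<le> Min (e ` {..n})" for x
  proof -
    have "x i \<in> U i" for i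
    proof (cases "i \<le> n")
      case True
      then have "Min (e ` {..n}) \<le> e i" by simp
      then show ?thesis
        using x(2) True e(2) by (meson order_trans)
    next
      case False
      then show ?thesis
        using x(1) c PiE_mem[OF U(2), of i] by (simp add: standard_simplex_def)
    qed
    then have "x \<in> PiE UNIV U"
      by (auto simp: PiE_def)
    then show ?thesis
      using U(3) by (rule subsetD[rotated])
  qed
  moreover have "Min (e ` {..n}) > 0"
    using e(1) by simp
  ultimately show ?thesis by blast
qed

context covering_space_action
begin

text \<open>Boxes that confine all coordinates are liftable if they are small enough. The coordinates are released
  one at a time: by bisection of the interval \<open>[0, 1]\<close> in which the coordinate ranges, short pieces that are
  liftable are joined along slices, which are convex and thus connected.\<close>

lemma liftable_standard_simplex:
  fixes n :: nat
  defines "T \<equiv> subtopology (powertop_real UNIV) (standard_simplex n)"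
  assumes \<sigma>: "continuous_map T orbit_space \<sigma>"
  shows "liftable T \<sigma> (standard_simplex n)"
proof -
  have topT [simp]: "topspace T = standard_simplex n"
    by (simp add: T_def)
  define box where
    "box k c e = {x \<in> standard_simplex n. \<forall>i\<le>n. k \<le> i \<longrightarrow> \<bar>x i - c i\<bar> \<le> e}" for k c and e :: real
  have main: "\<exists>e>0. liftable T \<sigma> (box k c e)" if "k \<le> Suc n" for k c
    using that
  proof (induction k arbitrary: c)
    case 0
    \<comment> \<open>The values of \<open>c\<close> above \<open>n\<close> do not constrain the box. They are replaced by \<open>0\<close>, the value
      of these coordinates on the simplex.\<close>
    define c' where "c' i = (if i \<le> n then c i else 0)" for i
    have "\<exists>W. openin (powertop_real UNIV) W \<and> c' \<in> W \<and> liftable T \<sigma> (standard_simplex n \<inter> W)"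
    proof (cases "c' \<in> standard_simplex n")
      case True
      then obtain N where "openin T N" "c' \<in> N" "liftable T \<sigma> N"
        using locally_liftable[OF \<sigma>] by auto
      then show ?thesis
        by (auto simp: T_def openin_subtopology Int_commute)
    next
      case False
      have "liftable T \<sigma> {}"
        by (auto simp: liftable_def)
      then show ?thesis
        using False closedin_standard_simplex[of n]
        by (intro exI[of _ "- standard_simplex n"]) (auto simp: closedin_def Compl_eq_Diff_UNIV)
    qed
    then obtain W where W: "openin (powertop_real UNIV) W" "c' \<in> W" "liftable T \<sigma> (standard_simplex n \<inter> W)"
      by blast
    obtain e where e: "e > 0"
      "\<And>x. x \<in> standard_simplex n \<Longrightarrow> (\<forall>i\<le>n. \<bar>x i - c' i\<bar> \<le> e) \<Longrightarrow> x \<in> W"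
      using standard_simplex_box_neighbourhood[OF W(1,2), of n] by (auto simp: c'_def)
    have "box 0 c e \<subseteq> standard_simplex n \<inter> W"
      using e(2) by (auto simp: box_def c'_def)
    then show ?case
      using W(3) liftable_subset e(1) by blast
  next
    case (Suc k)
    then have k: "k \<le> n" by simp
    have abs_iff: "\<bar>r - s\<bar> \<le> e \<longleftrightarrow> s - e \<le> r \<and> r \<le> s + e" for r s e :: real
      by linarith
    define slab where "slab a b e = {x \<in> standard_simplex n. a \<le> x k \<and> x k \<le> b} \<inter> box (Suc k) c e" for a b e
    have slab_closed: "closedin T (slab a b e)" for a b e
    proof -
      have proj: "continuous_map T euclideanreal (\<lambda>x. x i)" for i
        unfolding T_def
        by (intro continuous_map_from_subtopology)
          (use continuous_map_product_projection[of i UNIV "\<lambda>_. euclideanreal"] in simp)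
      have "slab a b e = (\<Inter>i\<in>insert k {Suc k..n}.
          {x \<in> topspace T. x i \<in> {if i = k then a else c i - e..if i = k then b else c i + e}})"
        by (auto simp: slab_def box_def abs_iff)
      also have "closedin T \<dots>"
        by (intro closedin_INT closedin_continuous_map_preimage[OF proj]) auto
      finally show ?thesis .
    qed
    have slab_connected: "connectedin T (slab a b e)" for a b e
    proof -
      have "connectedin (powertop_real UNIV) (slab a b e)"
      proof (rule connectedin_convex_functions)
        fix x y :: "nat \<Rightarrow> real" and u :: real
        assume xy: "x \<in> slab a b e" "y \<in> slab a b e" and u: "0 \<le> u" "u \<le> 1"
        have between: "p \<le> (1 - u) * r + u * s \<and> (1 - u) * r + u * s \<le> q"
          if "p \<le> r" "r \<le> q" "p \<le> s" "s \<le> q" for p q r s :: real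
          using that u convex_bound_le[of r q s "1 - u" u] convex_bound_le[of "-r" "-p" "-s" "1 - u" u]
          by (simp add: algebra_simps)
        show "(\<lambda>i. (1 - u) * x i + u * y i) \<in> slab a b e"
          using xy u between[of a "x k" b "y k"] between[of "c _ - e" "x _" "c _ + e" "y _"]
          by (auto simp: slab_def box_def convex_standard_simplex abs_iff)
      qed
      then show ?thesis
        by (auto simp: T_def connectedin_subtopology slab_def)
    qed
    have "\<exists>e>0. liftable T \<sigma> (slab 0 1 e)"
    proof (rule Bolzano[where P = "\<lambda>a b. \<exists>e>0. liftable T \<sigma> (slab a b e)"])
      fix a b d :: real
      assume ab: "\<exists>e>0. liftable T \<sigma> (slab a b e)" and bd: "\<exists>e>0. liftable T \<sigma> (slab b d e)"
        and le: "a \<le> b" "b \<le> d"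
      obtain e e' where e: "e > 0" "liftable T \<sigma> (slab a b e)" "e' > 0" "liftable T \<sigma> (slab b d e')"
        using ab bd by blast
      let ?m = "min e e'"
      have "liftable T \<sigma> (slab a b ?m)" "liftable T \<sigma> (slab b d ?m)"
        by (rule liftable_subset[OF e(2)] liftable_subset[OF e(4)]; force simp: slab_def box_def)+
      moreover have "slab a b ?m \<inter> slab b d ?m = slab b b ?m"
        using le by (auto simp: slab_def)
      ultimately have "liftable T \<sigma> (slab a b ?m \<union> slab b d ?m)"
        by (intro liftable_Un slab_closed) (simp_all add: slab_connected)
      moreover have "slab a b ?m \<union> slab b d ?m = slab a d ?m"
        using le by (auto simp: slab_def)
      ultimately show "\<exists>e>0. liftable T \<sigma> (slab a d e)"
        using e by (intro exI[of _ ?m]) simp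
    next
      fix r :: real
      obtain e where e: "e > 0" "liftable T \<sigma> (box k (c(k := r)) e)"
        using Suc.IH[OF Suc_leD[OF Suc.prems], of "c(k := r)"] by blast
      have "liftable T \<sigma> (slab a b e)" if "a \<le> r" "r \<le> b" "b - a < e" for a b
      proof (rule liftable_subset[OF e(2)])
        show "slab a b e \<subseteq> box k (c(k := r)) e"
          using that by (auto simp: slab_def box_def)
      qed
      then show "\<exists>d>0. \<forall>a b. a \<le> r \<and> r \<le> b \<and> b - a < d \<longrightarrow> (\<exists>e>0. liftable T \<sigma> (slab a b e))"
        using e(1) by blast
    qed simp
    moreover have "slab 0 1 e = box (Suc k) c e" for e
      by (auto simp: slab_def box_def standard_simplex_def)
    ultimately show ?case by simp
  qed
  have "box (Suc n) c e = standard_simplex n" for c e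
    by (auto simp: box_def)
  then show ?thesis
    using main[of "Suc n"] by auto
qed

lemma singular_simplex_lift:
  assumes "singular_simplex n orbit_space \<sigma>"
  obtains s where "singular_simplex n Y s" "simplex_map n (orbit G \<psi>) s = \<sigma>"
proof -
  let ?D = "standard_simplex n"
  obtain l where l: "continuous_map (subtopology (powertop_real UNIV) ?D) Y l"
    "\<And>t. t \<in> ?D \<Longrightarrow> orbit G \<psi> (l t) = \<sigma> t"
    using liftable_standard_simplex[of n \<sigma>] assms
    by (auto simp: liftable_def singular_simplex_def subtopology_subtopology)
  show ?thesis
  proof (rule that)
    show "singular_simplex n Y (restrict l ?D)"
      using l(1) by (auto simp: singular_simplex_def intro: continuous_map_eq)
    show "simplex_map n (orbit G \<psi>) (restrict l ?D) = \<sigma>"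
      using l(2) assms
      by (intro extensionalityI[where A = ?D]) (auto simp: simplex_map_def singular_simplex_def)
  qed
qed

lemma singular_simplex_lifts_translate:
  assumes "singular_simplex n Y s" "singular_simplex n Y s'"
    and "simplex_map n (orbit G \<psi>) s = simplex_map n (orbit G \<psi>) s'"
  obtains g where "g \<in> carrier G" "s' = simplex_map n (\<psi> g) s"
proof -
  let ?T = "subtopology (powertop_real UNIV) (standard_simplex n)"
  obtain g where g: "g \<in> carrier G" "\<And>t. t \<in> topspace ?T \<Longrightarrow> s' t = \<psi> g (s t)"
  proof (rule lifts_differ_by_translation[of ?T s s'])
    show "connected_space ?T"
      using connectedin_standard_simplex by (simp add: connectedin_def)
    show "orbit G \<psi> (s t) = orbit G \<psi> (s' t)" if "t \<in> topspace ?T" for t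
      using fun_cong[OF assms(3), of t] that by (simp add: simplex_map_def)
  qed (use assms in \<open>auto simp: singular_simplex_def\<close>)
  have "s' = simplex_map n (\<psi> g) s"
    using g(2) assms(2)
    by (intro extensionalityI[where A = "standard_simplex n"]) (auto simp: simplex_map_def singular_simplex_def)
  with g(1) show ?thesis by (rule that)
qed

end

section \<open>Cohomology of discrete spaces\<close>

definition constant_simplex :: "nat \<Rightarrow> 'a \<Rightarrow> 'a simplex" where
  "constant_simplex n g = restrict (\<lambda>_. g) (standard_simplex n)"

lemma singular_simplex_constant: "g \<in> topspace X \<Longrightarrow> singular_simplex n X (constant_simplex n g)"
  by (auto simp: singular_simplex_def constant_simplex_def intro: continuous_map_eq[of _ _ "\<lambda>_. g"])

lemma constant_simplex_eq_iff: "constant_simplex n g = constant_simplex n h \<longleftrightarrow> g = h"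
  using nonempty_standard_simplex[of n] by (auto simp: constant_simplex_def fun_eq_iff)

text \<open>A simplex is connected, so its image in a discrete space is a point.\<close>

lemma singular_simplex_discrete_topology:
  "singular_simplex n (discrete_topology C) s \<longleftrightarrow> (\<exists>g\<in>C. s = constant_simplex n g)"
proof
  assume s: "singular_simplex n (discrete_topology C) s"
  then have "connectedin (discrete_topology C) (s ` standard_simplex n)"
    using connectedin_continuous_map_image[of "subtopology (powertop_real UNIV) (standard_simplex n)"
        "discrete_topology C" s "standard_simplex n"] connectedin_standard_simplex[of n]
    by (simp add: singular_simplex_def connectedin_subtopology)
  then obtain g where g: "s ` standard_simplex n \<subseteq> C" "s ` standard_simplex n \<subseteq> {g}"
    unfolding connectedin_discrete_topology by blast
  moreover have "s = constant_simplex n g"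
    using g s by (intro extensionalityI[where A = "standard_simplex n"])
      (auto simp: singular_simplex_def constant_simplex_def)
  moreover obtain x where "x \<in> standard_simplex n"
    using nonempty_standard_simplex[of n] by blast
  ultimately show "\<exists>g\<in>C. s = constant_simplex n g"
    by (intro bexI[of _ g]) (auto simp: constant_simplex_def)
qed (auto intro: singular_simplex_constant)

lemma singular_face_constant:
  assumes "i \<le> Suc n"
  shows "singular_face (Suc n) i (constant_simplex (Suc n) g) = constant_simplex n g"
proof
  fix x :: "nat \<Rightarrow> real"
  show "singular_face (Suc n) i (constant_simplex (Suc n) g) x = constant_simplex n g x"
    using simplical_face_in_standard_simplex[of "Suc n" i x] assms
    by (simp add: singular_face_def constant_simplex_def)
qed

lemma sum_alternating_signs: "(\<Sum>i\<le>n. (-1) ^ i) = (if even n then 1 else 0 :: 'k::comm_ring_1)"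
  by (induction n) auto

lemma coboundary_constant:
  assumes "g \<in> topspace X"
  shows "coboundary X c (Suc n) (constant_simplex (Suc n) g) =
    (if odd n then c n (constant_simplex n g) else 0)"
proof -
  have "coboundary X c (Suc n) (constant_simplex (Suc n) g) =
      (\<Sum>i\<le>Suc n. (-1) ^ i * c n (constant_simplex n g))"
    using singular_simplex_constant[OF assms, of "Suc n"]
    by (simp add: coboundary_Suc singular_face_constant del: sum.atMost_Suc)
  also have "\<dots> = (\<Sum>i\<le>Suc n. (-1) ^ i) * c n (constant_simplex n g)"
    by (simp only: sum_distrib_right)
  finally show ?thesis
    unfolding sum_alternating_signs by simp
qed

text \<open>At a point, the cochain complex of a discrete space is \<open>K\<close> in every degree, with the coboundaries
  alternating between \<open>0\<close> and the identity. So there is no cohomology in positive degrees.\<close>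

lemma discrete_cocycle_coboundary:
  assumes c: "c \<in> cocycles (discrete_topology C)" and c0: "c 0 = 0"
  shows "c \<in> coboundaries (discrete_topology C)"
proof -
  let ?D = "discrete_topology C"
  \<comment> \<open>In odd degrees the coboundary is the identity up to a shift, so the primitive takes there the values of
    \<open>c\<close> in the next degree. A simplex is constant, and any of its points tells where it is.\<close>
  define a where "a n s = (if odd n \<and> singular_simplex n ?D s
    then c (Suc n) (constant_simplex (Suc n) (s (SOME x. x \<in> standard_simplex n))) else 0)" for n s
  have a_const: "a n (constant_simplex n g) = (if odd n then c (Suc n) (constant_simplex (Suc n) g) else 0)"
    if "g \<in> C" for n g
    using that nonempty_standard_simplex[of n] singular_simplex_constant[of g ?D n]
    by (auto simp: a_def constant_simplex_def some_in_eq)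
  have "a \<in> cochains ?D"
  proof (rule cochains_supportI[where N = "(\<lambda>n. n - 1) ` {n. c n \<noteq> 0}"])
    fix n assume "n \<notin> (\<lambda>n. n - 1) ` {n. c n \<noteq> 0}"
    then have "c (Suc n) = 0"
      by (metis (mono_tags, lifting) diff_Suc_1 imageI mem_Collect_eq)
    then show "a n = 0"
      by (simp add: a_def fun_eq_iff)
  qed (use c in \<open>auto simp: a_def cocycles_iff cochains_iff\<close>)
  moreover have "c = coboundary ?D a"
  proof (rule cochains_eqI)
    fix n s assume "singular_simplex n ?D s"
    then obtain g where g: "g \<in> C" "s = constant_simplex n g"
      by (auto simp: singular_simplex_discrete_topology)
    show "c n s = coboundary ?D a n s"
    proof (cases n)
      case (Suc m)
      have "c (Suc m) (constant_simplex (Suc m) g) = 0" if "even m"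
        using c coboundary_constant[of g ?D c "Suc m"] g that by (simp add: cocycles_iff)
      then show ?thesis
        using g Suc a_const[OF g(1), of m] coboundary_constant[of g ?D a m] by auto
    qed (simp add: c0)
  qed (use c \<open>a \<in> cochains ?D\<close> in \<open>simp_all add: cocycles_iff\<close>)
  ultimately show ?thesis
    by (simp add: coboundariesI)
qed

text \<open>The indicator function of a point, in degree \<open>0\<close>. The points of a finite discrete space yield a basis of
  its cohomology.\<close>

definition point_cochain :: "'a \<Rightarrow> ('a, 'k::field) cochain" where
  "point_cochain g = (\<lambda>n s. if n = 0 \<and> s = constant_simplex 0 g then 1 else 0)"

lemma point_cochain_cocycle [simp]:
  assumes "g \<in> C" shows "(point_cochain g :: ('a, 'k::field) cochain) \<in> cocycles (discrete_topology C)"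
    (is "?p \<in> cocycles ?D")
proof -
  have "?p \<in> cochains ?D"
  proof (rule cochains_supportI[where N = "{0}"])
    show "?p n s = 0" if "\<not> singular_simplex n ?D s" for n s
      using that assms singular_simplex_constant[of g ?D 0] by (auto simp: point_cochain_def)
  qed (simp_all add: point_cochain_def fun_eq_iff)
  moreover have "coboundary ?D ?p = 0"
  proof (rule cochains_eqI)
    fix n s assume "singular_simplex n ?D s"
    then obtain h where h: "h \<in> C" "s = constant_simplex n h"
      by (auto simp: singular_simplex_discrete_topology)
    show "coboundary ?D ?p n s = 0 n s"
      using h coboundary_constant[of h ?D ?p "n - 1"] by (cases n) (simp_all add: point_cochain_def odd_pos)
  qed (use calculation in simp_all)
  ultimately show ?thesis
    by (simp add: cocycles_iff)
qed

lemma discrete_cohomology_class: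
  assumes C: "finite C" and c: "c \<in> cocycles (discrete_topology C)"
  shows "cohomology_class (discrete_topology C) c =
    cohomology_class (discrete_topology C) (\<Sum>g\<in>C. scale (c 0 (constant_simplex 0 g)) (point_cochain g))"
proof -
  let ?D = "discrete_topology C"
  let ?p = "\<Sum>g\<in>C. scale (c 0 (constant_simplex 0 g)) (point_cochain g)"
  have p: "?p \<in> cocycles ?D"
    by (intro cocycles_sum) simp
  have "c - ?p \<in> coboundaries ?D"
  proof (rule discrete_cocycle_coboundary)
    show "(c - ?p) 0 = 0"
    proof
      fix s
      show "(c - ?p) 0 s = 0 s"
      proof (cases "singular_simplex 0 ?D s")
        case True
        then obtain h where h: "h \<in> C" "s = constant_simplex 0 h"
          by (auto simp: singular_simplex_discrete_topology)
        have "?p 0 s = (\<Sum>g\<in>C. if g = h then c 0 (constant_simplex 0 g) else 0)"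
          unfolding sum_cochain_apply
          by (intro sum.cong) (auto simp: h(2) point_cochain_def constant_simplex_eq_iff)
        then show ?thesis
          using C h by simp
      next
        case False
        then show ?thesis
          using c p by (simp add: cocycles_iff cochains_iff)
      qed
    qed
  qed (use c p in simp)
  then show ?thesis
    by (simp add: cohomology_class_eq_iff)
qed

section \<open>The product with a finite discrete space\<close>

lemma cup_unit_cochain [simp]:
  assumes "c \<in> cochains X" shows "cup X (unit_cochain X) c = c"
proof (rule cochains_eqI)
  fix n s assume s: "singular_simplex n X s"
  have "back_face 0 n s = s"
    using s by (intro ext) (simp add: back_face_def singular_simplex_def extensional_def restrict_def)
  moreover have "(\<Sum>p\<le>n. unit_cochain X p (front_face p s) * c (n - p) (back_face p (n - p) s)) =
      (\<Sum>p\<in>{0}. unit_cochain X p (front_face p s) * c (n - p) (back_face p (n - p) s))"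
    by (rule sum.mono_neutral_right) (auto simp: unit_cochain_def)
  ultimately show "cup X (unit_cochain X) c n s = c n s"
    using s singular_simplex_front_face[OF s, of 0] by (simp add: cup_apply unit_cochain_def)
qed (use assms unit_cochain_cocycle[of X] in \<open>simp_all add: cocycles_imp_cochains\<close>)

lemma continuous_slice:
  "g \<in> C \<Longrightarrow> continuous_map X (prod_topology (discrete_topology C) X) (Pair g)"
  by (simp add: continuous_map_pairwise o_def)

abbreviation sheets :: "'g set \<Rightarrow> 'a topology \<Rightarrow> ('g \<times> 'a) topology" where
  "sheets C X \<equiv> prod_topology (discrete_topology C) X"

text \<open>Every simplex of \<open>C \<times> X\<close> lies in a single slice.\<close>

lemma cochains_slices_eqI:
  assumes "c \<in> cochains (sheets C X)"
    and "d \<in> cochains (sheets C X)"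
    and eq: "\<And>g. g \<in> C \<Longrightarrow> pullback_cochain X (Pair g) c = pullback_cochain X (Pair g) d"
  shows "c = d"
proof (rule cochains_eqI[OF assms(1,2)])
  let ?P = "sheets C X"
  fix n s assume s: "singular_simplex n ?P s"
  have fst: "singular_simplex n (discrete_topology C) (simplex_map n fst s)"
    and snd: "singular_simplex n X (simplex_map n snd s)"
    using s by (auto intro!: singular_simplex_simplex_map continuous_map_fst continuous_map_snd)
  then obtain g where g: "g \<in> C" "simplex_map n fst s = constant_simplex n g"
    by (auto simp: singular_simplex_discrete_topology)
  have "simplex_map n (Pair g) (simplex_map n snd s) = s"
  proof (rule extensionalityI[where A = "standard_simplex n"])
    fix x assume x: "x \<in> standard_simplex n"
    then show "simplex_map n (Pair g) (simplex_map n snd s) x = s x"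
      using fun_cong[OF g(2), of x] by (auto simp: simplex_map_def constant_simplex_def prod_eq_iff)
  qed (use s in \<open>auto simp: simplex_map_def singular_simplex_def\<close>)
  moreover have "pullback_cochain X (Pair g) c n (simplex_map n snd s) =
      pullback_cochain X (Pair g) d n (simplex_map n snd s)"
    using eq[OF g(1)] by simp
  ultimately show "c n s = d n s"
    using snd by (simp add: pullback_cochain_apply)
qed

text \<open>The extension by zero of a cochain on the slice \<open>{g} \<times> X\<close>. Writing it as a cross product with the
  indicator function of \<open>g\<close> makes its compatibility with coboundaries an instance of the Leibniz rule.\<close>

definition extend_from_slice ::
    "'g set \<Rightarrow> 'a topology \<Rightarrow> 'g \<Rightarrow> ('a, 'k::field) cochain \<Rightarrow> ('g \<times> 'a, 'k) cochain" where
  "extend_from_slice C X g c = cup (sheets C X)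
     (pullback_cochain (sheets C X) fst (point_cochain g))
     (pullback_cochain (sheets C X) snd c)"

context
  fixes C :: "'g set" and X :: "'a topology"
  assumes finC: "finite C"
begin

lemma extend_from_slice_cochains:
  "g \<in> C \<Longrightarrow> c \<in> cochains X \<Longrightarrow> extend_from_slice C X g c \<in> cochains (sheets C X)"
  using point_cochain_cocycle[of g C] unfolding extend_from_slice_def
  by (intro cup_cochains pullback_cochains) (auto simp: cocycles_iff)

lemma pullback_extend_from_slice:
  fixes c :: "('a, 'k::field) cochain"
  assumes "g \<in> C" "h \<in> C" "c \<in> cochains X"
  shows "pullback_cochain X (Pair h) (extend_from_slice C X g c) = (if h = g then c else 0)"
proof -
  have "pullback_cochain X (\<lambda>_. h) (point_cochain g :: ('g, 'k) cochain) = (if h = g then unit_cochain X else 0)"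
    using constant_simplex_eq_iff[of 0 h g]
    by (auto simp: pullback_cochain_def point_cochain_def unit_cochain_def fun_eq_iff
        simplex_map_def constant_simplex_def o_def)
  moreover have "pullback_cochain X (\<lambda>x. x) c = c"
    using assms(3) by (intro pullback_id) auto
  ultimately show ?thesis
    using assms continuous_slice[OF assms(2), of X]
    by (simp add: extend_from_slice_def pullback_cup pullback_compose o_def)
qed

lemma coboundary_extend_from_slice:
  fixes c :: "('a, 'k::field) cochain"
  assumes "g \<in> C"
  shows "coboundary (sheets C X) (extend_from_slice C X g c) = extend_from_slice C X g (coboundary X c)"
proof -
  let ?p = "pullback_cochain (sheets C X) fst (point_cochain g) :: ('g \<times> 'a, 'k) cochain"
  have "?p \<in> cocycles (sheets C X)"
    by (rule pullback_cocycles[OF continuous_map_fst point_cochain_cocycle[OF assms]])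
  then have "coboundary (sheets C X) ?p = 0"
    by (simp add: cocycles_iff)
  moreover have "sign_cochain ?p = ?p"
    by (auto simp: sign_cochain_def pullback_cochain_def point_cochain_def fun_eq_iff)
  ultimately show ?thesis
    by (simp add: extend_from_slice_def coboundary_cup pullback_coboundary[OF continuous_map_snd])
qed

lemma cochain_sum_slices:
  assumes "c \<in> cochains (sheets C X)"
  shows "c = (\<Sum>g\<in>C. extend_from_slice C X g (pullback_cochain X (Pair g) c))"
proof (rule cochains_slices_eqI[OF assms])
  have slice: "pullback_cochain X (Pair g) c \<in> cochains X" for g
    using assms by (rule pullback_cochains)
  show "(\<Sum>g\<in>C. extend_from_slice C X g (pullback_cochain X (Pair g) c)) \<in> cochains (sheets C X)"
    by (intro cochains_sum extend_from_slice_cochains slice)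
  show "pullback_cochain X (Pair h) c = pullback_cochain X (Pair h)
      (\<Sum>g\<in>C. extend_from_slice C X g (pullback_cochain X (Pair g) c))" if "h \<in> C" for h
    using that finC by (simp add: pullback_sum pullback_extend_from_slice slice cong: sum.cong)
qed

text \<open>Primitives on the finitely many slices are extended by zero and added up.\<close>

lemma coboundaries_slices_iff:
  assumes "c \<in> cochains (sheets C X)"
  shows "c \<in> coboundaries (sheets C X) \<longleftrightarrow> (\<forall>g\<in>C. pullback_cochain X (Pair g) c \<in> coboundaries X)"
proof
  assume "\<forall>g\<in>C. pullback_cochain X (Pair g) c \<in> coboundaries X"
  then have "\<forall>g\<in>C. \<exists>a\<in>cochains X. pullback_cochain X (Pair g) c = coboundary X a"
    unfolding coboundaries_def by blast
  then obtain a where a: "\<And>g. g \<in> C \<Longrightarrow> a g \<in> cochains X"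
    "\<And>g. g \<in> C \<Longrightarrow> pullback_cochain X (Pair g) c = coboundary X (a g)"
    by metis
  have "c = coboundary (sheets C X) (\<Sum>g\<in>C. extend_from_slice C X g (a g))"
    using cochain_sum_slices[OF assms] a
    by (simp add: coboundary_sum coboundary_extend_from_slice cong: sum.cong)
  moreover have "(\<Sum>g\<in>C. extend_from_slice C X g (a g)) \<in> cochains (sheets C X)"
    by (intro cochains_sum extend_from_slice_cochains a)
  ultimately show "c \<in> coboundaries (sheets C X)"
    by (metis coboundariesI)
qed (simp add: pullback_coboundaries[OF continuous_slice])

end

section \<open>Tensor products\<close>

lemma tensor_relations_uminus:
  "u \<in> tensor_relations M N \<Longrightarrow> - u \<in> tensor_relations M N"
proof (induction rule: tensor_relations.induct)
  case (add u v)
  then show ?case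
    using tensor_relations.add[of "- u" M N "- v"] by (simp add: add.commute)
next
  case (add_left x x' y a)
  then show ?case
    using tensor_relations.add_left[of x M x' y N "- a"] by (simp add: single_uminus algebra_simps)
next
  case (add_right x y y' a)
  then show ?case
    using tensor_relations.add_right[of x M y N y' "- a"] by (simp add: single_uminus algebra_simps)
next
  case (smult_left x y b a)
  then show ?case
    using tensor_relations.smult_left[of x M y N b "- a"] by (simp add: single_uminus algebra_simps)
next
  case (smult_right x y b a)
  then show ?case
    using tensor_relations.smult_right[of x M y N b "- a"] by (simp add: single_uminus algebra_simps)
qed (simp add: tensor_relations.zero)

lemma tensor_relations_sum:
  "(\<And>i. i \<in> I \<Longrightarrow> u i \<in> tensor_relations M N) \<Longrightarrow> (\<Sum>i\<in>I. u i) \<in> tensor_relations M N"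
  by (induction I rule: infinite_finite_induct) (auto intro: tensor_relations.intros)

definition tensor_equiv ::
    "('k::field, 'v) module \<Rightarrow> ('k, 'w) module \<Rightarrow> ('v \<times> 'w \<Rightarrow>\<^sub>0 'k) \<Rightarrow> ('v \<times> 'w \<Rightarrow>\<^sub>0 'k) \<Rightarrow> bool" where
  "tensor_equiv M N u v \<longleftrightarrow> u - v \<in> tensor_relations M N"

lemma tensor_equiv_refl [simp]: "tensor_equiv M N u u"
  by (simp add: tensor_equiv_def tensor_relations.zero)

lemma tensor_equiv_sym: "tensor_equiv M N u v \<Longrightarrow> tensor_equiv M N v u"
  using tensor_relations_uminus[of "u - v"] by (simp add: tensor_equiv_def)

lemma tensor_equiv_trans [trans]:
  "tensor_equiv M N u v \<Longrightarrow> tensor_equiv M N v w \<Longrightarrow> tensor_equiv M N u w"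
  using tensor_relations.add[of "u - v" M N "v - w"] by (simp add: tensor_equiv_def)

lemma tensor_equiv_add:
  "tensor_equiv M N u u' \<Longrightarrow> tensor_equiv M N v v' \<Longrightarrow> tensor_equiv M N (u + v) (u' + v')"
  using tensor_relations.add[of "u - u'" M N "v - v'"]
  by (simp add: tensor_equiv_def algebra_simps)

lemma tensor_equiv_sum:
  "(\<And>i. i \<in> I \<Longrightarrow> tensor_equiv M N (u i) (v i)) \<Longrightarrow> tensor_equiv M N (\<Sum>i\<in>I. u i) (\<Sum>i\<in>I. v i)"
  using tensor_relations_sum[of I "\<lambda>i. u i - v i" M N] by (simp add: tensor_equiv_def sum_subtractf)

lemma tensor_class_eq_iff:
  assumes "u \<in> tensor_free M N"
  shows "tensor_class M N u = tensor_class M N v \<longleftrightarrow> tensor_equiv M N u v"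
proof
  assume eq: "tensor_class M N u = tensor_class M N v"
  have "u \<in> tensor_class M N u"
    using assms by (simp add: tensor_class_def tensor_relations.zero)
  then show "tensor_equiv M N u v"
    by (simp add: eq) (simp add: tensor_class_def tensor_equiv_def)
next
  assume uv: "tensor_equiv M N u v"
  then show "tensor_class M N u = tensor_class M N v"
    using tensor_equiv_trans[of M N _ u v] tensor_equiv_trans[of M N _ v u] tensor_equiv_sym[OF uv]
    by (auto simp: tensor_class_def tensor_equiv_def)
qed

lemma tensor_free_single [simp]:
  "x \<in> carrier M \<Longrightarrow> y \<in> carrier N \<Longrightarrow> Poly_Mapping.single (x, y) a \<in> tensor_free M N"
  by (simp add: tensor_free_def)

lemma tensor_free_diff:
  "u \<in> tensor_free M N \<Longrightarrow> v \<in> tensor_free M N \<Longrightarrow> u - v \<in> tensor_free M N"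
  using keys_diff[of u v] by (auto simp: tensor_free_def)

lemma tensor_free_sum:
  "(\<And>i. i \<in> I \<Longrightarrow> u i \<in> tensor_free M N) \<Longrightarrow> (\<Sum>i\<in>I. u i) \<in> tensor_free M N"
  using keys_sum[of u I] by (fastforce simp: tensor_free_def)

section \<open>The Kunneth isomorphism for a finite discrete factor\<close>

text \<open>Fixed choices of representatives turn the linear extension of the cross product into a map from formal
  combinations to cochains that is additive on the nose.\<close>

definition representative :: "'a topology \<Rightarrow> ('a, 'k::field) cochain set \<Rightarrow> ('a, 'k) cochain" where
  "representative X x = (SOME c. c \<in> cocycles X \<and> cohomology_class X c = x)"

lemma representative:
  assumes "x \<in> carrier (cohomology_algebra X)"
  shows "representative X x \<in> cocycles X" "cohomology_class X (representative X x) = x"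
proof -
  have "\<exists>c. c \<in> cocycles X \<and> cohomology_class X c = x"
    using assms by (auto elim: cohomology_carrierE)
  then show "representative X x \<in> cocycles X" "cohomology_class X (representative X x) = x"
    unfolding representative_def by (metis (mono_tags, lifting) someI_ex)+
qed

lemma cross_product_class:
  assumes "c \<in> cocycles Y" "d \<in> cocycles X"
  shows "cross_product Y X (cohomology_class Y c) (cohomology_class X d) =
    cohomology_class (prod_topology Y X)
      (cup (prod_topology Y X) (pullback_cochain (prod_topology Y X) fst c)
        (pullback_cochain (prod_topology Y X) snd d))"
  using assms by (simp add: cross_product_def induced_map_class[OF continuous_map_fst]
      induced_map_class[OF continuous_map_snd] cohomology_mult
      pullback_cocycles[OF continuous_map_fst] pullback_cocycles[OF continuous_map_snd])

definition cross_cochain ::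
    "'b topology \<Rightarrow> 'a topology \<Rightarrow> ('b, 'k::field) cochain set \<times> ('a, 'k) cochain set \<Rightarrow> ('b \<times> 'a, 'k) cochain"
  where "cross_cochain Y X z = cup (prod_topology Y X)
    (pullback_cochain (prod_topology Y X) fst (representative Y (fst z)))
    (pullback_cochain (prod_topology Y X) snd (representative X (snd z)))"

definition kunneth_cochain :: "'b topology \<Rightarrow> 'a topology \<Rightarrow>
    (('b, 'k::field) cochain set \<times> ('a, 'k) cochain set \<Rightarrow>\<^sub>0 'k) \<Rightarrow> ('b \<times> 'a, 'k) cochain"
  where "kunneth_cochain Y X u =
    (\<Sum>z\<in>Poly_Mapping.keys u. scale (Poly_Mapping.lookup u z) (cross_cochain Y X z))"

lemma kunneth_cochain_superset:
  assumes "finite S" "Poly_Mapping.keys u \<subseteq> S"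
  shows "kunneth_cochain Y X u = (\<Sum>z\<in>S. scale (Poly_Mapping.lookup u z) (cross_cochain Y X z))"
  unfolding kunneth_cochain_def
  by (rule sum.mono_neutral_left[OF assms]) (simp add: in_keys_iff)

lemma scale_left_diff: "scale (a - b) c = scale a c - scale b c"
  by (simp add: fun_eq_iff algebra_simps)

lemma kunneth_cochain_diff:
  "kunneth_cochain Y X (u - v) = kunneth_cochain Y X u - kunneth_cochain Y X v"
proof -
  let ?S = "Poly_Mapping.keys u \<union> Poly_Mapping.keys v"
  show ?thesis
    using keys_diff[of u v] kunneth_cochain_superset[of ?S "u - v" Y X]
      kunneth_cochain_superset[of ?S u Y X] kunneth_cochain_superset[of ?S v Y X]
    by (simp add: lookup_minus scale_left_diff sum_subtractf)
qed

lemma kunneth_cochain_single: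
  "kunneth_cochain Y X (Poly_Mapping.single z a) = scale a (cross_cochain Y X z)"
  using kunneth_cochain_superset[of "{z}" "Poly_Mapping.single z a" Y X] by simp

lemma kunneth_cochain_add:
  "kunneth_cochain Y X (u + v) = kunneth_cochain Y X u + kunneth_cochain Y X v"
  using kunneth_cochain_diff[of Y X "u + v" v] by simp

lemma kunneth_cochain_sum:
  "kunneth_cochain Y X (\<Sum>i\<in>I. u i) = (\<Sum>i\<in>I. kunneth_cochain Y X (u i))"
proof (induction I rule: infinite_finite_induct)
  case (insert i I)
  then show ?case by (simp only: sum.insert kunneth_cochain_add simp_thms not_False_eq_True)
qed (simp_all add: kunneth_cochain_def)

lemma cross_cochain_cocycle:
  assumes "x \<in> carrier (cohomology_algebra Y)" "y \<in> carrier (cohomology_algebra X)"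
  shows "cross_cochain Y X (x, y) \<in> cocycles (prod_topology Y X)"
  using representative(1)[OF assms(1)] representative(1)[OF assms(2)]
  by (simp add: cross_cochain_def pullback_cocycles[OF continuous_map_fst]
      pullback_cocycles[OF continuous_map_snd])

lemma cross_product_eq_class:
  assumes "x \<in> carrier (cohomology_algebra Y)" "y \<in> carrier (cohomology_algebra X)"
  shows "cross_product Y X x y = cohomology_class (prod_topology Y X) (cross_cochain Y X (x, y))"
  using cross_product_class[OF representative(1)[OF assms(1)] representative(1)[OF assms(2)]]
    representative(2)[OF assms(1)] representative(2)[OF assms(2)]
  by (simp add: cross_cochain_def)

lemma cross_cochain_class:
  assumes "c \<in> cocycles Y" "d \<in> cocycles X"
  shows "cross_cochain Y X (cohomology_class Y c, cohomology_class X d) -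
    cup (prod_topology Y X) (pullback_cochain (prod_topology Y X) fst c)
      (pullback_cochain (prod_topology Y X) snd d) \<in> coboundaries (prod_topology Y X)"
  using cross_product_class[OF assms]
    cross_product_eq_class[OF cohomology_class_carrier[OF assms(1)] cohomology_class_carrier[OF assms(2)]]
  by (simp flip: cohomology_class_eq_iff)

text \<open>This makes the Kunneth map independent of the formal combination that represents a tensor.\<close>

lemma kunneth_cochain_relations:
  assumes "u \<in> tensor_relations (cohomology_algebra Y) (cohomology_algebra X)"
  shows "kunneth_cochain Y X u \<in> coboundaries (prod_topology Y X)"
  using assms
proof (induction rule: tensor_relations.induct)
  case zero
  show ?case
    unfolding kunneth_cochain_def keys_zero sum.empty by (rule coboundaries_closed(1))
next
  case (add u v)
  then show ?case
    unfolding kunneth_cochain_add by (intro coboundaries_closed(2))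
next
  case (add_left x x' y a)
  obtain c c' d where c: "c \<in> cocycles Y" "x = cohomology_class Y c"
    and c': "c' \<in> cocycles Y" "x' = cohomology_class Y c'"
    and d: "d \<in> cocycles X" "y = cohomology_class X d"
    using add_left by (meson cohomology_carrierE)
  have "scale a (cross_cochain Y X (cohomology_class Y (c + c'), y)
      - cross_cochain Y X (x, y) - cross_cochain Y X (x', y)) \<in> coboundaries (prod_topology Y X)"
    using coboundaries_closed(3)[OF coboundaries_closed(3)[OF
          cross_cochain_class[OF cocycles_closed(2)[OF c(1) c'(1)] d(1)]
          cross_cochain_class[OF c(1) d(1)]] cross_cochain_class[OF c'(1) d(1)]]
    by (intro coboundaries_closed(4)) (simp add: c(2) c'(2) d(2) algebra_simps)
  then show ?case
    by (simp only: kunneth_cochain_diff kunneth_cochain_single scale_simps mult.commute c(2) c'(2) cohomology_add)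
next
  case (add_right x y y' a)
  obtain c d d' where c: "c \<in> cocycles Y" "x = cohomology_class Y c"
    and d: "d \<in> cocycles X" "y = cohomology_class X d"
    and d': "d' \<in> cocycles X" "y' = cohomology_class X d'"
    using add_right by (meson cohomology_carrierE)
  have "scale a (cross_cochain Y X (x, cohomology_class X (d + d'))
      - cross_cochain Y X (x, y) - cross_cochain Y X (x, y')) \<in> coboundaries (prod_topology Y X)"
    using coboundaries_closed(3)[OF coboundaries_closed(3)[OF
          cross_cochain_class[OF c(1) cocycles_closed(2)[OF d(1) d'(1)]]
          cross_cochain_class[OF c(1) d(1)]] cross_cochain_class[OF c(1) d'(1)]]
    by (intro coboundaries_closed(4)) (simp add: c(2) d'(2) d(2) algebra_simps)
  then show ?case
    by (simp only: kunneth_cochain_diff kunneth_cochain_single scale_simps mult.commute d(2) d'(2) cohomology_add)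
next
  case (smult_left x y b a)
  obtain c d where c: "c \<in> cocycles Y" "x = cohomology_class Y c"
    and d: "d \<in> cocycles X" "y = cohomology_class X d"
    using smult_left by (meson cohomology_carrierE)
  have "scale a (cross_cochain Y X (cohomology_class Y (scale b c), y) - scale b (cross_cochain Y X (x, y)))
      \<in> coboundaries (prod_topology Y X)"
    using coboundaries_closed(3)[OF cross_cochain_class[OF cocycles_closed(4)[OF c(1)] d(1)]
          coboundaries_closed(4)[OF cross_cochain_class[OF c(1) d(1)]], of b b]
    by (intro coboundaries_closed(4)) (simp add: c(2) d(2))
  then show ?case
    by (simp only: kunneth_cochain_diff kunneth_cochain_single scale_simps mult.commute c(2) cohomology_smult)
next
  case (smult_right x y b a)
  obtain c d where c: "c \<in> cocycles Y" "x = cohomology_class Y c"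
    and d: "d \<in> cocycles X" "y = cohomology_class X d"
    using smult_right by (meson cohomology_carrierE)
  have "scale a (cross_cochain Y X (x, cohomology_class X (scale b d)) - scale b (cross_cochain Y X (x, y)))
      \<in> coboundaries (prod_topology Y X)"
    using coboundaries_closed(3)[OF cross_cochain_class[OF c(1) cocycles_closed(4)[OF d(1)]]
          coboundaries_closed(4)[OF cross_cochain_class[OF c(1) d(1)]], of b b]
    by (intro coboundaries_closed(4)) (simp add: c(2) d(2))
  then show ?case
    by (simp only: kunneth_cochain_diff kunneth_cochain_single scale_simps mult.commute d(2) cohomology_smult)
qed

lemma kunneth_cochain_cocycle:
  assumes "u \<in> tensor_free (cohomology_algebra Y) (cohomology_algebra X)"
  shows "kunneth_cochain Y X u \<in> cocycles (prod_topology Y X)"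
  unfolding kunneth_cochain_def
proof (intro cocycles_sum cocycles_closed(4))
  fix z assume "z \<in> Poly_Mapping.keys u"
  then have "fst z \<in> carrier (cohomology_algebra Y)" "snd z \<in> carrier (cohomology_algebra X)"
    using assms by (auto simp: tensor_free_def)
  then show "cross_cochain Y X z \<in> cocycles (prod_topology Y X)"
    using cross_cochain_cocycle[of "fst z" Y "snd z" X] by simp
qed

lemma kunneth_map_class:
  fixes u :: "('b, 'k::field) cochain set \<times> ('a, 'k) cochain set \<Rightarrow>\<^sub>0 'k"
  assumes u: "u \<in> tensor_free (cohomology_algebra Y) (cohomology_algebra X)"
  shows "kunneth_map Y X (tensor_class (cohomology_algebra Y) (cohomology_algebra X) u) =
    cohomology_class (prod_topology Y X) (kunneth_cochain Y X u)"
proof -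
  let ?M = "cohomology_algebra Y :: ('b, 'k) cohomology"
    and ?N = "cohomology_algebra X :: ('a, 'k) cohomology"
    and ?P = "cohomology_algebra (prod_topology Y X) :: ('b \<times> 'a, 'k) cohomology"
  let ?L = "\<lambda>u. \<Oplus>\<^bsub>?P\<^esub>z\<in>Poly_Mapping.keys u.
    Poly_Mapping.lookup u z \<odot>\<^bsub>?P\<^esub> cross_product Y X (fst z) (snd z)"
  interpret abelian_group ?P
    by (rule abelian_group_cohomology)
  have L: "?L v = cohomology_class (prod_topology Y X) (kunneth_cochain Y X v)"
    if v: "v \<in> tensor_free ?M ?N" for v
  proof -
    have z: "fst z \<in> carrier ?M" "snd z \<in> carrier ?N" if "z \<in> Poly_Mapping.keys v" for z
      using v that by (auto simp: tensor_free_def)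
    have cocycle: "scale (Poly_Mapping.lookup v z) (cross_cochain Y X z) \<in> cocycles (prod_topology Y X)"
      if "z \<in> Poly_Mapping.keys v" for z
      using cross_cochain_cocycle[OF z[OF that]] by simp
    have "?L v = (\<Oplus>\<^bsub>?P\<^esub>z\<in>Poly_Mapping.keys v.
        cohomology_class (prod_topology Y X) (scale (Poly_Mapping.lookup v z) (cross_cochain Y X z)))"
      using cocycle by (intro finsum_cong') (auto simp: cross_product_eq_class[OF z] cohomology_smult)
    then show ?thesis
      using cocycle by (simp add: cohomology_finsum kunneth_cochain_def)
  qed
  have "?L ` tensor_class ?M ?N u = {cohomology_class (prod_topology Y X) (kunneth_cochain Y X u)}"
  proof -
    have "?L v = cohomology_class (prod_topology Y X) (kunneth_cochain Y X u)"
      if "v \<in> tensor_class ?M ?N u" for v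
      using that L[of v] kunneth_cochain_relations[of "v - u" Y X]
      by (simp add: tensor_class_def cohomology_class_eq_iff kunneth_cochain_diff)
    moreover have "u \<in> tensor_class ?M ?N u"
      using u by (simp add: tensor_class_def tensor_relations.zero)
    ultimately show ?thesis by blast
  qed
  then show ?thesis
    by (simp add: kunneth_map_def tensor_lift_def)
qed

lemma tensor_equiv_single_add:
  assumes "y \<in> carrier N" "y' \<in> carrier N" "x \<in> carrier M"
  shows "tensor_equiv M N (Poly_Mapping.single (x, y) a + Poly_Mapping.single (x, y') a)
    (Poly_Mapping.single (x, y \<oplus>\<^bsub>N\<^esub> y') a)"
  using tensor_relations.add_right[OF assms(3,1,2), of a]
  by - (rule tensor_equiv_sym, simp add: tensor_equiv_def algebra_simps)

lemma tensor_equiv_single_zero: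
  assumes "x \<in> carrier (cohomology_algebra Y)"
  shows "tensor_equiv (cohomology_algebra Y) (cohomology_algebra X)
    (Poly_Mapping.single (x, cohomology_class X 0) a) 0"
  using tensor_relations.smult_right[OF assms, of "cohomology_class X 0" "cohomology_algebra X" 0 a]
  by (simp add: tensor_equiv_def cohomology_smult)

lemma tensor_equiv_single_sum_left:
  assumes "finite I" "\<And>i. i \<in> I \<Longrightarrow> c i \<in> cocycles Y" "y \<in> carrier (cohomology_algebra X)"
  shows "tensor_equiv (cohomology_algebra Y) (cohomology_algebra X)
    (Poly_Mapping.single (cohomology_class Y (\<Sum>i\<in>I. c i), y) a)
    (\<Sum>i\<in>I. Poly_Mapping.single (cohomology_class Y (c i), y) a)"
  using assms
proof (induction I rule: finite_induct)
  case empty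
  have "Poly_Mapping.single (0 \<odot>\<^bsub>cohomology_algebra Y\<^esub> cohomology_class Y 0, y) a -
      Poly_Mapping.single (cohomology_class Y 0, y) (a * 0)
      \<in> tensor_relations (cohomology_algebra Y) (cohomology_algebra X)"
    using empty.prems by (intro tensor_relations.smult_left) simp_all
  then show ?case
    by (simp only: tensor_equiv_def sum.empty cohomology_smult scale_simps mult_zero_right single_zero
        diff_zero)
next
  case (insert i I)
  let ?S = "\<lambda>c. Poly_Mapping.single (cohomology_class Y c, y) a"
  have carr: "cohomology_class Y (c i) \<in> carrier (cohomology_algebra Y)"
    "cohomology_class Y (\<Sum>i\<in>I. c i) \<in> carrier (cohomology_algebra Y)"
    using insert.prems by (auto intro!: cohomology_class_carrier cocycles_sum)
  have "tensor_equiv (cohomology_algebra Y) (cohomology_algebra X) (?S (c i + (\<Sum>i\<in>I. c i)))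
      (?S (c i) + ?S (\<Sum>i\<in>I. c i))"
    using tensor_relations.add_left[OF carr insert.prems(2), of a]
    by (simp add: tensor_equiv_def cohomology_add algebra_simps)
  also have "tensor_equiv (cohomology_algebra Y) (cohomology_algebra X)
      (?S (c i) + ?S (\<Sum>i\<in>I. c i)) (?S (c i) + (\<Sum>i\<in>I. ?S (c i)))"
    using insert by (intro tensor_equiv_add) simp_all
  finally show ?case
    using insert.hyps by (simp only: sum.insert simp_thms not_False_eq_True)
qed

text \<open>The classes of the point cochains span the cohomology of the finite discrete space, so that every tensor
  is a sum \<open>\<Sum>\<^sub>g 1\<^sub>g \<otimes> x\<^sub>g\<close>.\<close>

lemma tensor_normal_form:
  fixes X :: "'a topology" and C :: "'g set"
    and u :: "('g, 'k::field) cochain set \<times> ('a, 'k) cochain set \<Rightarrow>\<^sub>0 'k"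
  defines "M \<equiv> cohomology_algebra (discrete_topology C)" and "N \<equiv> cohomology_algebra X"
  assumes C: "finite C" and u: "u \<in> tensor_free M N"
  obtains d where "\<And>g. g \<in> C \<Longrightarrow> d g \<in> cocycles X"
    and "tensor_equiv M N u (\<Sum>g\<in>C. Poly_Mapping.single
      (cohomology_class (discrete_topology C) (point_cochain g), cohomology_class X (d g)) 1)"
proof -
  let ?D = "discrete_topology C"
  let ?S = "\<lambda>d. \<Sum>g\<in>C. Poly_Mapping.single
      (cohomology_class ?D (point_cochain g), cohomology_class X (d g)) (1::'k)"
  have point: "cohomology_class ?D (point_cochain g) \<in> carrier M" if "g \<in> C" for g
    using that unfolding M_def by (intro cohomology_class_carrier point_cochain_cocycle)
  have monomial: "\<exists>d. (\<forall>g\<in>C. d g \<in> cocycles X) \<and> tensor_equiv M N (Poly_Mapping.single z a) (?S d)"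
    if z: "z \<in> carrier M \<times> carrier N" for z a
  proof -
    obtain c e where c: "c \<in> cocycles ?D" and e: "e \<in> cocycles X"
      and z_eq: "z = (cohomology_class ?D c, cohomology_class X e)"
      using z by (auto simp: M_def N_def elim!: cohomology_carrierE)
    define r where "r g = c 0 (constant_simplex 0 g)" for g
    have "tensor_equiv M N (Poly_Mapping.single z a) (\<Sum>g\<in>C. Poly_Mapping.single
        (cohomology_class ?D (scale (r g) (point_cochain g)), cohomology_class X e) a)"
      unfolding z_eq M_def N_def discrete_cohomology_class[OF C c] r_def
      using C e by (intro tensor_equiv_single_sum_left) simp_all
    also have "tensor_equiv M N \<dots> (\<Sum>g\<in>C. Poly_Mapping.single
        (cohomology_class ?D (point_cochain g), cohomology_class X e) (a * r g))"
    proof (rule tensor_equiv_sum)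
      fix g assume "g \<in> C"
      then show "tensor_equiv M N
          (Poly_Mapping.single (cohomology_class ?D (scale (r g) (point_cochain g)), cohomology_class X e) a)
          (Poly_Mapping.single (cohomology_class ?D (point_cochain g), cohomology_class X e) (a * r g))"
        using tensor_relations.smult_left[OF point, of g "cohomology_class X e" N "r g" a] e
        by (simp add: tensor_equiv_def M_def N_def cohomology_smult)
    qed
    also have "tensor_equiv M N \<dots> (?S (\<lambda>g. scale (a * r g) e))"
    proof (rule tensor_equiv_sum)
      fix g assume "g \<in> C"
      then show "tensor_equiv M N
          (Poly_Mapping.single (cohomology_class ?D (point_cochain g), cohomology_class X e) (a * r g))
          (Poly_Mapping.single (cohomology_class ?D (point_cochain g), cohomology_class X (scale (a * r g) e)) 1)"
        using tensor_relations.smult_right[OF point, of g "cohomology_class X e" N "a * r g" 1] e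
        by - (rule tensor_equiv_sym, simp add: tensor_equiv_def N_def cohomology_smult)
    qed
    finally show ?thesis
      using e by (intro exI[of _ "\<lambda>g. scale (a * r g) e"]) simp
  qed
  have partial: "\<exists>d. (\<forall>g\<in>C. d g \<in> cocycles X) \<and>
      tensor_equiv M N (\<Sum>z\<in>Z. Poly_Mapping.single z (Poly_Mapping.lookup u z)) (?S d)"
    if "finite Z" "Z \<subseteq> carrier M \<times> carrier N" for Z
    using that
  proof (induction Z rule: finite_induct)
    case empty
    have "tensor_equiv M N (?S (\<lambda>_. 0)) (\<Sum>g\<in>C. 0)"
      using point unfolding M_def N_def by (intro tensor_equiv_sum tensor_equiv_single_zero) simp
    then have "tensor_equiv M N (\<Sum>z\<in>{}. Poly_Mapping.single z (Poly_Mapping.lookup u z)) (?S (\<lambda>_. 0))"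
      by (simp only: sum.neutral_const sum.empty tensor_equiv_sym)
    then show ?case
      by (intro exI[of _ "\<lambda>_. 0"] conjI ballI cocycles_closed(1))
  next
    case (insert z Z)
    obtain d where d: "\<forall>g\<in>C. d g \<in> cocycles X"
      "tensor_equiv M N (\<Sum>z\<in>Z. Poly_Mapping.single z (Poly_Mapping.lookup u z)) (?S d)"
      using insert.IH insert.prems by blast
    obtain e where e: "\<forall>g\<in>C. e g \<in> cocycles X"
      "tensor_equiv M N (Poly_Mapping.single z (Poly_Mapping.lookup u z)) (?S e)"
      using monomial[of z "Poly_Mapping.lookup u z"] insert.prems by blast
    have "tensor_equiv M N (\<Sum>z\<in>insert z Z. Poly_Mapping.single z (Poly_Mapping.lookup u z)) (?S e + ?S d)"
      using insert.hyps tensor_equiv_add[OF e(2) d(2)] by simp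
    also have "tensor_equiv M N (?S e + ?S d) (?S (\<lambda>g. e g + d g))"
      unfolding sum.distrib[symmetric]
    proof (rule tensor_equiv_sum)
      fix g assume g: "g \<in> C"
      then show "tensor_equiv M N
          (Poly_Mapping.single (cohomology_class ?D (point_cochain g), cohomology_class X (e g)) 1 +
            Poly_Mapping.single (cohomology_class ?D (point_cochain g), cohomology_class X (d g)) 1)
          (Poly_Mapping.single (cohomology_class ?D (point_cochain g), cohomology_class X (e g + d g)) 1)"
        using tensor_equiv_single_add[OF _ _ point[OF g], of "cohomology_class X (e g)" N
            "cohomology_class X (d g)" 1] d(1) e(1) unfolding N_def cohomology_add
        by (metis cohomology_class_carrier)
    qed
    finally have "tensor_equiv M N (\<Sum>z\<in>insert z Z. Poly_Mapping.single z (Poly_Mapping.lookup u z))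
        (?S (\<lambda>g. e g + d g))" .
    moreover have "\<forall>g\<in>C. e g + d g \<in> cocycles X"
      using d(1) e(1) by (blast intro: cocycles_closed(2))
    ultimately show ?case
      by (intro exI[of _ "\<lambda>g. e g + d g"] conjI)
  qed
  have monomials: "(\<Sum>z\<in>Poly_Mapping.keys u. Poly_Mapping.single z (Poly_Mapping.lookup u z)) = u"
    by (rule poly_mapping_eqI) (simp add: lookup_sum lookup_single when_def in_keys_iff)
  have "Poly_Mapping.keys u \<subseteq> carrier M \<times> carrier N"
    using u by (simp add: tensor_free_def)
  from partial[OF finite_keys this] show ?thesis
    unfolding monomials using that by blast
qed

text \<open>The restriction to the slice of \<open>h\<close> annihilates the summands of all other points, and so it recovers the
  coefficient of \<open>1\<^sub>h\<close>.\<close>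

lemma kunneth_cochain_normal_form:
  fixes d :: "'g \<Rightarrow> ('a, 'k::field) cochain"
  assumes C: "finite C" and d: "\<And>g. g \<in> C \<Longrightarrow> d g \<in> cocycles X" and h: "h \<in> C"
  shows "pullback_cochain X (Pair h) (kunneth_cochain (discrete_topology C) X
    (\<Sum>g\<in>C. Poly_Mapping.single
      (cohomology_class (discrete_topology C) (point_cochain g), cohomology_class X (d g)) 1)) - d h
    \<in> coboundaries X"
proof -
  let ?D = "discrete_topology C"
  let ?z = "\<lambda>g. (cohomology_class ?D (point_cochain g), cohomology_class X (d g))"
  have slice: "pullback_cochain X (Pair h) (cross_cochain ?D X (?z g)) - (if h = g then d g else 0)
      \<in> coboundaries X" if g: "g \<in> C" for g
  proof -
    have "cross_cochain ?D X (?z g) - extend_from_slice C X g (d g) \<in> coboundaries (sheets C X)"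
      unfolding extend_from_slice_def
      using g d[OF g] by (intro cross_cochain_class point_cochain_cocycle)
    then have "pullback_cochain X (Pair h) (cross_cochain ?D X (?z g) - extend_from_slice C X g (d g))
        \<in> coboundaries X"
      by (rule pullback_coboundaries[OF continuous_slice[OF h]])
    then show ?thesis
      using C g h cocycles_imp_cochains[OF d[OF g]] by (simp add: pullback_extend_from_slice)
  qed
  have "(\<Sum>g\<in>C. pullback_cochain X (Pair h) (cross_cochain ?D X (?z g)) - (if h = g then d g else 0))
      \<in> coboundaries X"
    by (intro coboundaries_sum slice)
  moreover have "(\<Sum>g\<in>C. if h = g then d g else 0) = d h"
    using C h by simp
  ultimately show ?thesis
    by (simp add: kunneth_cochain_sum kunneth_cochain_single pullback_sum sum_subtractf)
qed

text \<open>A cohomology class of \<open>C \<times> X\<close> is determined by its restrictions to the slices, which are arbitrary; by the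
  normal form the same holds for a tensor.\<close>

theorem bij_betw_kunneth_map:
  fixes X :: "'a topology" and C :: "'g set"
  assumes C: "finite C"
  shows "bij_betw (kunneth_map (discrete_topology C) X)
    (tensor_space (cohomology_algebra (discrete_topology C) :: ('g, 'k::field) cohomology)
      (cohomology_algebra X))
    (carrier (cohomology_algebra (sheets C X)))"
proof -
  let ?D = "discrete_topology C"
  let ?M = "cohomology_algebra ?D :: ('g, 'k) cohomology" and ?N = "cohomology_algebra X :: ('a, 'k) cohomology"
  let ?K = "kunneth_map ?D X" and ?k = "kunneth_cochain ?D X"
  let ?S = "\<lambda>d. \<Sum>g\<in>C. Poly_Mapping.single
      (cohomology_class ?D (point_cochain g), cohomology_class X (d g)) (1::'k)"
  have S_free: "?S d \<in> tensor_free ?M ?N" if "\<And>g. g \<in> C \<Longrightarrow> d g \<in> cocycles X" for d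
    using that by (intro tensor_free_sum tensor_free_single cohomology_class_carrier point_cochain_cocycle)
  have "inj_on ?K (tensor_space ?M ?N)"
  proof (rule inj_onI)
    fix S T assume "S \<in> tensor_space ?M ?N" "T \<in> tensor_space ?M ?N" and eq: "?K S = ?K T"
    then obtain u v where u: "u \<in> tensor_free ?M ?N" "S = tensor_class ?M ?N u"
      and v: "v \<in> tensor_free ?M ?N" "T = tensor_class ?M ?N v"
      by (auto simp: tensor_space_def)
    have k: "?k (u - v) \<in> coboundaries (sheets C X)"
      using eq u v by (simp add: kunneth_map_class cohomology_class_eq_iff kunneth_cochain_diff)
    obtain d where d: "\<And>g. g \<in> C \<Longrightarrow> d g \<in> cocycles X" "tensor_equiv ?M ?N (u - v) (?S d)"
      by (rule tensor_normal_form[OF C tensor_free_diff[OF u(1) v(1)]]) (rule that)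
    have diff: "?k (u - v) - ?k (?S d) \<in> coboundaries (sheets C X)"
      using kunneth_cochain_relations[of "u - v - ?S d" ?D X] d(2)
      by (simp add: tensor_equiv_def kunneth_cochain_diff)
    have kS: "?k (?S d) \<in> coboundaries (sheets C X)"
      using coboundaries_closed(3)[OF k diff] by (simp only: diff_diff_eq2 add_diff_cancel_left')
    have d0: "cohomology_class X (d h) = cohomology_class X 0" if h: "h \<in> C" for h
    proof -
      have "pullback_cochain X (Pair h) (?k (?S d)) \<in> coboundaries X"
        using pullback_coboundaries[OF continuous_slice[OF h] kS] .
      from coboundaries_closed(3)[OF this kunneth_cochain_normal_form[where d = d, OF C d(1) h]]
      show ?thesis
        unfolding cohomology_class_eq_iff diff_zero by (simp only: diff_diff_eq2 add_diff_cancel_left')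
    qed
    have "tensor_equiv ?M ?N (?S d) (\<Sum>g\<in>C. 0)"
      by (intro tensor_equiv_sum) (simp add: d0 tensor_equiv_single_zero)
    then have "tensor_equiv ?M ?N (u - v) 0"
      using tensor_equiv_trans[OF d(2)] by simp
    then have "tensor_equiv ?M ?N u v"
      by (simp add: tensor_equiv_def)
    then show "S = T"
      using u v by (simp add: tensor_class_eq_iff)
  qed
  moreover have "?K ` tensor_space ?M ?N = carrier (cohomology_algebra (sheets C X))"
  proof (intro equalityI subsetI)
    fix y assume "y \<in> ?K ` tensor_space ?M ?N"
    then show "y \<in> carrier (cohomology_algebra (sheets C X))"
      by (auto simp: tensor_space_def kunneth_map_class kunneth_cochain_cocycle)
  next
    fix y :: "('g \<times> 'a, 'k) cochain set" assume "y \<in> carrier (cohomology_algebra (sheets C X))"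
    then obtain c where c: "c \<in> cocycles (sheets C X)" "y = cohomology_class (sheets C X) c"
      by (rule cohomology_carrierE)
    define d where "d g = pullback_cochain X (Pair g) c" for g
    have d: "d g \<in> cocycles X" if "g \<in> C" for g
      unfolding d_def using continuous_slice[OF that] c(1) by (rule pullback_cocycles)
    have S: "?S d \<in> tensor_free ?M ?N"
      by (rule S_free) (rule d)
    then have kS: "?k (?S d) \<in> cocycles (sheets C X)"
      by (rule kunneth_cochain_cocycle)
    have "?k (?S d) - c \<in> coboundaries (sheets C X)"
    proof (subst coboundaries_slices_iff[OF C])
      show "?k (?S d) - c \<in> cochains (sheets C X)"
        using kS c(1) by (simp add: cocycles_imp_cochains)
      show "\<forall>g\<in>C. pullback_cochain X (Pair g) (?k (?S d) - c) \<in> coboundaries X"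
        using kunneth_cochain_normal_form[where d = d, OF C d] by (simp add: d_def)
    qed
    then have "?K (tensor_class ?M ?N (?S d)) = y"
      unfolding kunneth_map_class[OF S] c(2) cohomology_class_eq_iff .
    then show "y \<in> ?K ` tensor_space ?M ?N"
      unfolding tensor_space_def using S by blast
  qed
  ultimately show ?thesis
    by (simp add: bij_betw_def)
qed

section \<open>The cotensor product as the invariant classes\<close>

lemma continuous_map_action:
  assumes "\<And>g. g \<in> C \<Longrightarrow> continuous_map X Z (f g)"
  shows "continuous_map (sheets C X) Z (\<lambda>(g, x). f g x)"
  unfolding continuous_map_def
proof (intro conjI allI impI)
  show "(\<lambda>(g, x). f g x) \<in> topspace (sheets C X) \<rightarrow> topspace Z"
    using assms by (auto simp: continuous_map_def)
  fix U assume "openin Z U"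
  have "openin (sheets C X) (\<Union>g\<in>C. {g} \<times> {x \<in> topspace X. f g x \<in> U})"
    using openin_continuous_map_preimage[OF assms \<open>openin Z U\<close>]
    by (intro openin_Union) (auto simp: openin_prod_Times_iff)
  also have "(\<Union>g\<in>C. {g} \<times> {x \<in> topspace X. f g x \<in> U}) =
      {z \<in> topspace (sheets C X). (\<lambda>(g, x). f g x) z \<in> U}"
    by auto
  finally show "openin (sheets C X) {z \<in> topspace (sheets C X). (\<lambda>(g, x). f g x) z \<in> U}" .
qed

text \<open>Since the Kunneth map is bijective, \<open>\<nabla>(x) = 1 \<otimes> x\<close> says that the action and the projection
  \<open>G \<times> X \<rightarrow> X\<close> pull \<open>x\<close> back to the same class. On the slice of \<open>g\<close> these pullbacks are \<open>g\<^sup>* x\<close> and \<open>x\<close>.\<close>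

theorem coaction_eq_iff_invariant:
  fixes X :: "'a topology" and c :: "('a, 'k::field) cochain"
  assumes G: "finite (carrier G)" and act: "\<And>g. g \<in> carrier G \<Longrightarrow> continuous_map X X (\<phi> g)"
    and c: "c \<in> cocycles X"
  shows "coaction G X \<phi> (cohomology_class X c) =
      pure_tensor (dual_group_algebra G) (cohomology_algebra X) \<one>\<^bsub>dual_group_algebra G\<^esub> (cohomology_class X c)
    \<longleftrightarrow> (\<forall>g\<in>carrier G. pullback_cochain X (\<phi> g) c - c \<in> coboundaries X)"
proof -
  let ?D = "discrete_group G" and ?P = "sheets (carrier G) X"
  let ?M = "dual_group_algebra G" and ?N = "cohomology_algebra X :: ('a, 'k) cohomology"
  let ?K = "kunneth_map ?D X" and ?T = "tensor_space ?M ?N" and ?\<alpha> = "\<lambda>(g, y). \<phi> g y"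
  let ?u = "Poly_Mapping.single (\<one>\<^bsub>?M\<^esub>, cohomology_class X c) (1::'k)"
  have cont: "continuous_map ?P X ?\<alpha>"
    using act by (rule continuous_map_action)
  have bij: "bij_betw ?K ?T (carrier (cohomology_algebra ?P))"
    by (rule bij_betw_kunneth_map[OF G])
  have u: "?u \<in> tensor_free ?M ?N"
    using c by (simp add: cohomology_one)
  have pure: "pure_tensor ?M ?N \<one>\<^bsub>?M\<^esub> (cohomology_class X c) \<in> ?T"
    using u by (simp add: pure_tensor_def tensor_space_def)
  have snd: "pullback_cochain ?P snd c \<in> cocycles ?P"
    using continuous_map_snd c by (rule pullback_cocycles)
  have "?K (pure_tensor ?M ?N \<one>\<^bsub>?M\<^esub> (cohomology_class X c)) =
      cohomology_class ?P (cross_cochain ?D X (cohomology_class ?D (unit_cochain ?D), cohomology_class X c))"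
    using u by (simp add: pure_tensor_def kunneth_map_class kunneth_cochain_single cohomology_one)
  also have "\<dots> = cohomology_class ?P (pullback_cochain ?P snd c)"
    using cross_cochain_class[OF unit_cochain_cocycle[of ?D] c] snd
    by (simp add: cohomology_class_eq_iff pullback_unit_cochain[OF continuous_map_fst] cocycles_imp_cochains)
  finally have K_pure: "?K (pure_tensor ?M ?N \<one>\<^bsub>?M\<^esub> (cohomology_class X c)) =
    cohomology_class ?P (pullback_cochain ?P snd c)" .
  have ind: "induced_map ?P ?\<alpha> (cohomology_class X c) = cohomology_class ?P (pullback_cochain ?P ?\<alpha> c)"
    using cont by (rule induced_map_class)
  then have ind_carrier: "induced_map ?P ?\<alpha> (cohomology_class X c) \<in> carrier (cohomology_algebra ?P)"
    using pullback_cocycles[OF cont c] by simp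
  have "coaction G X \<phi> (cohomology_class X c) = pure_tensor ?M ?N \<one>\<^bsub>?M\<^esub> (cohomology_class X c) \<longleftrightarrow>
      induced_map ?P ?\<alpha> (cohomology_class X c) = ?K (pure_tensor ?M ?N \<one>\<^bsub>?M\<^esub> (cohomology_class X c))"
    unfolding coaction_def
    using bij_betw_inv_into_left[OF bij pure] bij_betw_inv_into_right[OF bij ind_carrier] by auto
  also have "\<dots> \<longleftrightarrow> pullback_cochain ?P ?\<alpha> c - pullback_cochain ?P snd c \<in> coboundaries ?P"
    unfolding K_pure ind by (rule cohomology_class_eq_iff)
  also have "\<dots> \<longleftrightarrow> (\<forall>g\<in>carrier G. pullback_cochain X (\<phi> g) c - c \<in> coboundaries X)"
  proof (subst coboundaries_slices_iff[OF G])
    show "pullback_cochain ?P ?\<alpha> c - pullback_cochain ?P snd c \<in> cochains ?P"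
      using pullback_cocycles[OF cont c] snd by (simp add: cocycles_imp_cochains)
    have "pullback_cochain X (\<lambda>x. x) c = c"
      using c by (intro pullback_id) (auto simp: cocycles_imp_cochains)
    then show "(\<forall>g\<in>carrier G. pullback_cochain X (Pair g)
        (pullback_cochain ?P ?\<alpha> c - pullback_cochain ?P snd c) \<in> coboundaries X) \<longleftrightarrow>
      (\<forall>g\<in>carrier G. pullback_cochain X (\<phi> g) c - c \<in> coboundaries X)"
      by (simp add: pullback_compose[OF continuous_slice] o_def)
  qed
  finally show ?thesis .
qed

section \<open>Averaging over the group\<close>

context covering_space_action
begin

abbreviation orbit_pullback ::
    "('y set, 'k::field) cochain \<Rightarrow> ('y, 'k) cochain" where
  "orbit_pullback \<equiv> pullback_cochain Y (orbit G \<psi>)"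

lemma orbit_act: "g \<in> carrier G \<Longrightarrow> y \<in> topspace Y \<Longrightarrow> orbit G \<psi> (\<psi> g y) = orbit G \<psi> y"
  using orbit_eq_iff[of y "\<psi> g y"] act_closed by blast

lemma orbit_pullback_invariant:
  assumes "g \<in> carrier G"
  shows "pullback_cochain Y (\<psi> g) (orbit_pullback b) = orbit_pullback b"
  unfolding pullback_compose[OF continuous_act[OF assms]]
  by (rule pullback_cong) (simp add: orbit_act[OF assms])

text \<open>Every simplex of the orbit space lifts.\<close>

lemma orbit_pullback_eqI:
  assumes "b \<in> cochains orbit_space" "b' \<in> cochains orbit_space" "orbit_pullback b = orbit_pullback b'"
  shows "b = b'"
proof (rule cochains_eqI[OF assms(1,2)])
  fix n \<sigma> assume "singular_simplex n orbit_space \<sigma>"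
  then obtain s where s: "singular_simplex n Y s" "simplex_map n (orbit G \<psi>) s = \<sigma>"
    by (rule singular_simplex_lift)
  have "orbit_pullback b n s = orbit_pullback b' n s"
    by (simp only: assms(3))
  then show "b n \<sigma> = b' n \<sigma>"
    using s by (simp add: pullback_cochain_apply)
qed

text \<open>The value on a simplex of the orbit space is read off from any of its lifts. They are translates of each
  other, so invariance makes the choice irrelevant. Together with injectivity, this identifies the cochains
  of the orbit space with the invariant cochains of \<open>Y\<close>.\<close>

lemma invariant_cochain_descends:
  assumes w: "w \<in> cochains Y" and inv: "\<And>g. g \<in> carrier G \<Longrightarrow> pullback_cochain Y (\<psi> g) w = w"
  obtains b where "b \<in> cochains orbit_space" "orbit_pullback b = w" "\<And>n. w n = 0 \<Longrightarrow> b n = 0"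
proof -
  define lift where "lift n \<sigma> = (SOME s. singular_simplex n Y s \<and> simplex_map n (orbit G \<psi>) s = \<sigma>)" for n \<sigma>
  define b where "b n \<sigma> = (if singular_simplex n orbit_space \<sigma> then w n (lift n \<sigma>) else 0)" for n \<sigma>
  have zero: "b n = 0" if "w n = 0" for n
    using that by (simp add: b_def fun_eq_iff)
  have b: "b \<in> cochains orbit_space"
    using w by (intro cochains_supportI[where N = "{n. w n \<noteq> 0}"]) (auto simp: b_def cochains_iff zero)
  have pb: "orbit_pullback b = w"
  proof (rule cochains_eqI[OF pullback_cochains[OF b] w])
    fix n s assume s: "singular_simplex n Y s"
    let ?\<sigma> = "simplex_map n (orbit G \<psi>) s"
    have \<sigma>: "singular_simplex n orbit_space ?\<sigma>"
      using s continuous_orbit by (rule singular_simplex_simplex_map)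
    have "singular_simplex n Y (lift n ?\<sigma>) \<and> simplex_map n (orbit G \<psi>) (lift n ?\<sigma>) = ?\<sigma>"
      unfolding lift_def by (rule someI[of _ s]) (simp add: s)
    then obtain g where g: "g \<in> carrier G" "lift n ?\<sigma> = simplex_map n (\<psi> g) s"
      using singular_simplex_lifts_translate[OF s, of "lift n ?\<sigma>"] by metis
    have "orbit_pullback b n s = w n (simplex_map n (\<psi> g) s)"
      using s \<sigma> g(2) by (simp add: pullback_cochain_apply b_def)
    also have "\<dots> = pullback_cochain Y (\<psi> g) w n s"
      using s by (simp add: pullback_cochain_apply)
    finally show "orbit_pullback b n s = w n s"
      by (simp only: inv[OF g(1)])
  qed
  show ?thesis
    by (rule that[OF b pb zero])
qed

definition average :: "('y, 'k::field) cochain \<Rightarrow> ('y, 'k) cochain" where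
  "average w = scale (inverse (of_nat (order G))) (\<Sum>g\<in>carrier G. pullback_cochain Y (\<psi> g) w)"

lemma average_invariant:
  assumes h: "h \<in> carrier G"
  shows "pullback_cochain Y (\<psi> h) (average w) = average w"
proof -
  have "pullback_cochain Y (\<psi> h) (\<Sum>g\<in>carrier G. pullback_cochain Y (\<psi> g) w) =
      (\<Sum>g\<in>carrier G. pullback_cochain Y (\<psi> (g \<otimes> h)) w)"
    unfolding pullback_sum pullback_compose[OF continuous_act[OF h]]
    by (intro sum.cong refl pullback_cong) (simp add: act_mult h)
  also have "\<dots> = (\<Sum>g\<in>carrier G. pullback_cochain Y (\<psi> g) w)"
    by (rule sum.reindex_bij_witness[where i = "\<lambda>g. g \<otimes> inv h" and j = "\<lambda>g. g \<otimes> h"])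
      (simp_all add: h m_assoc)
  finally show ?thesis
    by (simp add: average_def)
qed

lemma average_cochains: "w \<in> cochains Y \<Longrightarrow> average w \<in> cochains Y"
  unfolding average_def by (intro cochains_scale cochains_sum pullback_cochains)

lemma average_degree:
  assumes "w n = 0" shows "average w n = 0"
proof
  fix s
  have "pullback_cochain Y (\<psi> g) w n s = 0" for g
    using assms by (simp add: pullback_cochain_def)
  then show "average w n s = 0 s"
    by (simp add: average_def sum_cochain_apply)
qed

lemma coboundary_average: "coboundary Y (average w) = average (coboundary Y w)"
  by (simp add: average_def coboundary_sum pullback_coboundary[OF continuous_act] cong: sum.cong)

lemma average_diff:
  fixes w :: "('y, 'k::field) cochain"
  assumes G: "finite (carrier G)" and ord: "of_nat (order G) \<noteq> (0 :: 'k)"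
  shows "average w - w =
    scale (inverse (of_nat (order G))) (\<Sum>g\<in>carrier G. pullback_cochain Y (\<psi> g) w - w)"
proof (intro ext)
  fix n s
  show "(average w - w) n s =
    scale (inverse (of_nat (order G))) (\<Sum>g\<in>carrier G. pullback_cochain Y (\<psi> g) w - w) n s"
    using ord by (simp add: average_def sum_cochain_apply sum_subtractf order_def right_diff_distrib)
qed

text \<open>A primitive of an invariant cochain can be averaged and then descends.\<close>

lemma orbit_pullback_coboundary_imp:
  fixes b :: "('y set, 'k::field) cochain"
  assumes G: "finite (carrier G)" and ord: "of_nat (order G) \<noteq> (0 :: 'k)"
    and b: "b \<in> cochains orbit_space" and pb: "orbit_pullback b \<in> coboundaries Y"
  shows "b \<in> coboundaries orbit_space"
proof -
  obtain e where e: "e \<in> cochains Y" "orbit_pullback b = coboundary Y e"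
    using pb by (auto simp: coboundaries_def)
  obtain a where a: "a \<in> cochains orbit_space" "orbit_pullback a = average e"
    using invariant_cochain_descends[OF average_cochains[OF e(1)] average_invariant] by metis
  have "average (orbit_pullback b) - orbit_pullback b = 0"
    unfolding average_diff[OF G ord] by (simp add: orbit_pullback_invariant)
  then have "orbit_pullback b = average (coboundary Y e)"
    by (simp add: e(2))
  also have "\<dots> = orbit_pullback (coboundary orbit_space a)"
    by (simp only: pullback_coboundary[OF continuous_orbit] a(2) coboundary_average)
  finally have "b = coboundary orbit_space a"
    using a(1) b by (intro orbit_pullback_eqI) simp_all
  with a(1) show ?thesis
    by (simp add: coboundariesI)
qed

text \<open>If the class of \<open>w\<close> is invariant, then \<open>w\<close> is cohomologous to its average, which descends.\<close>

lemma invariant_class_descends: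
  fixes w :: "('y, 'k::field) cochain"
  assumes G: "finite (carrier G)" and ord: "of_nat (order G) \<noteq> (0 :: 'k)"
    and w: "w \<in> cocycles Y"
    and inv: "\<And>g. g \<in> carrier G \<Longrightarrow> pullback_cochain Y (\<psi> g) w - w \<in> coboundaries Y"
  obtains b where "b \<in> cocycles orbit_space" "orbit_pullback b - w \<in> coboundaries Y"
    "\<And>n. w n = 0 \<Longrightarrow> b n = 0"
proof -
  obtain b where b: "b \<in> cochains orbit_space" "orbit_pullback b = average w"
    "\<And>n. average w n = 0 \<Longrightarrow> b n = 0"
    using invariant_cochain_descends[OF average_cochains[OF cocycles_imp_cochains[OF w]] average_invariant]
    by metis
  have diff: "average w - w \<in> coboundaries Y"
    unfolding average_diff[OF G ord] by (intro coboundaries_closed(4) coboundaries_sum inv)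
  have "coboundary Y (average w) = average 0"
    using w by (simp add: coboundary_average cocycles_iff)
  then have "orbit_pullback (coboundary orbit_space b) = orbit_pullback 0"
    by (simp add: pullback_coboundary[OF continuous_orbit] b(2) average_def)
  then have "coboundary orbit_space b = 0"
    using b(1) by (intro orbit_pullback_eqI) simp_all
  then have cocycle: "b \<in> cocycles orbit_space"
    using b(1) by (simp add: cocycles_iff)
  show ?thesis
    by (rule that[OF cocycle diff[folded b(2)] b(3)[OF average_degree]])
qed

end

section \<open>The Borel construction\<close>

text \<open>Contracting \<open>E\<close> to \<open>e\<close> deforms the identity of \<open>E \<times> X\<close> into \<open>(y, x) \<mapsto> (e, x)\<close>.\<close>

lemma contractible_factor_pullback:
  assumes E: "contractible_space E" and e: "e \<in> topspace E"
    and w: "w \<in> cocycles (prod_topology E X)"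
  shows "pullback_cochain (prod_topology E X) snd (pullback_cochain X (Pair e) w) - w
    \<in> coboundaries (prod_topology E X)"
proof -
  let ?Y = "prod_topology E X"
  have "homotopic_with (\<lambda>x. True) E E id (\<lambda>_. e)"
    using E e by (simp add: contractible_space_alt)
  moreover have "homotopic_with (\<lambda>x. True) X X id id"
    by simp
  ultimately have "homotopic_with (\<lambda>x. True) ?Y ?Y (\<lambda>z. (id (fst z), id (snd z))) (\<lambda>z. (e, id (snd z)))"
    by (rule homotopic_with_prod_topology) simp
  then have "pullback_cochain ?Y (\<lambda>z. (e, id (snd z))) w - pullback_cochain ?Y (\<lambda>z. (id (fst z), id (snd z))) w
      \<in> coboundaries ?Y"
    using w by (rule homotopic_pullback_coboundaries)
  moreover have "pullback_cochain ?Y (\<lambda>z. (id (fst z), id (snd z))) w = w"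
    using cocycles_imp_cochains[OF w] by (intro pullback_id) auto
  moreover have "pullback_cochain ?Y snd (pullback_cochain X (Pair e) w) =
      pullback_cochain ?Y (\<lambda>z. (e, id (snd z))) w"
    by (simp add: pullback_compose[OF continuous_map_snd] o_def)
  ultimately show ?thesis
    by simp
qed

text \<open>If the nontrivial translates of \<open>U \<subseteq> E\<close> are disjoint from \<open>U\<close>, then so are those of \<open>U \<times> X\<close>.\<close>

lemma covering_space_diagonal_action:
  fixes G (structure)
  assumes G: "group G" and E: "universal_G_space G E \<psi>" and X: "continuous_action G X \<phi>"
  shows "covering_space_action G (prod_topology E X) (diagonal_action \<psi> \<phi>)"
proof -
  interpret group G by (rule G)
  have actE: "continuous_action G E \<psi>"
    using E by (simp add: universal_G_space_def)
  interpret E: continuous_group_action G E \<psi>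
    using G actE by (rule continuous_group_action_if_continuous_action)
  interpret X: continuous_group_action G X \<phi>
    using G X by (rule continuous_group_action_if_continuous_action)
  let ?Y = "prod_topology E X" and ?\<delta> = "diagonal_action \<psi> \<phi>"
  show ?thesis
  proof
    fix g assume g: "g \<in> carrier G"
    have "continuous_map ?Y ?Y (\<lambda>z. ((\<psi> g \<circ> fst) z, (\<phi> g \<circ> snd) z))"
      by (intro continuous_map_pairedI continuous_map_compose[OF continuous_map_fst E.continuous_act[OF g]]
          continuous_map_compose[OF continuous_map_snd X.continuous_act[OF g]])
    then show "continuous_map ?Y ?Y (?\<delta> g)"
      by (simp add: diagonal_action_def case_prod_unfold)
  next
    fix y assume "y \<in> topspace ?Y"
    then show "?\<delta> \<one> y = y"
      by (auto simp: diagonal_action_def E.act_one X.act_one)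
  next
    fix g h y assume "g \<in> carrier G" "h \<in> carrier G" "y \<in> topspace ?Y"
    then show "?\<delta> (g \<otimes> h) y = ?\<delta> g (?\<delta> h y)"
      by (auto simp: diagonal_action_def E.act_mult X.act_mult)
  next
    fix y assume y: "y \<in> topspace ?Y"
    then have "fst y \<in> topspace E"
      by auto
    then obtain U where U: "openin E U" "fst y \<in> U" "\<forall>g\<in>carrier G. g \<noteq> \<one> \<longrightarrow> \<psi> g ` U \<inter> U = {}"
      using E unfolding universal_G_space_def by blast
    have "openin ?Y (U \<times> topspace X)"
      using U(1) by (simp add: openin_prod_Times_iff)
    moreover have "y \<in> U \<times> topspace X"
      using y U(2) by (auto simp: mem_Times_iff)
    moreover have "?\<delta> g ` (U \<times> topspace X) \<inter> (U \<times> topspace X) = {}" if "g \<in> carrier G" "g \<noteq> \<one>" for g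
      using U(3) that by (fastforce simp: diagonal_action_def)
    ultimately show "\<exists>V. openin ?Y V \<and> y \<in> V \<and> (\<forall>g\<in>carrier G. g \<noteq> \<one> \<longrightarrow> ?\<delta> g ` V \<inter> V = {})"
      by (intro exI[of _ "U \<times> topspace X"] conjI ballI impI)
  qed
qed

theorem theorem5p2:
  fixes G :: "('g, 'm) monoid_scheme"
    and X :: "'x topology" and \<phi> :: "'g \<Rightarrow> 'x \<Rightarrow> 'x"
    and E :: "'e topology" and \<psi> :: "'g \<Rightarrow> 'e \<Rightarrow> 'e"
  assumes "group G" and "finite (carrier G)"
    and "continuous_action G X \<phi>"
    and "locally_finite_cohomology TYPE('k::field) X"
    and "of_nat (order G) \<noteq> (0 :: 'k)"
    and "universal_G_space G E \<psi>"
  shows "\<exists>h. h \<in> graded_algebra_iso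
      (cohomology_algebra (borel_construction G E \<psi> X \<phi>) :: (('e \<times> 'x) set, 'k) cohomology)
      (\<lambda>n. cohomology_group n (borel_construction G E \<psi> X \<phi>))
      (cotensor_cohomology G X \<phi>)
      (\<lambda>n. carrier (cotensor_cohomology G X \<phi>) \<inter> cohomology_group n X)"
proof -
  let ?Y = "prod_topology E X" and ?\<delta> = "diagonal_action \<psi> \<phi>"
  define B where "B = borel_construction G E \<psi> X \<phi>"
  interpret covering_space_action G ?Y ?\<delta>
    using assms(1,6,3) by (rule covering_space_diagonal_action)
  interpret X: continuous_group_action G X \<phi>
    using assms(1,3) by (rule continuous_group_action_if_continuous_action)
  have B: "B = orbit_space"
    by (simp add: B_def borel_construction_def)
  have contr: "contractible_space E" and "topspace E \<noteq> {}"
    using assms(6) unfolding universal_G_space_def by blast+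
  then obtain e where e: "e \<in> topspace E"
    by blast
  let ?j = "Pair e :: 'x \<Rightarrow> 'e \<times> 'x"
  \<comment> \<open>The fibre inclusion \<open>x \<mapsto> [e, x]\<close>; it induces the isomorphism.\<close>
  define q where "q = orbit G ?\<delta> \<circ> ?j"
  have j: "continuous_map X ?Y ?j"
    using e by (simp add: continuous_map_pairwise o_def)
  have q: "continuous_map X B q"
    unfolding q_def B using j continuous_orbit by (rule continuous_map_compose)
  let ?snd = "pullback_cochain ?Y snd :: ('x, 'k) cochain \<Rightarrow> _"
  let ?q = "pullback_cochain X q :: (('e \<times> 'x) set, 'k) cochain \<Rightarrow> _"
  have q_eq: "?q b = pullback_cochain X ?j (orbit_pullback b)" for b
    by (simp add: pullback_compose[OF j] q_def)
  have j_snd: "pullback_cochain X ?j (?snd c) = c" if "c \<in> cochains X" for c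
    unfolding pullback_compose[OF j] using that by (intro pullback_id) auto
  \<comment> \<open>Up to coboundaries, the covering projection factors as \<open>snd\<close> followed by \<open>q\<close>.\<close>
  have snd_q: "?snd (?q b) - orbit_pullback b \<in> coboundaries ?Y" if "b \<in> cocycles B" for b
    unfolding q_eq using contr e pullback_cocycles[OF continuous_orbit that[unfolded B]]
    by (rule contractible_factor_pullback)
  have snd_act: "pullback_cochain ?Y (?\<delta> g) (?snd c) = ?snd (pullback_cochain X (\<phi> g) c)"
    if g: "g \<in> carrier G" for g c
  proof -
    have "snd \<circ> ?\<delta> g = \<phi> g \<circ> snd"
      by (auto simp: diagonal_action_def)
    then show ?thesis
      by (simp only: pullback_compose[OF continuous_act[OF g]] pullback_compose[OF continuous_map_snd])
  qed
  have invariant: "cohomology_class X c \<in> carrier (cotensor_cohomology G X \<phi>) \<longleftrightarrow>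
      (\<forall>g\<in>carrier G. pullback_cochain X (\<phi> g) c - c \<in> coboundaries X)"
    if "c \<in> cocycles X" for c :: "('x, 'k) cochain"
    using coaction_eq_iff_invariant[OF assms(2) X.continuous_act that] that
    by (simp add: trivial_cotensor_def)
  have q_cocycle: "?q b \<in> cocycles X" if "b \<in> cocycles B" for b
    using q that by (rule pullback_cocycles)
  have q_invariant: "cohomology_class X (?q b) \<in> carrier (cotensor_cohomology G X \<phi>)"
    if b: "b \<in> cocycles B" for b
    unfolding invariant[OF q_cocycle[OF b]]
  proof
    \<comment> \<open>Pulled back along \<open>snd\<close>, both \<open>q\<^sup>* b\<close> and its translate become cohomologous to the invariant
      pullback of \<open>b\<close> to \<open>E \<times> X\<close>; restricting to the fibre recovers them.\<close>
    fix g assume g: "g \<in> carrier G"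
    have "pullback_cochain ?Y (?\<delta> g) (?snd (?q b) - orbit_pullback b) \<in> coboundaries ?Y"
      using continuous_act[OF g] snd_q[OF b] by (rule pullback_coboundaries)
    then have "?snd (pullback_cochain X (\<phi> g) (?q b)) - orbit_pullback b \<in> coboundaries ?Y"
      by (simp add: snd_act[OF g] orbit_pullback_invariant[OF g])
    from coboundaries_closed(3)[OF this snd_q[OF b]]
    have "?snd (pullback_cochain X (\<phi> g) (?q b) - ?q b) \<in> coboundaries ?Y"
      by simp
    then have "pullback_cochain X ?j (?snd (pullback_cochain X (\<phi> g) (?q b) - ?q b)) \<in> coboundaries X"
      by (rule pullback_coboundaries[OF j])
    then show "pullback_cochain X (\<phi> g) (?q b) - ?q b \<in> coboundaries X"
      using cocycles_imp_cochains[OF q_cocycle[OF b]] by (simp only: j_snd cochains_diff pullback_cochains)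
  qed
  \<comment> \<open>If \<open>q\<^sup>* b\<close> is a coboundary, then so is \<open>snd\<^sup>* q\<^sup>* b\<close> and with it the pullback of \<open>b\<close> to \<open>E \<times> X\<close>.\<close>
  have q_injective: "b \<in> coboundaries B" if b: "b \<in> cocycles B" and qb: "?q b \<in> coboundaries X" for b
  proof -
    have "?snd (?q b) \<in> coboundaries ?Y"
      using continuous_map_snd qb by (rule pullback_coboundaries)
    from coboundaries_closed(3)[OF this snd_q[OF b]] have "orbit_pullback b \<in> coboundaries ?Y"
      by simp
    then show ?thesis
      using orbit_pullback_coboundary_imp[OF assms(2,5)] cocycles_imp_cochains[OF b] unfolding B by blast
  qed
  \<comment> \<open>The pullback of \<open>c\<close> to \<open>E \<times> X\<close> has an invariant class as well, so it descends up to coboundaries; on the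
    fibre it is \<open>c\<close> itself.\<close>
  have q_surjective: "\<exists>b\<in>cocycles B. cohomology_class X (?q b) = cohomology_class X c \<and>
      (\<forall>n. c n = 0 \<longrightarrow> b n = 0)"
    if c: "c \<in> cocycles X" and inv: "cohomology_class X c \<in> carrier (cotensor_cohomology G X \<phi>)" for c
  proof -
    have "?snd c \<in> cocycles ?Y"
      using continuous_map_snd c by (rule pullback_cocycles)
    moreover have "pullback_cochain ?Y (?\<delta> g) (?snd c) - ?snd c \<in> coboundaries ?Y" if g: "g \<in> carrier G" for g
    proof -
      have "?snd (pullback_cochain X (\<phi> g) c - c) \<in> coboundaries ?Y"
        using inv g unfolding invariant[OF c] by (intro pullback_coboundaries[OF continuous_map_snd]) blast
      then show ?thesis
        by (simp add: snd_act[OF g])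
    qed
    ultimately obtain b where b: "b \<in> cocycles orbit_space" "orbit_pullback b - ?snd c \<in> coboundaries ?Y"
      "\<And>n. ?snd c n = 0 \<Longrightarrow> b n = 0"
      using invariant_class_descends[OF assms(2,5)] by metis
    have "pullback_cochain X ?j (orbit_pullback b - ?snd c) \<in> coboundaries X"
      using j b(2) by (rule pullback_coboundaries)
    then have "cohomology_class X (?q b) = cohomology_class X c"
      using cocycles_imp_cochains[OF c] by (simp add: cohomology_class_eq_iff q_eq j_snd)
    moreover have "b n = 0" if "c n = 0" for n
      using that by (intro b(3)) (simp add: pullback_cochain_def fun_eq_iff)
    ultimately show ?thesis
      using b(1) unfolding B by blast
  qed
  have induced: "induced_map X q (cohomology_class B b) = cohomology_class X (?q b)" for b
    using q by (rule induced_map_class)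
  let ?A = "cohomology_algebra B :: (('e \<times> 'x) set, 'k) cohomology"
  let ?C = "cotensor_cohomology G X \<phi> :: ('x, 'k) cohomology"
  have C_ops: "x \<oplus>\<^bsub>?C\<^esub> y = x \<oplus>\<^bsub>cohomology_algebra X\<^esub> y" "x \<otimes>\<^bsub>?C\<^esub> y = x \<otimes>\<^bsub>cohomology_algebra X\<^esub> y"
    "\<one>\<^bsub>?C\<^esub> = \<one>\<^bsub>cohomology_algebra X\<^esub>" "a \<odot>\<^bsub>?C\<^esub> x = a \<odot>\<^bsub>cohomology_algebra X\<^esub> x" for x y a
    by (simp_all add: trivial_cotensor_def)
  have C_carrier: "carrier ?C \<subseteq> carrier (cohomology_algebra X)"
    by (auto simp: trivial_cotensor_def)
  have "induced_map X q \<in> ring_hom ?A ?C"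
  proof (rule ring_hom_memI)
    fix x y assume "x \<in> carrier ?A" "y \<in> carrier ?A"
    then obtain b b' where b: "b \<in> cocycles B" "x = cohomology_class B b"
      and b': "b' \<in> cocycles B" "y = cohomology_class B b'"
      by (meson cohomology_carrierE)
    show "induced_map X q (x \<otimes>\<^bsub>?A\<^esub> y) = induced_map X q x \<otimes>\<^bsub>?C\<^esub> induced_map X q y"
      unfolding b(2) b'(2) C_ops
      by (simp only: cohomology_mult b(1) b'(1) q_cocycle induced pullback_cup[OF q])
    show "induced_map X q (x \<oplus>\<^bsub>?A\<^esub> y) = induced_map X q x \<oplus>\<^bsub>?C\<^esub> induced_map X q y"
      unfolding b(2) b'(2) C_ops by (simp only: cohomology_add induced pullback_linear)
  next
    fix x assume "x \<in> carrier ?A"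
    then show "induced_map X q x \<in> carrier ?C"
      by (auto elim!: cohomology_carrierE simp only: induced q_invariant)
  next
    show "induced_map X q \<one>\<^bsub>?A\<^esub> = \<one>\<^bsub>?C\<^esub>"
      unfolding C_ops cohomology_one induced pullback_unit_cochain[OF q] ..
  qed
  moreover have "bij_betw (induced_map X q) (carrier ?A) (carrier ?C)"
  proof (rule bij_betw_imageI)
    show "inj_on (induced_map X q) (carrier ?A)"
    proof (rule inj_onI)
      fix x y assume "x \<in> carrier ?A" "y \<in> carrier ?A" and eq: "induced_map X q x = induced_map X q y"
      then obtain b b' where b: "b \<in> cocycles B" "x = cohomology_class B b"
        and b': "b' \<in> cocycles B" "y = cohomology_class B b'"
        by (meson cohomology_carrierE)
      have "?q (b - b') \<in> coboundaries X"
        using eq unfolding b(2) b'(2) induced cohomology_class_eq_iff by (simp only: pullback_linear)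
      then show "x = y"
        unfolding b(2) b'(2) cohomology_class_eq_iff
        by (rule q_injective[rotated]) (use b(1) b'(1) in \<open>rule cocycles_closed(3)\<close>)
    qed
  next
    show "induced_map X q ` carrier ?A = carrier ?C"
    proof (intro equalityI subsetI)
      fix x assume "x \<in> induced_map X q ` carrier ?A"
      then show "x \<in> carrier ?C"
        by (auto elim!: cohomology_carrierE simp only: induced q_invariant)
    next
      fix x assume x: "x \<in> carrier ?C"
      then obtain c where c: "c \<in> cocycles X" "x = cohomology_class X c"
        using C_carrier by (meson cohomology_carrierE subsetD)
      obtain b where "b \<in> cocycles B" "cohomology_class X (?q b) = x"
        using q_surjective[OF c(1)] x c(2) by blast
      then show "x \<in> induced_map X q ` carrier ?A"
        using induced cohomology_class_carrier by (metis imageI)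
    qed
  qed
  moreover have "induced_map X q (a \<odot>\<^bsub>?A\<^esub> x) = a \<odot>\<^bsub>?C\<^esub> induced_map X q x"
    if x: "x \<in> carrier ?A" for a x
  proof -
    obtain b where b: "x = cohomology_class B b"
      using x by (meson cohomology_carrierE)
    show ?thesis
      unfolding b C_ops by (simp only: cohomology_smult induced pullback_linear)
  qed
  moreover have "induced_map X q ` cohomology_group n B = carrier ?C \<inter> cohomology_group n X" for n
  proof (intro equalityI subsetI)
    fix x :: "('x, 'k) cochain set"
    assume "x \<in> induced_map X q ` cohomology_group n B"
    then obtain b where b: "b \<in> cocycles B" "\<forall>m. m \<noteq> n \<longrightarrow> b m = (\<lambda>s. 0)"
      "x = induced_map X q (cohomology_class B b)"
      by (auto simp: cohomology_group_def)
    have "\<forall>m. m \<noteq> n \<longrightarrow> ?q b m = (\<lambda>s. 0)"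
      using b(2) by (simp add: pullback_cochain_def fun_eq_iff)
    then have "cohomology_class X (?q b) \<in> cohomology_group n X"
      using q_cocycle[OF b(1)] by (auto simp: cohomology_group_def)
    then show "x \<in> carrier ?C \<inter> cohomology_group n X"
      unfolding b(3) induced using q_invariant[OF b(1)] by blast
  next
    fix x :: "('x, 'k) cochain set"
    assume x: "x \<in> carrier ?C \<inter> cohomology_group n X"
    then obtain c where c: "c \<in> cocycles X" "\<forall>m. m \<noteq> n \<longrightarrow> c m = (\<lambda>s. 0)" "x = cohomology_class X c"
      by (auto simp: cohomology_group_def)
    obtain b where b: "b \<in> cocycles B" "cohomology_class X (?q b) = x" "\<forall>m. c m = 0 \<longrightarrow> b m = 0"
      using q_surjective[OF c(1)] x c(3) by blast
    have "cohomology_class B b \<in> cohomology_group n B"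
      using b(1,3) c(2) by (auto simp: cohomology_group_def zero_fun_def)
    then show "x \<in> induced_map X q ` cohomology_group n B"
      using b(2) induced by (metis imageI)
  qed
  ultimately have "induced_map X q \<in> graded_algebra_iso ?A (\<lambda>n. cohomology_group n B) ?C
      (\<lambda>n. carrier ?C \<inter> cohomology_group n X)"
    by (simp add: graded_algebra_iso_def ring_iso_def)
  then show ?thesis
    unfolding B_def by blast
qed

end
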